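(* Let $(k,\{\cdot,\cdot\})$ be a bidifferential field of characteristic zero and let $\phi:X\to Y$ be a dominant $B$-morphism of irreducible $B$-varieties over $k$. Assume that $Y$ is $B$-rational. Let $L=k(Y)$ and let $X_\alpha=\phi_L^{-1}(\alpha)$ be the generic $B$-fibre of $\phi$ over $L$, where $k(\alpha)=L$. Then the following are equivalent: (i) $X$ is $B$-rational (as a $B$-variety over $k$). (ii) The generic $B$-fibre $X_\alpha$ of $\phi$ over $k(Y)$ is $B$-rational (as a $B$-variety over $L$).
   Context: All rings are commutative and unital. A biderivation on a ring $R$ is a function $\{\cdot,\cdot\}:R\times R\to R$ such that for each $r\in R$ both $\{r,\cdot\}$ and $\{\cdot,r\}$ are derivations on $R$ (no linearity over a base is assumed); $(R,\{\cdot,\cdot\})$ is then a bidifferential ring (bidifferential field if $R$ is a field). A ring homomorphism $\phi$ of bidifferential rings is bidifferential if $\phi\{a,b\}=\{\phi a,\phi b\}$; the target is then said to be an extension of the source. A biderivation on an integral domain extends uniquely to the fraction field. A bidifferential ideal is an ideal $I$ with $\{R,I\}\subseteq I$ and $\{I,R\}\subseteq I$. A bidifferential ideal pair of $R$ is a pair of ideals $(I,J)$ with $\{I,R\}\subseteq I$ and $\{R,J\}\subseteq J$. An extension $R\to R'$ of bidifferential rings is lifting if $(IR',JR')$ is a bidifferential ideal pair of $R'$ whenever $(I,J)$ is a bidifferential ideal pair of $R$. The constants of a bidifferential ring are the elements $r$ such that $\{r,\cdot\}$ and $\{\cdot,r\}$ are identically zero. A $B$-variety over a bidifferential field $k$ is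 an affine algebraic variety $X$ over $k$ together with a biderivation on $k[X]$ extending that on $k$. A $B$-subvariety of $X$ is a subvariety whose vanishing ideal is a bidifferential ideal (it is then a $B$-variety with the induced biderivation on the quotient). A $B$-point of $X$ over $k$ is a $k$-point which as a singleton is a $B$-subvariety; the set of $B$-points over $k$ is denoted $X^\sharp(k)$. A $B$-morphism is a regular map $\phi:X\to Y$ such that $\phi^*:k[Y]\to k[X]$ is bidifferential. If $k\subseteq L$ is an extension of bidifferential fields and $X$ is a $B$-variety over $k$, write $X_L=X\times_k L$. A compatible $B$-variety structure on $X_L$ (a compatible base extension) is a biderivation on $L[X_L]=k[X]\otimes_k L$ that extends the given biderivations on $k[X]$ and on $L$, and such that $k[X]\subseteq L[X_L]$ is a lifting extension. Given a dominant $B$-morphism $\phi:X\to Y$ of irreducible $B$-varieties over $k$, a generic $B$-fibre of $\phi$ over $L$ consists of: a bidifferential field extension $L\supseteq k$; compatible base extensions $X_L$ and $Y_L$ such that $\phi_L:X_L\to Y_L$ is a $B$-morphism; and a $B$-point $\alpha\in Y_L^\sharp(L)$ that is Zariski generic in $Y_L$ over $k$ (i.e. contained in no proper closed subvariety of $Y$ defined over $k$) such that $X_\alpha:=\phi_L^{-1}(\alpha)$ is a $B$-subvariety of $X_L$. Here $L=k(Y)$ is equipped with the unique biderivation extending that of $k[Y]$; for this $L$ a generic $B$-fibre with $k(\alpha)=L$ exists. An irreducible $B$-variety $X$ over $k$ is $B$-rational if the zero ideal of $k[X]$ is $B$-rational, i.e. if every constant of the bidifferential field $k(X)=\operatorname{Frac}(k[X])$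 is algebraic over $k$; the same definition is used over $L$ (constants of $L(X_\alpha)$ are algebraic over $L$). *)

theory Defs
  imports "HOL-Algebra.Algebra"
begin

section \<open>Bidifferential rings\<close>

text \<open>
  Derivations and biderivations are only additive and Leibniz; no linearity over a base is
  assumed.
\<close>

definition derivation :: "('a, 'm) ring_scheme \<Rightarrow> ('a \<Rightarrow> 'a) \<Rightarrow> bool"
  where "derivation R d \<longleftrightarrow> d \<in> carrier R \<rightarrow> carrier R \<and>
    (\<forall>x\<in>carrier R. \<forall>y\<in>carrier R. d (x \<oplus>\<^bsub>R\<^esub> y) = d x \<oplus>\<^bsub>R\<^esub> d y) \<and>
    (\<forall>x\<in>carrier R. \<forall>y\<in>carrier R.
      d (x \<otimes>\<^bsub>R\<^esub> y) = (d x \<otimes>\<^bsub>R\<^esub> y) \<oplus>\<^bsub>R\<^esub> (x \<otimes>\<^bsub>R\<^esub> d y))"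

definition biderivation :: "('a, 'm) ring_scheme \<Rightarrow> ('a \<Rightarrow> 'a \<Rightarrow> 'a) \<Rightarrow> bool"
  where "biderivation R D \<longleftrightarrow>
    (\<forall>r\<in>carrier R. derivation R (\<lambda>s. D r s) \<and> derivation R (\<lambda>s. D s r))"

record 'a bidiff_ring = "'a ring" +
  bracket :: "['a, 'a] \<Rightarrow> 'a" (\<open>\<lbrace>_,/ _\<rbrace>\<index>\<close>)

locale bidifferential_ring = cring R for R :: "('a, 'm) bidiff_ring_scheme" (structure) +
  assumes bider: "biderivation R (bracket R)"

locale bidifferential_field = bidifferential_ring R + field R for R :: "('a, 'm) bidiff_ring_scheme" (structure)

definition bidifferential_hom ::
    "('a, 'm) bidiff_ring_scheme \<Rightarrow> ('b, 'n) bidiff_ring_scheme \<Rightarrow> ('a \<Rightarrow> 'b) \<Rightarrow> bool"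
  where "bidifferential_hom R S f \<longleftrightarrow> f \<in> ring_hom R S \<and>
    (\<forall>x\<in>carrier R. \<forall>y\<in>carrier R. f \<lbrace>x, y\<rbrace>\<^bsub>R\<^esub> = \<lbrace>f x, f y\<rbrace>\<^bsub>S\<^esub>)"

definition bidifferential_ideal :: "('a, 'm) bidiff_ring_scheme \<Rightarrow> 'a set \<Rightarrow> bool"
  where "bidifferential_ideal R I \<longleftrightarrow> ideal I R \<and>
    (\<forall>r\<in>carrier R. \<forall>x\<in>I. \<lbrace>r, x\<rbrace>\<^bsub>R\<^esub> \<in> I \<and> \<lbrace>x, r\<rbrace>\<^bsub>R\<^esub> \<in> I)"

definition bidifferential_ideal_pair :: "('a, 'm) bidiff_ring_scheme \<Rightarrow> 'a set \<Rightarrow> 'a set \<Rightarrow> bool"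
  where "bidifferential_ideal_pair R I J \<longleftrightarrow> ideal I R \<and> ideal J R \<and>
    (\<forall>x\<in>I. \<forall>r\<in>carrier R. \<lbrace>x, r\<rbrace>\<^bsub>R\<^esub> \<in> I) \<and>
    (\<forall>r\<in>carrier R. \<forall>y\<in>J. \<lbrace>r, y\<rbrace>\<^bsub>R\<^esub> \<in> J)"

definition lifting ::
    "('a, 'm) bidiff_ring_scheme \<Rightarrow> ('b, 'n) bidiff_ring_scheme \<Rightarrow> ('a \<Rightarrow> 'b) \<Rightarrow> bool"
  where "lifting R S f \<longleftrightarrow> (\<forall>I J. bidifferential_ideal_pair R I J \<longrightarrow>
    bidifferential_ideal_pair S (Idl\<^bsub>S\<^esub> (f ` I)) (Idl\<^bsub>S\<^esub> (f ` J)))"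

definition constants :: "('a, 'm) bidiff_ring_scheme \<Rightarrow> 'a set"
  where "constants R =
    {c \<in> carrier R. \<forall>r\<in>carrier R. \<lbrace>c, r\<rbrace>\<^bsub>R\<^esub> = \<zero>\<^bsub>R\<^esub> \<and> \<lbrace>r, c\<rbrace>\<^bsub>R\<^esub> = \<zero>\<^bsub>R\<^esub>}"

text \<open>
  The induced bracket on cosets; it is well defined when \<open>I\<close> is a bidifferential ideal.
\<close>

definition bidiff_quot :: "('a, 'm) bidiff_ring_scheme \<Rightarrow> 'a set \<Rightarrow> 'a set bidiff_ring"
  where "bidiff_quot R I = ring.extend (R Quot I)
    (bidiff_ring.fields (\<lambda>A B. \<Union>a\<in>A. \<Union>b\<in>B. I +>\<^bsub>R\<^esub> \<lbrace>a, b\<rbrace>\<^bsub>R\<^esub>))"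

lemma bidiff_quot_bracket:
  assumes "bidifferential_ring R" and I: "bidifferential_ideal R I"
    and ab: "a \<in> carrier R" "b \<in> carrier R"
  shows "\<lbrace>I +>\<^bsub>R\<^esub> a, I +>\<^bsub>R\<^esub> b\<rbrace>\<^bsub>bidiff_quot R I\<^esub> = I +>\<^bsub>R\<^esub> \<lbrace>a, b\<rbrace>\<^bsub>R\<^esub>"
proof -
  interpret R: bidifferential_ring R by fact
  interpret I: ideal I R using I by (simp add: bidifferential_ideal_def)
  have S: "abelian_subgroup I R"
    by (rule abelian_subgroupI3) (unfold_locales)
  have cl: "\<lbrace>x, y\<rbrace>\<^bsub>R\<^esub> \<in> carrier R" if "x \<in> carrier R" "y \<in> carrier R" for x y
    using R.bider that by (auto simp: biderivation_def derivation_def)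
  have br: "\<lbrace>x \<oplus>\<^bsub>R\<^esub> x', y\<rbrace>\<^bsub>R\<^esub> = \<lbrace>x, y\<rbrace>\<^bsub>R\<^esub> \<oplus>\<^bsub>R\<^esub> \<lbrace>x', y\<rbrace>\<^bsub>R\<^esub>"
    "\<lbrace>y, x \<oplus>\<^bsub>R\<^esub> x'\<rbrace>\<^bsub>R\<^esub> = \<lbrace>y, x\<rbrace>\<^bsub>R\<^esub> \<oplus>\<^bsub>R\<^esub> \<lbrace>y, x'\<rbrace>\<^bsub>R\<^esub>"
    if "x \<in> carrier R" "x' \<in> carrier R" "y \<in> carrier R" for x x' y
    using R.bider that by (auto simp: biderivation_def derivation_def)
  have IB: "\<lbrace>x, y\<rbrace>\<^bsub>R\<^esub> \<in> I" "\<lbrace>y, x\<rbrace>\<^bsub>R\<^esub> \<in> I" if "x \<in> I" "y \<in> carrier R" for x y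
    using I that by (auto simp: bidifferential_ideal_def)
  have "I +>\<^bsub>R\<^esub> \<lbrace>x, y\<rbrace>\<^bsub>R\<^esub> = I +>\<^bsub>R\<^esub> \<lbrace>a, b\<rbrace>\<^bsub>R\<^esub>"
    if xy: "x \<in> I +>\<^bsub>R\<^esub> a" "y \<in> I +>\<^bsub>R\<^esub> b" for x y
  proof -
    obtain i j where ij: "i \<in> I" "j \<in> I" "x = i \<oplus>\<^bsub>R\<^esub> a" "y = j \<oplus>\<^bsub>R\<^esub> b"
      using xy by (auto simp: a_r_coset_def')
    have ijc: "i \<in> carrier R" "j \<in> carrier R" using ij I.a_subset by auto
    have "\<lbrace>x, y\<rbrace>\<^bsub>R\<^esub> = (\<lbrace>i, y\<rbrace>\<^bsub>R\<^esub> \<oplus>\<^bsub>R\<^esub> \<lbrace>a, j\<rbrace>\<^bsub>R\<^esub>) \<oplus>\<^bsub>R\<^esub> \<lbrace>a, b\<rbrace>\<^bsub>R\<^esub>"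
      unfolding ij using ijc ab cl by (simp add: br R.a_ac)
    moreover have "\<lbrace>i, y\<rbrace>\<^bsub>R\<^esub> \<oplus>\<^bsub>R\<^esub> \<lbrace>a, j\<rbrace>\<^bsub>R\<^esub> \<in> I"
      using ij ijc ab IB by simp
    ultimately have "\<lbrace>x, y\<rbrace>\<^bsub>R\<^esub> \<in> I +>\<^bsub>R\<^esub> \<lbrace>a, b\<rbrace>\<^bsub>R\<^esub>"
      by (auto simp: a_r_coset_def')
    then show ?thesis
      by (rule abelian_subgroup.a_repr_independence'[OF S _ cl[OF ab], symmetric])
  qed
  moreover have "a \<in> I +>\<^bsub>R\<^esub> a" "b \<in> I +>\<^bsub>R\<^esub> b"
    using ab abelian_subgroup.a_rcos_self[OF S] by auto
  ultimately have "(\<Union>x\<in>I +>\<^bsub>R\<^esub> a. \<Union>y\<in>I +>\<^bsub>R\<^esub> b. I +>\<^bsub>R\<^esub> \<lbrace>x, y\<rbrace>\<^bsub>R\<^esub>) = I +>\<^bsub>R\<^esub> \<lbrace>a, b\<rbrace>\<^bsub>R\<^esub>"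
    by blast
  then show ?thesis
    by (simp add: bidiff_quot_def ring.defs bidiff_ring.defs)
qed


section \<open>Fraction fields\<close>

definition frac_rel :: "('a, 'm) ring_scheme \<Rightarrow> (('a \<times> 'a) \<times> ('a \<times> 'a)) set"
  where "frac_rel R = {((a, b), (c, d)).
    a \<in> carrier R \<and> b \<in> carrier R - {\<zero>\<^bsub>R\<^esub>} \<and> c \<in> carrier R \<and> d \<in> carrier R - {\<zero>\<^bsub>R\<^esub>} \<and>
    a \<otimes>\<^bsub>R\<^esub> d = c \<otimes>\<^bsub>R\<^esub> b}"

definition fraction :: "('a, 'm) ring_scheme \<Rightarrow> 'a \<Rightarrow> 'a \<Rightarrow> ('a \<times> 'a) set"
  where "fraction R a b = frac_rel R `` {(a, b)}"

definition to_frac :: "('a, 'm) ring_scheme \<Rightarrow> 'a \<Rightarrow> ('a \<times> 'a) set"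
  where "to_frac R a = fraction R a \<one>\<^bsub>R\<^esub>"

definition frac_ring :: "('a, 'm) ring_scheme \<Rightarrow> ('a \<times> 'a) set ring"
  where "frac_ring R =
    \<lparr>carrier = (carrier R \<times> (carrier R - {\<zero>\<^bsub>R\<^esub>})) // frac_rel R,
     monoid.mult = (\<lambda>x y. \<Union>(a, b)\<in>x. \<Union>(c, d)\<in>y. fraction R (a \<otimes>\<^bsub>R\<^esub> c) (b \<otimes>\<^bsub>R\<^esub> d)),
     monoid.one = fraction R \<one>\<^bsub>R\<^esub> \<one>\<^bsub>R\<^esub>,
     ring.zero = fraction R \<zero>\<^bsub>R\<^esub> \<one>\<^bsub>R\<^esub>,
     ring.add = (\<lambda>x y. \<Union>(a, b)\<in>x. \<Union>(c, d)\<in>y.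
       fraction R ((a \<otimes>\<^bsub>R\<^esub> d) \<oplus>\<^bsub>R\<^esub> (c \<otimes>\<^bsub>R\<^esub> b)) (b \<otimes>\<^bsub>R\<^esub> d))\<rparr>"

lemma frac_rel_iff:
  "((a, b), (c, d)) \<in> frac_rel R \<longleftrightarrow> a \<in> carrier R \<and> b \<in> carrier R \<and> b \<noteq> \<zero>\<^bsub>R\<^esub> \<and>
    c \<in> carrier R \<and> d \<in> carrier R \<and> d \<noteq> \<zero>\<^bsub>R\<^esub> \<and> a \<otimes>\<^bsub>R\<^esub> d = c \<otimes>\<^bsub>R\<^esub> b"
  by (auto simp: frac_rel_def)

context domain
begin

lemma equiv_frac_rel: "equiv (carrier R \<times> (carrier R - {\<zero>})) (frac_rel R)"
proof (rule equivI)
  show "frac_rel R \<subseteq> (carrier R \<times> (carrier R - {\<zero>})) \<times> (carrier R \<times> (carrier R - {\<zero>}))"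
    by (auto simp: frac_rel_def)
  show "refl_on (carrier R \<times> (carrier R - {\<zero>})) (frac_rel R)"
    by (auto simp: refl_on_def frac_rel_iff)
  show "sym (frac_rel R)"
    by (auto simp: sym_def frac_rel_iff)
  show "trans (frac_rel R)"
  proof (rule transI, clarsimp simp: frac_rel_iff)
    fix a b c d s t
    assume c: "a \<in> carrier R" "b \<in> carrier R" "c \<in> carrier R" "d \<in> carrier R" "s \<in> carrier R"
      "t \<in> carrier R" and nz: "d \<noteq> \<zero>" and 1: "a \<otimes> d = c \<otimes> b" and 2: "c \<otimes> t = s \<otimes> d"
    have "d \<otimes> (a \<otimes> t) = (a \<otimes> d) \<otimes> t" using c by algebra
    also have "\<dots> = (c \<otimes> t) \<otimes> b" unfolding 1 using c by algebra
    also have "\<dots> = d \<otimes> (s \<otimes> b)" unfolding 2 using c by algebra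
    finally show "a \<otimes> t = s \<otimes> b" using c nz m_lcancel by simp
  qed
qed

lemma fraction_eq_iff:
  assumes "a \<in> carrier R" "b \<in> carrier R" "b \<noteq> \<zero>" "c \<in> carrier R" "d \<in> carrier R" "d \<noteq> \<zero>"
  shows "fraction R a b = fraction R c d \<longleftrightarrow> a \<otimes> d = c \<otimes> b"
  unfolding fraction_def
  using eq_equiv_class_iff[OF equiv_frac_rel, of "(a, b)" "(c, d)"] assms
  by (simp add: frac_rel_iff)

lemma carrier_frac_ring:
  "carrier (frac_ring R) = {fraction R a b | a b. a \<in> carrier R \<and> b \<in> carrier R \<and> b \<noteq> \<zero>}"
  by (auto simp: frac_ring_def fraction_def quotient_def)

lemma fraction_closed [intro, simp]:
  "a \<in> carrier R \<Longrightarrow> b \<in> carrier R \<Longrightarrow> b \<noteq> \<zero> \<Longrightarrow> fraction R a b \<in> carrier (frac_ring R)"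
  by (auto simp: carrier_frac_ring)

lemma fraction_cases [cases set, consumes 1]:
  assumes "x \<in> carrier (frac_ring R)"
  obtains a b where "a \<in> carrier R" "b \<in> carrier R" "b \<noteq> \<zero>" "x = fraction R a b"
  using assms by (auto simp: carrier_frac_ring)

lemma UN_fraction:
  assumes "a \<in> carrier R" "b \<in> carrier R" "b \<noteq> \<zero>" "c \<in> carrier R" "d \<in> carrier R" "d \<noteq> \<zero>"
    and "\<And>a' b' c' d'. ((a, b), (a', b')) \<in> frac_rel R \<Longrightarrow> ((c, d), (c', d')) \<in> frac_rel R \<Longrightarrow>
      g a' b' c' d' = z"
  shows "(\<Union>(a, b)\<in>fraction R a b. \<Union>(c, d)\<in>fraction R c d. g a b c d) = z"
proof -
  have 1: "(a, b) \<in> fraction R a b" and 2: "(c, d) \<in> fraction R c d"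
    using assms(1-6) by (simp_all add: fraction_def frac_rel_iff)
  have *: "g a' b' c' d' = z" if "(a', b') \<in> fraction R a b" "(c', d') \<in> fraction R c d" for a' b' c' d'
    using that assms(7)[of a' b' c' d'] by (simp add: fraction_def)
  show ?thesis
    using 1 2 * by (fastforce split: prod.splits)
qed

lemma fraction_mult:
  assumes "a \<in> carrier R" "b \<in> carrier R" "b \<noteq> \<zero>" "c \<in> carrier R" "d \<in> carrier R" "d \<noteq> \<zero>"
  shows "fraction R a b \<otimes>\<^bsub>frac_ring R\<^esub> fraction R c d = fraction R (a \<otimes> c) (b \<otimes> d)"
  unfolding frac_ring_def monoid.simps
proof (rule UN_fraction, (fact assms)+)
  fix a' b' c' d'
  assume "((a, b), (a', b')) \<in> frac_rel R" "((c, d), (c', d')) \<in> frac_rel R"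
  then have c: "a' \<in> carrier R" "b' \<in> carrier R" "b' \<noteq> \<zero>" "c' \<in> carrier R" "d' \<in> carrier R" "d' \<noteq> \<zero>"
    and e: "a \<otimes> b' = a' \<otimes> b" "c \<otimes> d' = c' \<otimes> d" by (auto simp: frac_rel_iff)
  have "(a' \<otimes> c') \<otimes> (b \<otimes> d) = (a' \<otimes> b) \<otimes> (c' \<otimes> d)" using c assms by algebra
  also have "\<dots> = (a \<otimes> c) \<otimes> (b' \<otimes> d')" unfolding e[symmetric] using c assms by algebra
  finally show "fraction R (a' \<otimes> c') (b' \<otimes> d') = fraction R (a \<otimes> c) (b \<otimes> d)"
    using c assms by (simp add: fraction_eq_iff integral_iff)
qed

lemma fraction_add:
  assumes "a \<in> carrier R" "b \<in> carrier R" "b \<noteq> \<zero>" "c \<in> carrier R" "d \<in> carrier R" "d \<noteq> \<zero>"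
  shows "fraction R a b \<oplus>\<^bsub>frac_ring R\<^esub> fraction R c d = fraction R (a \<otimes> d \<oplus> c \<otimes> b) (b \<otimes> d)"
  unfolding frac_ring_def ring.simps
proof (rule UN_fraction, (fact assms)+)
  fix a' b' c' d'
  assume "((a, b), (a', b')) \<in> frac_rel R" "((c, d), (c', d')) \<in> frac_rel R"
  then have c: "a' \<in> carrier R" "b' \<in> carrier R" "b' \<noteq> \<zero>" "c' \<in> carrier R" "d' \<in> carrier R" "d' \<noteq> \<zero>"
    and e: "a \<otimes> b' = a' \<otimes> b" "c \<otimes> d' = c' \<otimes> d" by (auto simp: frac_rel_iff)
  have "(a' \<otimes> d' \<oplus> c' \<otimes> b') \<otimes> (b \<otimes> d) = (a' \<otimes> b) \<otimes> (d \<otimes> d') \<oplus> (c' \<otimes> d) \<otimes> (b \<otimes> b')"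
    using c assms by algebra
  also have "\<dots> = (a \<otimes> d \<oplus> c \<otimes> b) \<otimes> (b' \<otimes> d')"
    unfolding e[symmetric] using c assms by algebra
  finally show "fraction R (a' \<otimes> d' \<oplus> c' \<otimes> b') (b' \<otimes> d') = fraction R (a \<otimes> d \<oplus> c \<otimes> b) (b \<otimes> d)"
    using c assms by (simp add: fraction_eq_iff integral_iff)
qed

lemma one_frac_ring: "\<one>\<^bsub>frac_ring R\<^esub> = fraction R \<one> \<one>"
  and zero_frac_ring: "\<zero>\<^bsub>frac_ring R\<^esub> = fraction R \<zero> \<one>"
  by (simp_all add: frac_ring_def)

lemmas fraction_arith = fraction_add fraction_mult one_frac_ring zero_frac_ring

lemma field_frac_ring: "field (frac_ring R)"
proof (rule cring.cring_fieldI2)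
  show "cring (frac_ring R)"
  proof (rule cringI)
    show "abelian_group (frac_ring R)"
    proof (rule abelian_groupI)
      fix x y z assume "x \<in> carrier (frac_ring R)" "y \<in> carrier (frac_ring R)" "z \<in> carrier (frac_ring R)"
      then obtain a b c d s t where *: "a \<in> carrier R" "b \<in> carrier R" "b \<noteq> \<zero>" "x = fraction R a b"
        "c \<in> carrier R" "d \<in> carrier R" "d \<noteq> \<zero>" "y = fraction R c d"
        "s \<in> carrier R" "t \<in> carrier R" "t \<noteq> \<zero>" "z = fraction R s t"
        by (auto simp: carrier_frac_ring)
      have "((a \<otimes> d \<oplus> c \<otimes> b) \<otimes> t \<oplus> s \<otimes> (b \<otimes> d)) \<otimes> (b \<otimes> (d \<otimes> t)) =
        (a \<otimes> (d \<otimes> t) \<oplus> (c \<otimes> t \<oplus> s \<otimes> d) \<otimes> b) \<otimes> (b \<otimes> d \<otimes> t)"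
        using * by algebra
      then show "x \<oplus>\<^bsub>frac_ring R\<^esub> y \<oplus>\<^bsub>frac_ring R\<^esub> z = x \<oplus>\<^bsub>frac_ring R\<^esub> (y \<oplus>\<^bsub>frac_ring R\<^esub> z)"
        using * by (simp add: fraction_arith integral_iff fraction_eq_iff)
      have "(a \<otimes> d \<oplus> c \<otimes> b) \<otimes> (d \<otimes> b) = (c \<otimes> b \<oplus> a \<otimes> d) \<otimes> (b \<otimes> d)" using * by algebra
      then show "x \<oplus>\<^bsub>frac_ring R\<^esub> y = y \<oplus>\<^bsub>frac_ring R\<^esub> x"
        using * by (simp add: fraction_arith integral_iff fraction_eq_iff)
      show "x \<oplus>\<^bsub>frac_ring R\<^esub> y \<in> carrier (frac_ring R)"
        using * by (simp add: fraction_arith integral_iff)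
      show "\<zero>\<^bsub>frac_ring R\<^esub> \<oplus>\<^bsub>frac_ring R\<^esub> x = x"
        using * by (simp add: fraction_arith)
      have "(\<ominus> a \<otimes> b \<oplus> a \<otimes> b) = \<zero>" using * by algebra
      then have "fraction R (\<ominus> a) b \<oplus>\<^bsub>frac_ring R\<^esub> x = \<zero>\<^bsub>frac_ring R\<^esub>"
        using * by (simp add: fraction_arith integral_iff fraction_eq_iff)
      then show "\<exists>y\<in>carrier (frac_ring R). y \<oplus>\<^bsub>frac_ring R\<^esub> x = \<zero>\<^bsub>frac_ring R\<^esub>"
        using * by blast
    qed (auto simp: zero_frac_ring)
    show "Group.comm_monoid (frac_ring R)"
    proof (rule comm_monoidI)
      fix x y z assume "x \<in> carrier (frac_ring R)" "y \<in> carrier (frac_ring R)" "z \<in> carrier (frac_ring R)"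
      then obtain a b c d s t where *: "a \<in> carrier R" "b \<in> carrier R" "b \<noteq> \<zero>" "x = fraction R a b"
        "c \<in> carrier R" "d \<in> carrier R" "d \<noteq> \<zero>" "y = fraction R c d"
        "s \<in> carrier R" "t \<in> carrier R" "t \<noteq> \<zero>" "z = fraction R s t"
        by (auto simp: carrier_frac_ring)
      show "x \<otimes>\<^bsub>frac_ring R\<^esub> y \<in> carrier (frac_ring R)"
        "x \<otimes>\<^bsub>frac_ring R\<^esub> y \<otimes>\<^bsub>frac_ring R\<^esub> z = x \<otimes>\<^bsub>frac_ring R\<^esub> (y \<otimes>\<^bsub>frac_ring R\<^esub> z)"
        "x \<otimes>\<^bsub>frac_ring R\<^esub> y = y \<otimes>\<^bsub>frac_ring R\<^esub> x"
        "\<one>\<^bsub>frac_ring R\<^esub> \<otimes>\<^bsub>frac_ring R\<^esub> x = x"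
        using * by (simp_all add: fraction_arith integral_iff m_ac)
    qed (auto simp: one_frac_ring)
    fix x y z assume "x \<in> carrier (frac_ring R)" "y \<in> carrier (frac_ring R)" "z \<in> carrier (frac_ring R)"
    then obtain a b c d s t where *: "a \<in> carrier R" "b \<in> carrier R" "b \<noteq> \<zero>" "x = fraction R a b"
      "c \<in> carrier R" "d \<in> carrier R" "d \<noteq> \<zero>" "y = fraction R c d"
      "s \<in> carrier R" "t \<in> carrier R" "t \<noteq> \<zero>" "z = fraction R s t"
      by (auto simp: carrier_frac_ring)
    have "(a \<otimes> d \<oplus> c \<otimes> b) \<otimes> s \<otimes> (b \<otimes> t \<otimes> (d \<otimes> t)) =
      (a \<otimes> s \<otimes> (d \<otimes> t) \<oplus> c \<otimes> s \<otimes> (b \<otimes> t)) \<otimes> (b \<otimes> d \<otimes> t)"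
      using * by algebra
    then show "(x \<oplus>\<^bsub>frac_ring R\<^esub> y) \<otimes>\<^bsub>frac_ring R\<^esub> z =
        x \<otimes>\<^bsub>frac_ring R\<^esub> z \<oplus>\<^bsub>frac_ring R\<^esub> y \<otimes>\<^bsub>frac_ring R\<^esub> z"
      using * by (simp add: fraction_arith integral_iff fraction_eq_iff)
  qed
  show "\<zero>\<^bsub>frac_ring R\<^esub> \<noteq> \<one>\<^bsub>frac_ring R\<^esub>"
    by (simp add: fraction_arith fraction_eq_iff)
  fix x assume x: "x \<in> carrier (frac_ring R)" and nz: "x \<noteq> \<zero>\<^bsub>frac_ring R\<^esub>"
  from x obtain a b where *: "a \<in> carrier R" "b \<in> carrier R" "b \<noteq> \<zero>" "x = fraction R a b"
    by (rule fraction_cases)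
  with nz have "a \<noteq> \<zero>" by (auto simp: fraction_arith fraction_eq_iff)
  with * have "x \<otimes>\<^bsub>frac_ring R\<^esub> fraction R b a = \<one>\<^bsub>frac_ring R\<^esub>"
    by (simp add: fraction_arith integral_iff fraction_eq_iff m_comm)
  then show "\<exists>y\<in>carrier (frac_ring R). x \<otimes>\<^bsub>frac_ring R\<^esub> y = \<one>\<^bsub>frac_ring R\<^esub>"
    using * \<open>a \<noteq> \<zero>\<close> by blast
qed

lemma to_frac_closed [intro, simp]: "a \<in> carrier R \<Longrightarrow> to_frac R a \<in> carrier (frac_ring R)"
  by (simp add: to_frac_def)

lemma to_frac_hom: "to_frac R \<in> ring_hom R (frac_ring R)"
  by (rule ring_hom_memI) (auto simp: to_frac_def fraction_arith)

lemma to_frac_eq_iff: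
  "a \<in> carrier R \<Longrightarrow> b \<in> carrier R \<Longrightarrow> to_frac R a = to_frac R b \<longleftrightarrow> a = b"
  by (simp add: to_frac_def fraction_eq_iff)

lemma to_frac_nonzero:
  "a \<in> carrier R \<Longrightarrow> a \<noteq> \<zero> \<Longrightarrow> to_frac R a \<noteq> \<zero>\<^bsub>frac_ring R\<^esub>"
  by (simp add: to_frac_def fraction_arith fraction_eq_iff)

lemma frac_ring_cases [consumes 1]:
  assumes "x \<in> carrier (frac_ring R)"
  obtains a b where "a \<in> carrier R" "b \<in> carrier R" "b \<noteq> \<zero>"
    "x \<otimes>\<^bsub>frac_ring R\<^esub> to_frac R b = to_frac R a"
proof -
  obtain a b where *: "a \<in> carrier R" "b \<in> carrier R" "b \<noteq> \<zero>" "x = fraction R a b"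
    using assms by (rule fraction_cases)
  then have "x \<otimes>\<^bsub>frac_ring R\<^esub> to_frac R b = to_frac R a"
    by (simp add: to_frac_def fraction_arith fraction_eq_iff)
  with * that show thesis by blast
qed

end

text \<open>A derivation from \<open>R\<close> to its fraction field extends uniquely to the fraction field.\<close>

definition deriv_into_frac :: "('a, 'm) ring_scheme \<Rightarrow> ('a \<Rightarrow> ('a \<times> 'a) set) \<Rightarrow> bool"
  where "deriv_into_frac R d \<longleftrightarrow> d \<in> carrier R \<rightarrow> carrier (frac_ring R) \<and>
    (\<forall>a\<in>carrier R. \<forall>b\<in>carrier R. d (a \<oplus>\<^bsub>R\<^esub> b) = d a \<oplus>\<^bsub>frac_ring R\<^esub> d b) \<and>
    (\<forall>a\<in>carrier R. \<forall>b\<in>carrier R. d (a \<otimes>\<^bsub>R\<^esub> b) =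
      d a \<otimes>\<^bsub>frac_ring R\<^esub> to_frac R b \<oplus>\<^bsub>frac_ring R\<^esub> to_frac R a \<otimes>\<^bsub>frac_ring R\<^esub> d b)"

definition deriv_ext :: "('a, 'm) ring_scheme \<Rightarrow> ('a \<Rightarrow> ('a \<times> 'a) set) \<Rightarrow> ('a \<times> 'a) set \<Rightarrow> ('a \<times> 'a) set"
  where "deriv_ext R d x = (THE z. z \<in> carrier (frac_ring R) \<and>
    (\<forall>a\<in>carrier R. \<forall>b\<in>carrier R. b \<noteq> \<zero>\<^bsub>R\<^esub> \<longrightarrow> x \<otimes>\<^bsub>frac_ring R\<^esub> to_frac R b = to_frac R a \<longrightarrow>
      z \<otimes>\<^bsub>frac_ring R\<^esub> to_frac R b \<oplus>\<^bsub>frac_ring R\<^esub> x \<otimes>\<^bsub>frac_ring R\<^esub> d b = d a))"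

context
  fixes R :: "('a, 'm) ring_scheme" and F (structure) and \<iota>
  assumes domain_R: "domain R"
  defines "F \<equiv> frac_ring R" and "\<iota> \<equiv> to_frac R"
begin

interpretation R: domain R
  by (rule domain_R)

interpretation F: field F
  unfolding F_def by (rule R.field_frac_ring)

lemma iota_facts:
  shows iota_closed: "a \<in> carrier R \<Longrightarrow> \<iota> a \<in> carrier F"
    and iota_add: "a \<in> carrier R \<Longrightarrow> b \<in> carrier R \<Longrightarrow> \<iota> (a \<oplus>\<^bsub>R\<^esub> b) = \<iota> a \<oplus> \<iota> b"
    and iota_mult: "a \<in> carrier R \<Longrightarrow> b \<in> carrier R \<Longrightarrow> \<iota> (a \<otimes>\<^bsub>R\<^esub> b) = \<iota> a \<otimes> \<iota> b"
    and iota_one: "\<iota> \<one>\<^bsub>R\<^esub> = \<one>"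
    and iota_nz: "a \<in> carrier R \<Longrightarrow> a \<noteq> \<zero>\<^bsub>R\<^esub> \<Longrightarrow> \<iota> a \<noteq> \<zero>"
    and iota_inj: "a \<in> carrier R \<Longrightarrow> b \<in> carrier R \<Longrightarrow> \<iota> a = \<iota> b \<Longrightarrow> a = b"
  unfolding F_def \<iota>_def
  using R.to_frac_hom ring_hom_add[OF R.to_frac_hom] ring_hom_mult[OF R.to_frac_hom]
    ring_hom_one[OF R.to_frac_hom]
  by (simp_all add: R.to_frac_nonzero R.to_frac_eq_iff)

lemma F_cases:
  assumes "x \<in> carrier F"
  obtains a b where "a \<in> carrier R" "b \<in> carrier R" "b \<noteq> \<zero>\<^bsub>R\<^esub>" "x \<otimes> \<iota> b = \<iota> a"
  using R.frac_ring_cases[of x] assms unfolding F_def \<iota>_def by blast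

lemma cancel_iota:
  assumes "b \<in> carrier R" "b \<noteq> \<zero>\<^bsub>R\<^esub>" "x \<in> carrier F" "y \<in> carrier F" "x \<otimes> \<iota> b = y \<otimes> \<iota> b"
  shows "x = y"
  using F.m_rcancel[of "\<iota> b" x y] assms iota_facts by simp

lemma deriv_intoD:
  assumes "deriv_into_frac R d"
  shows "a \<in> carrier R \<Longrightarrow> d a \<in> carrier F"
    and "a \<in> carrier R \<Longrightarrow> b \<in> carrier R \<Longrightarrow> d (a \<oplus>\<^bsub>R\<^esub> b) = d a \<oplus> d b"
    and "a \<in> carrier R \<Longrightarrow> b \<in> carrier R \<Longrightarrow> d (a \<otimes>\<^bsub>R\<^esub> b) = d a \<otimes> \<iota> b \<oplus> \<iota> a \<otimes> d b"
  using assms unfolding deriv_into_frac_def F_def[symmetric] \<iota>_def[symmetric] by auto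

lemma deriv_ext_unique:
  assumes d: "deriv_into_frac R d" and x: "x \<in> carrier F"
    and ab: "a \<in> carrier R" "b \<in> carrier R" "b \<noteq> \<zero>\<^bsub>R\<^esub>" "x \<otimes> \<iota> b = \<iota> a"
  shows "\<exists>!z. z \<in> carrier F \<and> (\<forall>a\<in>carrier R. \<forall>b\<in>carrier R. b \<noteq> \<zero>\<^bsub>R\<^esub> \<longrightarrow> x \<otimes> \<iota> b = \<iota> a \<longrightarrow>
      z \<otimes> \<iota> b \<oplus> x \<otimes> d b = d a)"
proof -
  note D = deriv_intoD[OF d]
  define z where "z = (d a \<ominus> x \<otimes> d b) \<otimes> inv \<iota> b"
  have inv: "inv \<iota> b \<in> carrier F" "inv \<iota> b \<otimes> \<iota> b = \<one>"
    using ab iota_facts F.field_Units by auto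
  have cl: "d a \<in> carrier F" "d b \<in> carrier F" "\<iota> a \<in> carrier F" "\<iota> b \<in> carrier F"
    using ab iota_facts D by auto
  have z: "z \<in> carrier F" using cl x inv by (simp add: z_def)
  have zb: "z \<otimes> \<iota> b \<oplus> x \<otimes> d b = d a"
  proof -
    have "z \<otimes> \<iota> b = (d a \<ominus> x \<otimes> d b) \<otimes> (inv \<iota> b \<otimes> \<iota> b)"
      unfolding z_def using inv cl x by (simp add: F.m_assoc)
    then show ?thesis using inv cl x by (simp, algebra)
  qed
  show ?thesis
  proof (rule ex1I[of _ z])
    have "z \<otimes> \<iota> b' \<oplus> x \<otimes> d b' = d a'" if c: "a' \<in> carrier R" "b' \<in> carrier R" "b' \<noteq> \<zero>\<^bsub>R\<^esub>" "x \<otimes> \<iota> b' = \<iota> a'" for a' b'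
    proof -
    have cl': "d a' \<in> carrier F" "d b' \<in> carrier F" "\<iota> a' \<in> carrier F" "\<iota> b' \<in> carrier F"
      using c iota_facts D by auto
    have "\<iota> a \<otimes> \<iota> b' = \<iota> a' \<otimes> \<iota> b"
      unfolding ab(4)[symmetric] c(4)[symmetric] using cl cl' x by algebra
    then have "a \<otimes>\<^bsub>R\<^esub> b' = a' \<otimes>\<^bsub>R\<^esub> b" using ab c iota_inj by (simp add: iota_mult[symmetric])
    then have "d (a \<otimes>\<^bsub>R\<^esub> b') = d (a' \<otimes>\<^bsub>R\<^esub> b)" by simp
    then have e: "d a \<otimes> \<iota> b' \<oplus> (x \<otimes> \<iota> b) \<otimes> d b' = d a' \<otimes> \<iota> b \<oplus> (x \<otimes> \<iota> b') \<otimes> d b"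
      using ab c by (simp add: D)
    have "(z \<otimes> \<iota> b' \<oplus> x \<otimes> d b') \<otimes> \<iota> b =
        ((z \<otimes> \<iota> b \<oplus> x \<otimes> d b) \<otimes> \<iota> b' \<oplus> (x \<otimes> \<iota> b) \<otimes> d b') \<ominus> (x \<otimes> \<iota> b') \<otimes> d b"
      using z x cl cl' by algebra
    also have "\<dots> = d a' \<otimes> \<iota> b"
      unfolding zb e using z x cl cl' by algebra
    finally show ?thesis
      using cancel_iota[OF ab(2,3)] z x cl cl' by simp
    qed
    then show "z \<in> carrier F \<and> (\<forall>a\<in>carrier R. \<forall>b\<in>carrier R. b \<noteq> \<zero>\<^bsub>R\<^esub> \<longrightarrow> x \<otimes> \<iota> b = \<iota> a \<longrightarrow>
      z \<otimes> \<iota> b \<oplus> x \<otimes> d b = d a)" using z by blast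
  next
    fix w assume "w \<in> carrier F \<and> (\<forall>a\<in>carrier R. \<forall>b\<in>carrier R. b \<noteq> \<zero>\<^bsub>R\<^esub> \<longrightarrow> x \<otimes> \<iota> b = \<iota> a \<longrightarrow> w \<otimes> \<iota> b \<oplus> x \<otimes> d b = d a)"
    then have w: "w \<in> carrier F" and h: "\<forall>a\<in>carrier R. \<forall>b\<in>carrier R. b \<noteq> \<zero>\<^bsub>R\<^esub> \<longrightarrow>
      x \<otimes> \<iota> b = \<iota> a \<longrightarrow> w \<otimes> \<iota> b \<oplus> x \<otimes> d b = d a" by auto
    have "w \<otimes> \<iota> b \<oplus> x \<otimes> d b = z \<otimes> \<iota> b \<oplus> x \<otimes> d b" using h ab zb by simp
    then have "w \<otimes> \<iota> b = z \<otimes> \<iota> b" using w z x cl by simp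
    then show "w = z" using cancel_iota[OF ab(2,3)] w z by simp
  qed
qed

lemma deriv_ext_props:
  assumes d: "deriv_into_frac R d" and x: "x \<in> carrier F"
  shows "deriv_ext R d x \<in> carrier F"
    and "a \<in> carrier R \<Longrightarrow> b \<in> carrier R \<Longrightarrow> b \<noteq> \<zero>\<^bsub>R\<^esub> \<Longrightarrow> x \<otimes> \<iota> b = \<iota> a \<Longrightarrow>
      deriv_ext R d x \<otimes> \<iota> b \<oplus> x \<otimes> d b = d a"
proof -
  obtain a' b' where "a' \<in> carrier R" "b' \<in> carrier R" "b' \<noteq> \<zero>\<^bsub>R\<^esub>" "x \<otimes> \<iota> b' = \<iota> a'"
    using F_cases[OF x] .
  from theI'[OF deriv_ext_unique[OF d x this]]
  have *: "deriv_ext R d x \<in> carrier F \<and> (\<forall>a\<in>carrier R. \<forall>b\<in>carrier R. b \<noteq> \<zero>\<^bsub>R\<^esub> \<longrightarrow>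
      x \<otimes> \<iota> b = \<iota> a \<longrightarrow> deriv_ext R d x \<otimes> \<iota> b \<oplus> x \<otimes> d b = d a)"
    unfolding deriv_ext_def F_def[symmetric] \<iota>_def[symmetric] .
  then show "deriv_ext R d x \<in> carrier F" by blast
  show "a \<in> carrier R \<Longrightarrow> b \<in> carrier R \<Longrightarrow> b \<noteq> \<zero>\<^bsub>R\<^esub> \<Longrightarrow> x \<otimes> \<iota> b = \<iota> a \<Longrightarrow>
      deriv_ext R d x \<otimes> \<iota> b \<oplus> x \<otimes> d b = d a" using * by blast
qed

lemma deriv_ext_eqI:
  assumes d: "deriv_into_frac R d" and x: "x \<in> carrier F" and z: "z \<in> carrier F"
    and ab: "a \<in> carrier R" "b \<in> carrier R" "b \<noteq> \<zero>\<^bsub>R\<^esub>" "x \<otimes> \<iota> b = \<iota> a"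
    and e: "z \<otimes> \<iota> b \<oplus> x \<otimes> d b = d a"
  shows "deriv_ext R d x = z"
proof -
  have "deriv_ext R d x \<otimes> \<iota> b \<oplus> x \<otimes> d b = z \<otimes> \<iota> b \<oplus> x \<otimes> d b"
    using deriv_ext_props(2)[OF d x ab] e by simp
  moreover have "x \<otimes> d b \<in> carrier F" "\<iota> b \<in> carrier F" "deriv_ext R d x \<in> carrier F"
    using x ab deriv_intoD[OF d] iota_facts deriv_ext_props(1)[OF d x] by auto
  ultimately show ?thesis
    using cancel_iota[OF ab(2,3)] z by simp
qed

lemma deriv_ext_iota:
  assumes d: "deriv_into_frac R d" and a: "a \<in> carrier R"
  shows "deriv_ext R d (\<iota> a) = d a"
proof (rule deriv_ext_eqI[OF d _ _ a R.one_closed R.one_not_zero])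
  note D = deriv_intoD[OF d]
  have "d \<one>\<^bsub>R\<^esub> \<in> carrier F" and "d \<one>\<^bsub>R\<^esub> = d \<one>\<^bsub>R\<^esub> \<oplus> d \<one>\<^bsub>R\<^esub>"
    using D(1)[OF R.one_closed] D(3)[OF R.one_closed R.one_closed] by (simp_all add: iota_one)
  then have "d \<one>\<^bsub>R\<^esub> = \<zero>" using F.add.l_cancel_one' by auto
  then show "d a \<otimes> \<iota> \<one>\<^bsub>R\<^esub> \<oplus> \<iota> a \<otimes> d \<one>\<^bsub>R\<^esub> = d a"
    using D(1)[OF a] a by (simp add: iota_facts)
  show "\<iota> a \<in> carrier F" "d a \<in> carrier F" "\<iota> a \<otimes> \<iota> \<one>\<^bsub>R\<^esub> = \<iota> a"
    using D(1)[OF a] a by (simp_all add: iota_facts)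
qed

lemma derivation_deriv_ext:
  assumes d: "deriv_into_frac R d"
  shows "derivation F (deriv_ext R d)"
proof -
  note D = deriv_intoD[OF d] and E = deriv_ext_props[OF d]
  have "deriv_ext R d (x \<oplus> y) = deriv_ext R d x \<oplus> deriv_ext R d y \<and>
      deriv_ext R d (x \<otimes> y) = deriv_ext R d x \<otimes> y \<oplus> x \<otimes> deriv_ext R d y"
    if x: "x \<in> carrier F" and y: "y \<in> carrier F" for x y
  proof -
    obtain a b where ab: "a \<in> carrier R" "b \<in> carrier R" "b \<noteq> \<zero>\<^bsub>R\<^esub>" "x \<otimes> \<iota> b = \<iota> a"
      using F_cases[OF x] .
    obtain a' b' where c: "a' \<in> carrier R" "b' \<in> carrier R" "b' \<noteq> \<zero>\<^bsub>R\<^esub>" "y \<otimes> \<iota> b' = \<iota> a'"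
      using F_cases[OF y] .
    have cl: "\<iota> a \<in> carrier F" "\<iota> b \<in> carrier F" "\<iota> a' \<in> carrier F" "\<iota> b' \<in> carrier F"
      "d b \<in> carrier F" "d b' \<in> carrier F" "deriv_ext R d x \<in> carrier F" "deriv_ext R d y \<in> carrier F"
      using ab c x y by (auto simp: iota_facts D E)
    have da: "d a = deriv_ext R d x \<otimes> \<iota> b \<oplus> x \<otimes> d b" and da': "d a' = deriv_ext R d y \<otimes> \<iota> b' \<oplus> y \<otimes> d b'"
      using E(2)[OF x ab] E(2)[OF y c] by simp_all
    note [simp] = iota_facts(2,3) D(2,3)
    have bb: "b \<otimes>\<^bsub>R\<^esub> b' \<in> carrier R" "b \<otimes>\<^bsub>R\<^esub> b' \<noteq> \<zero>\<^bsub>R\<^esub>"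
      using ab c by (simp_all add: R.integral_iff)
    have "deriv_ext R d (x \<oplus> y) = deriv_ext R d x \<oplus> deriv_ext R d y"
    proof (rule deriv_ext_eqI[OF d _ _ _ bb])
      show "(x \<oplus> y) \<otimes> \<iota> (b \<otimes>\<^bsub>R\<^esub> b') = \<iota> (a \<otimes>\<^bsub>R\<^esub> b' \<oplus>\<^bsub>R\<^esub> a' \<otimes>\<^bsub>R\<^esub> b)"
        using ab(1-3) c(1-3) apply (simp add: ab(4)[symmetric] c(4)[symmetric])
        using x y cl by algebra
      show "(deriv_ext R d x \<oplus> deriv_ext R d y) \<otimes> \<iota> (b \<otimes>\<^bsub>R\<^esub> b') \<oplus> (x \<oplus> y) \<otimes> d (b \<otimes>\<^bsub>R\<^esub> b') =
          d (a \<otimes>\<^bsub>R\<^esub> b' \<oplus>\<^bsub>R\<^esub> a' \<otimes>\<^bsub>R\<^esub> b)"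
        using ab(1-3) c(1-3) apply (simp add: da da' ab(4)[symmetric] c(4)[symmetric])
        using x y cl by algebra
    qed (use x y cl ab c in auto)
    moreover have "deriv_ext R d (x \<otimes> y) = deriv_ext R d x \<otimes> y \<oplus> x \<otimes> deriv_ext R d y"
    proof (rule deriv_ext_eqI[OF d _ _ _ bb])
      show "(x \<otimes> y) \<otimes> \<iota> (b \<otimes>\<^bsub>R\<^esub> b') = \<iota> (a \<otimes>\<^bsub>R\<^esub> a')"
        using ab(1-3) c(1-3) apply (simp add: ab(4)[symmetric] c(4)[symmetric])
        using x y cl by algebra
      show "(deriv_ext R d x \<otimes> y \<oplus> x \<otimes> deriv_ext R d y) \<otimes> \<iota> (b \<otimes>\<^bsub>R\<^esub> b') \<oplus> (x \<otimes> y) \<otimes> d (b \<otimes>\<^bsub>R\<^esub> b') =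
          d (a \<otimes>\<^bsub>R\<^esub> a')"
        using ab(1-3) c(1-3) apply (simp add: da da' ab(4)[symmetric] c(4)[symmetric])
        using x y cl by algebra
    qed (use x y cl ab c in auto)
    ultimately show ?thesis ..
  qed
  then show ?thesis
    using E(1) by (auto simp: derivation_def)
qed

text \<open>A derivation of the fraction field is determined by its values on \<open>R\<close>.\<close>

lemma deriv_into_frac_comp:
  assumes "derivation F D"
  shows "deriv_into_frac R (\<lambda>a. D (\<iota> a))"
  using assms iota_facts
  unfolding deriv_into_frac_def derivation_def F_def[symmetric] \<iota>_def[symmetric]
  by (auto simp: Pi_iff)

lemma derivation_frac_determined:
  assumes D: "derivation F D" and d: "\<And>a. a \<in> carrier R \<Longrightarrow> D (\<iota> a) = d a"
    and "deriv_into_frac R d" and x: "x \<in> carrier F"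
  shows "D x = deriv_ext R d x"
proof -
  obtain a b where ab: "a \<in> carrier R" "b \<in> carrier R" "b \<noteq> \<zero>\<^bsub>R\<^esub>" "x \<otimes> \<iota> b = \<iota> a"
    using F_cases[OF x] .
  have "D x \<otimes> \<iota> b \<oplus> x \<otimes> d b = d a"
    using D x ab iota_closed[of b] unfolding derivation_def
    by (simp add: d[symmetric] ab(4)[symmetric])
  then show ?thesis
    using deriv_ext_eqI[OF assms(3) x _ ab] D x by (auto simp: derivation_def)
qed

lemma biderivation_frac_exists:
  assumes B: "biderivation R B"
  shows "\<exists>D. biderivation F D \<and> (\<forall>a\<in>carrier R. \<forall>b\<in>carrier R. D (\<iota> a) (\<iota> b) = \<iota> (B a b))"
proof -
  have Bc: "B a b \<in> carrier R" if "a \<in> carrier R" "b \<in> carrier R" for a b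
    using B that by (auto simp: biderivation_def derivation_def)
  have Br: "B a (b \<oplus>\<^bsub>R\<^esub> c) = B a b \<oplus>\<^bsub>R\<^esub> B a c"
    "B a (b \<otimes>\<^bsub>R\<^esub> c) = B a b \<otimes>\<^bsub>R\<^esub> c \<oplus>\<^bsub>R\<^esub> b \<otimes>\<^bsub>R\<^esub> B a c"
    "B (b \<oplus>\<^bsub>R\<^esub> c) a = B b a \<oplus>\<^bsub>R\<^esub> B c a"
    "B (b \<otimes>\<^bsub>R\<^esub> c) a = B b a \<otimes>\<^bsub>R\<^esub> c \<oplus>\<^bsub>R\<^esub> b \<otimes>\<^bsub>R\<^esub> B c a"
    if "a \<in> carrier R" "b \<in> carrier R" "c \<in> carrier R" for a b c
    using B that by (auto simp: biderivation_def derivation_def)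
  note [simp] = iota_facts(1-3) Bc Br
  define E where "E r = deriv_ext R (\<lambda>b. \<iota> (B r b))" for r
  have d1: "deriv_into_frac R (\<lambda>b. \<iota> (B r b))" if "r \<in> carrier R" for r
    using that unfolding deriv_into_frac_def F_def[symmetric] \<iota>_def[symmetric] by auto
  have dE: "derivation F (E r)" if "r \<in> carrier R" for r
    unfolding E_def by (rule derivation_deriv_ext[OF d1[OF that]])
  have Ec: "E r y \<in> carrier F" if "r \<in> carrier R" "y \<in> carrier F" for r y
    using dE[OF that(1)] that by (auto simp: derivation_def)
  have d2: "deriv_into_frac R (\<lambda>r. E r y)" if y: "y \<in> carrier F" for y
  proof -
    obtain a b where ab: "a \<in> carrier R" "b \<in> carrier R" "b \<noteq> \<zero>\<^bsub>R\<^esub>" "y \<otimes> \<iota> b = \<iota> a"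
      using F_cases[OF y] .
    have Er: "\<iota> (B r a) = E r y \<otimes> \<iota> b \<oplus> y \<otimes> \<iota> (B r b)" if "r \<in> carrier R" for r
      unfolding E_def using deriv_ext_props(2)[OF d1[OF that] y ab] by simp
    have "E (r \<oplus>\<^bsub>R\<^esub> s) y = E r y \<oplus> E s y \<and> E (r \<otimes>\<^bsub>R\<^esub> s) y = E r y \<otimes> \<iota> s \<oplus> \<iota> r \<otimes> E s y"
      if rs: "r \<in> carrier R" "s \<in> carrier R" for r s
    proof
      have cl: "E r y \<in> carrier F" "E s y \<in> carrier F" "\<iota> b \<in> carrier F" "\<iota> (B r b) \<in> carrier F"
        "\<iota> (B s b) \<in> carrier F" "\<iota> r \<in> carrier F" "\<iota> s \<in> carrier F"
        using rs y ab by (auto simp: Ec)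
      show "E (r \<oplus>\<^bsub>R\<^esub> s) y = E r y \<oplus> E s y"
        unfolding E_def[of "r \<oplus>\<^bsub>R\<^esub> s"]
      proof (rule deriv_ext_eqI[OF d1 y _ ab])
        show "(E r y \<oplus> E s y) \<otimes> \<iota> b \<oplus> y \<otimes> \<iota> (B (r \<oplus>\<^bsub>R\<^esub> s) b) = \<iota> (B (r \<oplus>\<^bsub>R\<^esub> s) a)"
          using ab(1,2) rs apply (simp add: Er)
          using cl y by algebra
      qed (use rs cl in auto)
      show "E (r \<otimes>\<^bsub>R\<^esub> s) y = E r y \<otimes> \<iota> s \<oplus> \<iota> r \<otimes> E s y"
        unfolding E_def[of "r \<otimes>\<^bsub>R\<^esub> s"]
      proof (rule deriv_ext_eqI[OF d1 y _ ab])
        show "(E r y \<otimes> \<iota> s \<oplus> \<iota> r \<otimes> E s y) \<otimes> \<iota> b \<oplus> y \<otimes> \<iota> (B (r \<otimes>\<^bsub>R\<^esub> s) b) = \<iota> (B (r \<otimes>\<^bsub>R\<^esub> s) a)"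
          using ab(1,2) rs apply (simp add: Er)
          using cl y by algebra
      qed (use rs cl in auto)
    qed
    then show ?thesis
      using Ec y unfolding deriv_into_frac_def F_def[symmetric] \<iota>_def[symmetric] by auto
  qed
  define G where "G x y = deriv_ext R (\<lambda>r. E r y) x" for x y
  have 1: "derivation F (\<lambda>x. G x y)" if "y \<in> carrier F" for y
    unfolding G_def by (rule derivation_deriv_ext[OF d2[OF that]])
  have 2: "derivation F (\<lambda>y. G x y)" if x: "x \<in> carrier F" for x
  proof -
    obtain a b where ab: "a \<in> carrier R" "b \<in> carrier R" "b \<noteq> \<zero>\<^bsub>R\<^esub>" "x \<otimes> \<iota> b = \<iota> a"
      using F_cases[OF x] .
    have Gc: "G x y \<in> carrier F" if "y \<in> carrier F" for y
      unfolding G_def by (rule deriv_ext_props(1)[OF d2[OF that] x])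
    have Ga: "E a y = G x y \<otimes> \<iota> b \<oplus> x \<otimes> E b y" if "y \<in> carrier F" for y
      unfolding G_def using deriv_ext_props(2)[OF d2[OF that] x ab] by simp
    have El: "E r (y \<oplus> z) = E r y \<oplus> E r z" "E r (y \<otimes> z) = E r y \<otimes> z \<oplus> y \<otimes> E r z"
      if "r \<in> carrier R" "y \<in> carrier F" "z \<in> carrier F" for r y z
      using dE[OF that(1)] that by (auto simp: derivation_def)
    have "G x (y \<oplus> z) = G x y \<oplus> G x z \<and> G x (y \<otimes> z) = G x y \<otimes> z \<oplus> y \<otimes> G x z"
      if yz: "y \<in> carrier F" "z \<in> carrier F" for y z
    proof
      have cl: "G x y \<in> carrier F" "G x z \<in> carrier F" "E b y \<in> carrier F" "E b z \<in> carrier F"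
        "\<iota> b \<in> carrier F"
        using yz ab by (auto simp: Gc Ec)
      show "G x (y \<oplus> z) = G x y \<oplus> G x z"
        unfolding G_def[of x "y \<oplus> z"]
      proof (rule deriv_ext_eqI[OF d2 x _ ab])
        show "(G x y \<oplus> G x z) \<otimes> \<iota> b \<oplus> x \<otimes> E b (y \<oplus> z) = E a (y \<oplus> z)"
          using ab(1,2) yz apply (simp add: El Ga)
          using cl x yz by algebra
      qed (use yz cl in auto)
      show "G x (y \<otimes> z) = G x y \<otimes> z \<oplus> y \<otimes> G x z"
        unfolding G_def[of x "y \<otimes> z"]
      proof (rule deriv_ext_eqI[OF d2 x _ ab])
        show "(G x y \<otimes> z \<oplus> y \<otimes> G x z) \<otimes> \<iota> b \<oplus> x \<otimes> E b (y \<otimes> z) = E a (y \<otimes> z)"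
          using ab(1,2) yz apply (simp add: El Ga)
          using cl x yz by algebra
      qed (use yz cl in auto)
    qed
    then show ?thesis using Gc by (auto simp: derivation_def)
  qed
  have "G (\<iota> a) (\<iota> b) = \<iota> (B a b)" if "a \<in> carrier R" "b \<in> carrier R" for a b
    unfolding G_def using deriv_ext_iota[OF d2[OF iota_closed[OF that(2)]] that(1)]
      deriv_ext_iota[OF d1[OF that(1)] that(2)] by (simp add: E_def)
  with 1 2 show ?thesis by (intro exI[of _ G]) (auto simp: biderivation_def)
qed

lemma biderivation_frac_unique:
  assumes D: "biderivation F D" "biderivation F D'"
    and e: "\<And>a b. a \<in> carrier R \<Longrightarrow> b \<in> carrier R \<Longrightarrow> D (\<iota> a) (\<iota> b) = D' (\<iota> a) (\<iota> b)"
    and x: "x \<in> carrier F" and y: "y \<in> carrier F"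
  shows "D x y = D' x y"
proof -
  have r: "derivation F (D x)" "derivation F (D' x)" if "x \<in> carrier F" for x
    using D that by (auto simp: biderivation_def)
  have l: "derivation F (\<lambda>x. D x y)" "derivation F (\<lambda>x. D' x y)"
    using D y by (auto simp: biderivation_def)
  have "D (\<iota> a) y = D' (\<iota> a) y" if "a \<in> carrier R" for a
    using derivation_frac_determined[OF r(1) _ deriv_into_frac_comp[OF r(2)] y, of "\<iota> a" "\<iota> a"]
      derivation_frac_determined[OF r(2) _ deriv_into_frac_comp[OF r(2)] y, of "\<iota> a" "\<iota> a"]
      e that iota_closed by simp
  then show ?thesis
    using derivation_frac_determined[OF l(1) _ deriv_into_frac_comp[OF l(2)] x]
      derivation_frac_determined[OF l(2) _ deriv_into_frac_comp[OF l(2)] x] by simp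
qed

end

text \<open>
  On the fraction field of a bidifferential domain there is exactly one biderivation extending
  the given one (see \<open>frac_bider_extends\<close> and \<open>frac_bider_unique\<close>); the choice operator
  picks it, up to its irrelevant values outside the carrier.
\<close>

definition frac_bider :: "('a, 'm) bidiff_ring_scheme \<Rightarrow> ('a \<times> 'a) set \<Rightarrow> ('a \<times> 'a) set \<Rightarrow> ('a \<times> 'a) set"
  where "frac_bider R = (SOME D. biderivation (frac_ring R) D \<and>
    (\<forall>a\<in>carrier R. \<forall>b\<in>carrier R. D (to_frac R a) (to_frac R b) = to_frac R \<lbrace>a, b\<rbrace>\<^bsub>R\<^esub>))"

definition frac_bidiff :: "('a, 'm) bidiff_ring_scheme \<Rightarrow> ('a \<times> 'a) set bidiff_ring"
  where "frac_bidiff R = ring.extend (frac_ring R) (bidiff_ring.fields (frac_bider R))"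

lemma frac_bidiff_simps [simp]:
  "carrier (frac_bidiff R) = carrier (frac_ring R)"
  "x \<otimes>\<^bsub>frac_bidiff R\<^esub> y = x \<otimes>\<^bsub>frac_ring R\<^esub> y"
  "x \<oplus>\<^bsub>frac_bidiff R\<^esub> y = x \<oplus>\<^bsub>frac_ring R\<^esub> y"
  "\<one>\<^bsub>frac_bidiff R\<^esub> = \<one>\<^bsub>frac_ring R\<^esub>"
  "\<zero>\<^bsub>frac_bidiff R\<^esub> = \<zero>\<^bsub>frac_ring R\<^esub>"
  "\<lbrace>x, y\<rbrace>\<^bsub>frac_bidiff R\<^esub> = frac_bider R x y"
  by (simp_all add: frac_bidiff_def ring.defs bidiff_ring.defs)

lemma frac_bider_extends:
  assumes "domain R" and "bidifferential_ring R"
  shows "biderivation (frac_ring R) (frac_bider R)"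
    and "a \<in> carrier R \<Longrightarrow> b \<in> carrier R \<Longrightarrow>
      frac_bider R (to_frac R a) (to_frac R b) = to_frac R \<lbrace>a, b\<rbrace>\<^bsub>R\<^esub>"
  using someI_ex[OF biderivation_frac_exists[OF assms(1) bidifferential_ring.bider[OF assms(2)]]]
  unfolding frac_bider_def by blast+

lemma frac_bider_unique:
  assumes "domain R" and "bidifferential_ring R" and "biderivation (frac_ring R) D"
    and "\<And>a b. a \<in> carrier R \<Longrightarrow> b \<in> carrier R \<Longrightarrow>
      D (to_frac R a) (to_frac R b) = to_frac R \<lbrace>a, b\<rbrace>\<^bsub>R\<^esub>"
    and "x \<in> carrier (frac_ring R)" and "y \<in> carrier (frac_ring R)"
  shows "D x y = frac_bider R x y"
  using biderivation_frac_unique[OF assms(1,3) frac_bider_extends(1)[OF assms(1,2)] _ assms(5,6)]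
  by (simp add: assms(4) frac_bider_extends(2)[OF assms(1,2)])

section \<open>Tensor products\<close>

text \<open>
  For \<open>k\<close>-algebras \<open>i: k \<rightarrow> A\<close> and \<open>j: k \<rightarrow> L\<close>, the subgroup of the free abelian group on
  \<open>A \<times> L\<close> generated by the bilinearity and \<open>k\<close>-balancedness relations.
\<close>

definition tensor_relations ::
    "('k, 'm) ring_scheme \<Rightarrow> ('a, 'n) ring_scheme \<Rightarrow> ('k \<Rightarrow> 'a) \<Rightarrow> ('l, 'o) ring_scheme \<Rightarrow> ('k \<Rightarrow> 'l) \<Rightarrow>
     ('a \<times> 'l \<Rightarrow>\<^sub>0 int) set"
  where "tensor_relations k A i L j = generate (free_Abelian_group (carrier A \<times> carrier L))
    ({frag_of (x \<oplus>\<^bsub>A\<^esub> y, z) - frag_of (x, z) - frag_of (y, z) | x y z.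
        x \<in> carrier A \<and> y \<in> carrier A \<and> z \<in> carrier L} \<union>
     {frag_of (x, z \<oplus>\<^bsub>L\<^esub> w) - frag_of (x, z) - frag_of (x, w) | x z w.
        x \<in> carrier A \<and> z \<in> carrier L \<and> w \<in> carrier L} \<union>
     {frag_of (i c \<otimes>\<^bsub>A\<^esub> x, z) - frag_of (x, j c \<otimes>\<^bsub>L\<^esub> z) | c x z.
        c \<in> carrier k \<and> x \<in> carrier A \<and> z \<in> carrier L})"

text \<open>
  \<open>T\<close>, with \<open>p: A \<rightarrow> T\<close> and \<open>q: L \<rightarrow> T\<close>, is a model of \<open>A \<otimes>\<^sub>k L\<close>: the map induced by
  \<open>x \<otimes> z \<mapsto> p x \<cdot> q z\<close> from the quotient of the free abelian group on \<open>A \<times> L\<close> by the tensor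
  relations to \<open>T\<close> is bijective.
\<close>

definition is_tensor_product ::
    "('k, 'm) ring_scheme \<Rightarrow> ('a, 'n) ring_scheme \<Rightarrow> ('k \<Rightarrow> 'a) \<Rightarrow> ('l, 'o) ring_scheme \<Rightarrow> ('k \<Rightarrow> 'l) \<Rightarrow>
     ('t, 'q) ring_scheme \<Rightarrow> ('a \<Rightarrow> 't) \<Rightarrow> ('l \<Rightarrow> 't) \<Rightarrow> bool"
  where "is_tensor_product k A i L j T p q \<longleftrightarrow>
    cring T \<and> p \<in> ring_hom A T \<and> q \<in> ring_hom L T \<and>
    (\<exists>h \<in> hom (free_Abelian_group (carrier A \<times> carrier L)) (add_monoid T).
      (\<forall>x\<in>carrier A. \<forall>z\<in>carrier L. h (frag_of (x, z)) = p x \<otimes>\<^bsub>T\<^esub> q z) \<and>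
      h ` carrier (free_Abelian_group (carrier A \<times> carrier L)) = carrier T \<and>
      kernel (free_Abelian_group (carrier A \<times> carrier L)) (add_monoid T) h =
        tensor_relations k A i L j)"


section \<open>Affine B-varieties\<close>

definition radical :: "('a, 'm) ring_scheme \<Rightarrow> 'a set \<Rightarrow> 'a set"
  where "radical R I = {x \<in> carrier R. \<exists>n::nat. x [^]\<^bsub>R\<^esub> n \<in> I}"

definition radical_ideal :: "('a, 'm) ring_scheme \<Rightarrow> 'a set \<Rightarrow> bool"
  where "radical_ideal R I \<longleftrightarrow> ideal I R \<and> radical R I = I"

text \<open>
  An affine variety over \<open>k\<close> is given by its coordinate ring, a reduced finitely generated
  \<open>k\<close>-algebra, here together with its bracket.  Closed subvarieties are represented by their
  vanishing ideals, which are the radical ideals of the coordinate ring; regular maps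
  \<open>V \<rightarrow> W\<close> by the \<open>k\<close>-algebra homomorphisms \<open>k[W] \<rightarrow> k[V]\<close>; and \<open>k\<close>-points by the
  \<open>k\<close>-algebra homomorphisms \<open>k[V] \<rightarrow> k\<close> (evaluation at the point).
\<close>

record ('k, 'a) B_var =
  coord_ring :: "'a bidiff_ring"
  scalar :: "'k \<Rightarrow> 'a"

definition B_variety :: "'k bidiff_ring \<Rightarrow> ('k, 'a) B_var \<Rightarrow> bool"
  where "B_variety k V \<longleftrightarrow> bidifferential_field k \<and>
    bidifferential_ring (coord_ring V) \<and>
    radical_ideal (coord_ring V) {\<zero>\<^bsub>coord_ring V\<^esub>} \<and>
    bidifferential_hom k (coord_ring V) (scalar V) \<and>
    (\<exists>S. finite S \<and> S \<subseteq> carrier (coord_ring V) \<and>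
      generate_ring (coord_ring V) (scalar V ` carrier k \<union> S) = carrier (coord_ring V))"

definition irreducible_B_variety :: "'k bidiff_ring \<Rightarrow> ('k, 'a) B_var \<Rightarrow> bool"
  where "irreducible_B_variety k V \<longleftrightarrow> B_variety k V \<and> domain (coord_ring V)"

definition B_subvariety :: "('k, 'a) B_var \<Rightarrow> 'a set \<Rightarrow> bool"
  where "B_subvariety V I \<longleftrightarrow>
    radical_ideal (coord_ring V) I \<and> bidifferential_ideal (coord_ring V) I"

definition point :: "'k bidiff_ring \<Rightarrow> ('k, 'a) B_var \<Rightarrow> ('a \<Rightarrow> 'k) \<Rightarrow> bool"
  where "point k V \<alpha> \<longleftrightarrow> \<alpha> \<in> ring_hom (coord_ring V) k \<and> (\<forall>c\<in>carrier k. \<alpha> (scalar V c) = c)"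

definition vanishing_ideal_pt :: "'k bidiff_ring \<Rightarrow> ('k, 'a) B_var \<Rightarrow> ('a \<Rightarrow> 'k) \<Rightarrow> 'a set"
  where "vanishing_ideal_pt k V \<alpha> = a_kernel (coord_ring V) k \<alpha>"

definition B_point :: "'k bidiff_ring \<Rightarrow> ('k, 'a) B_var \<Rightarrow> ('a \<Rightarrow> 'k) \<Rightarrow> bool"
  where "B_point k V \<alpha> \<longleftrightarrow> point k V \<alpha> \<and> B_subvariety V (vanishing_ideal_pt k V \<alpha>)"

text \<open>In the following, \<open>f\<close> is the comorphism \<open>k[W] \<rightarrow> k[V]\<close> of a regular map \<open>V \<rightarrow> W\<close>.\<close>

definition B_morphism ::
    "'k bidiff_ring \<Rightarrow> ('k, 'a) B_var \<Rightarrow> ('k, 'b) B_var \<Rightarrow> ('b \<Rightarrow> 'a) \<Rightarrow> bool"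
  where "B_morphism k V W f \<longleftrightarrow> bidifferential_hom (coord_ring W) (coord_ring V) f \<and>
    (\<forall>c\<in>carrier k. f (scalar W c) = scalar V c)"

text \<open>
  Dominant: the only closed subvariety of \<open>W\<close> containing the image is \<open>W\<close> itself (the image
  lies in the zero set of \<open>I\<close> iff all pullbacks of elements of \<open>I\<close> vanish on \<open>V\<close>).
\<close>

definition dominant :: "('k, 'a) B_var \<Rightarrow> ('k, 'b) B_var \<Rightarrow> ('b \<Rightarrow> 'a) \<Rightarrow> bool"
  where "dominant V W f \<longleftrightarrow>
    (\<forall>I. radical_ideal (coord_ring W) I \<and> (\<forall>g\<in>I. f g = \<zero>\<^bsub>coord_ring V\<^esub>) \<longrightarrow>
      I = {\<zero>\<^bsub>coord_ring W\<^esub>})"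

text \<open>
  The vanishing ideal of the fibre over a point \<open>\<alpha>\<close>: by the Nullstellensatz, the radical of the
  ideal generated by the pullbacks of the functions vanishing at \<open>\<alpha>\<close>.
\<close>

definition fibre_ideal ::
    "'k bidiff_ring \<Rightarrow> ('k, 'a) B_var \<Rightarrow> ('k, 'b) B_var \<Rightarrow> ('b \<Rightarrow> 'a) \<Rightarrow> ('b \<Rightarrow> 'k) \<Rightarrow> 'a set"
  where "fibre_ideal k V W f \<alpha> =
    radical (coord_ring V) (Idl\<^bsub>coord_ring V\<^esub> (f ` vanishing_ideal_pt k W \<alpha>))"

definition subvar :: "('k, 'a) B_var \<Rightarrow> 'a set \<Rightarrow> ('k, 'a set) B_var"
  where "subvar V I =
    \<lparr>coord_ring = bidiff_quot (coord_ring V) I,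
     scalar = (\<lambda>c. I +>\<^bsub>coord_ring V\<^esub> scalar V c)\<rparr>"

definition fibre ::
    "'k bidiff_ring \<Rightarrow> ('k, 'a) B_var \<Rightarrow> ('k, 'b) B_var \<Rightarrow> ('b \<Rightarrow> 'a) \<Rightarrow> ('b \<Rightarrow> 'k) \<Rightarrow> ('k, 'a set) B_var"
  where "fibre k V W f \<alpha> = subvar V (fibre_ideal k V W f \<alpha>)"

abbreviation function_field :: "('k, 'a) B_var \<Rightarrow> ('a \<times> 'a) set bidiff_ring"
  where "function_field V \<equiv> frac_bidiff (coord_ring V)"

abbreviation function_field_scalar :: "('k, 'a) B_var \<Rightarrow> 'k \<Rightarrow> ('a \<times> 'a) set"
  where "function_field_scalar V \<equiv> to_frac (coord_ring V) \<circ> scalar V"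

definition B_rational :: "'k bidiff_ring \<Rightarrow> ('k, 'a) B_var \<Rightarrow> bool"
  where "B_rational k V \<longleftrightarrow> domain (coord_ring V) \<and>
    (\<forall>c\<in>constants (function_field V).
      ring.algebraic (function_field V) (function_field_scalar V ` carrier k) c)"


section \<open>Base extension and generic B-fibres\<close>

text \<open>
  \<open>e: k \<rightarrow> L\<close> is an extension of bidifferential fields, and the coordinate ring of \<open>VL\<close> is
  \<open>k[V] \<otimes>\<^sub>k L\<close>, with \<open>p: k[V] \<rightarrow> L[VL]\<close> the canonical map.
\<close>

definition compatible_base_extension ::
    "'k bidiff_ring \<Rightarrow> 'l bidiff_ring \<Rightarrow> ('k \<Rightarrow> 'l) \<Rightarrow> ('k, 'a) B_var \<Rightarrow> ('l, 't) B_var \<Rightarrow> ('a \<Rightarrow> 't) \<Rightarrow> bool"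
  where "compatible_base_extension k L e V VL p \<longleftrightarrow>
    is_tensor_product k (coord_ring V) (scalar V) L e (coord_ring VL) p (scalar VL) \<and>
    bidifferential_ring (coord_ring VL) \<and>
    bidifferential_hom (coord_ring V) (coord_ring VL) p \<and>
    bidifferential_hom L (coord_ring VL) (scalar VL) \<and>
    lifting (coord_ring V) (coord_ring VL) p"

text \<open>
  Zariski generic over \<open>k\<close>: the point \<open>\<alpha>\<close> of \<open>WL\<close> lies on no proper closed subvariety of
  \<open>W\<close>, i.e. on none with nonzero vanishing ideal in \<open>k[W]\<close>; here \<open>q: k[W] \<rightarrow> L[WL]\<close>.
\<close>

definition generic_point ::
    "'l bidiff_ring \<Rightarrow> ('k, 'b) B_var \<Rightarrow> ('b \<Rightarrow> 'u) \<Rightarrow> ('u \<Rightarrow> 'l) \<Rightarrow> bool"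
  where "generic_point L W q \<alpha> \<longleftrightarrow>
    (\<forall>I. radical_ideal (coord_ring W) I \<and> I \<noteq> {\<zero>\<^bsub>coord_ring W\<^esub>} \<longrightarrow>
      \<not> (\<forall>g\<in>I. \<alpha> (q g) = \<zero>\<^bsub>L\<^esub>))"

text \<open>
  \<open>fL: L[WL] \<rightarrow> L[VL]\<close> is the comorphism of the base change of the morphism with comorphism
  \<open>f: k[W] \<rightarrow> k[V]\<close>; it is determined by \<open>L\<close>-linearity (part of \<open>B_morphism\<close>) and by
  \<open>fL \<circ> q = p \<circ> f\<close> on \<open>k[W]\<close>.
\<close>

definition generic_B_fibre ::
    "'k bidiff_ring \<Rightarrow> ('k, 'a) B_var \<Rightarrow> ('k, 'b) B_var \<Rightarrow> ('b \<Rightarrow> 'a) \<Rightarrow>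
     'l bidiff_ring \<Rightarrow> ('k \<Rightarrow> 'l) \<Rightarrow> ('l, 't) B_var \<Rightarrow> ('a \<Rightarrow> 't) \<Rightarrow> ('l, 'u) B_var \<Rightarrow> ('b \<Rightarrow> 'u) \<Rightarrow>
     ('u \<Rightarrow> 't) \<Rightarrow> ('u \<Rightarrow> 'l) \<Rightarrow> bool"
  where "generic_B_fibre k V W f L e VL p WL q fL \<alpha> \<longleftrightarrow>
    bidifferential_field L \<and> bidifferential_hom k L e \<and>
    compatible_base_extension k L e V VL p \<and>
    compatible_base_extension k L e W WL q \<and>
    B_morphism L VL WL fL \<and> (\<forall>g\<in>carrier (coord_ring W). fL (q g) = p (f g)) \<and>
    B_point L WL \<alpha> \<and> generic_point L W q \<alpha> \<and>
    B_subvariety VL (fibre_ideal L VL WL fL \<alpha>)"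

text \<open>The subfield \<open>k(\<alpha>)\<close> of \<open>L\<close>, generated by the values at \<open>\<alpha>\<close> of the functions in \<open>k[W]\<close>.\<close>

definition residue_field_pt ::
    "'k bidiff_ring \<Rightarrow> ('k, 'b) B_var \<Rightarrow> 'l bidiff_ring \<Rightarrow> ('k \<Rightarrow> 'l) \<Rightarrow> ('b \<Rightarrow> 'u) \<Rightarrow> ('u \<Rightarrow> 'l) \<Rightarrow> 'l set"
  where "residue_field_pt k W L e q \<alpha> =
    generate_field L (e ` carrier k \<union> (\<lambda>g. \<alpha> (q g)) ` carrier (coord_ring W))"

definition char_zero :: "('a, 'm) ring_scheme \<Rightarrow> bool"
  where "char_zero R \<longleftrightarrow> (\<forall>n::nat. n > 0 \<longrightarrow> [n] \<cdot>\<^bsub>R\<^esub> \<one>\<^bsub>R\<^esub> \<noteq> \<zero>\<^bsub>R\<^esub>)"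

end

theory Submission
  imports Defs
begin

text \<open>
  Let \<open>A = k[Y]\<close>, \<open>B = k[X]\<close> and \<open>L = Frac(A)\<close>.  Since \<open>k(\<alpha>) = L\<close>, every element of \<open>L\<close> is a quotient
  of values of \<open>A\<close> at \<open>\<alpha>\<close>, so \<open>L[X\<^sub>\<alpha>]\<close> is the localization of \<open>B\<close> at the nonzero elements of \<open>A\<close>,
  and \<open>L(X\<^sub>\<alpha>)\<close> is isomorphic to \<open>k(X)\<close> as a bidifferential field, with \<open>L\<close> embedded as \<open>k(Y)\<close>.
  The claim becomes: the constants of \<open>k(X)\<close> are algebraic over \<open>k\<close> iff they are algebraic over
  \<open>k(Y)\<close>.  If a constant \<open>c\<close> is algebraic over \<open>k(Y)\<close>, differentiating its minimal polynomial shows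
  that the coefficients are constants of \<open>k(Y)\<close>; these are algebraic over \<open>k\<close>, hence so is \<open>c\<close>.
\<close>

section \<open>Algebraic elements and derivations\<close>

text \<open>Two points shape the proof. The condition \<open>k(\<alpha>) = L\<close> says only that
  the values at \<open>\<alpha>\<close> generate \<open>L\<close>: evaluation
  \<open>\<sigma>: A \<rightarrow> L\<close> at the point need not be the canonical inclusion. It
  extends to a bijective endomorphism \<open>\<tau>\<close> of \<open>L\<close>, and the scalars of
  the fibre embed into \<open>k(X)\<close> through
  \<open>\<chi> = \<Phi> \<circ> inv \<tau>\<close>, where \<open>\<Phi>\<close> is the canonical
  map \<open>k(Y) \<rightarrow> k(X)\<close>. Both maps have the same image, and algebraicity
  depends on that image only. Moreover, the brackets on \<open>B\<close> and \<open>L\<close> alone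
  do not determine brackets of mixed elements of the tensor product, so the map
  \<open>b \<otimes> l \<mapsto> b \<chi>(l)\<close> is not bidifferential by construction. It
  becomes so because it kills the fibre ideal, which is a bidifferential ideal, and because modulo
  that ideal every element is a quotient of elements of \<open>B\<close>; the quotient rule then
  reduces everything to \<open>B\<close>. Passing from (i) to (ii) only enlarges the coefficient
  field; the B-rationality of \<open>Y\<close> serves the converse.\<close>

lemma (in field) algebraic_over_algebraics:
  assumes K: "subfield K R" and x: "x \<in> carrier R"
    and alg: "(algebraic over {y \<in> carrier R. (algebraic over K) y}) x"
  shows "(algebraic over K) x"
proof -
  let ?A = "{y \<in> carrier R. (algebraic over K) y}"
  have A: "subring ?A R"
    by (rule subfieldE(1)[OF subfield_of_algebraics[OF K]])
  obtain p where p: "p \<in> carrier (?A[X])" "p \<noteq> []" "eval p x = \<zero>"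
    using algebraicE[OF A x alg] .
  have pA: "set p \<subseteq> ?A" and lc: "lead_coeff p \<noteq> \<zero>"
    using p by (auto simp: univ_poly_def polynomial_def)
  then have pc: "set p \<subseteq> carrier R" by auto
  \<comment> \<open>A polynomial is its list of coefficients, so \<open>p\<close> itself serves as
    the list of elements to adjoin. They are finitely many and algebraic over \<open>K\<close>,
    hence \<open>E\<close> is finite-dimensional, and the tower law carries \<open>x\<close> from
    \<open>E\<close> down to \<open>K\<close>.\<close>
  define E where "E = finite_extension K p"
  have E: "subfield E R" "finite_dimension K E"
    unfolding E_def using finite_extension_is_subfield[OF K pc] finite_extension_finite_dimension(1)[OF K pc] pA
    by blast+
  have "set p \<subseteq> E"
    unfolding E_def by (rule finite_extension_mem[OF subfieldE(1)[OF K] pc])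
  then have "p \<in> carrier (E[X])"
    using p(2) lc by (auto simp: univ_poly_def polynomial_def)
  then have "(algebraic over E) x"
    using p(2,3) by (rule algebraicI)
  then have "finite_dimension E (simple_extension E x)"
    using finite_dimension_simple_extension[OF E(1) x] by simp
  then have "finite_dimension K (simple_extension E x)"
    by (rule telescopic_base_dim(1)[OF K E])
  then show ?thesis
    using finite_dimension_imp_algebraic[OF K simple_extension_is_subring[OF subfieldE(1)[OF E(1)] x]]
      simple_extension_mem[OF subfieldE(1)[OF E(1)] x] by blast
qed

text \<open>A homomorphism of fields is injective, so polynomials can be moved in both directions
  coefficient by coefficient without losing the leading one. This allows algebraicity to be tested
  in whichever copy of a function field is convenient.\<close>

lemma algebraic_image_iff:
  assumes R: "field R" and S: "field S" and h: "h \<in> ring_hom R S"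
    and K: "subfield K R" and x: "x \<in> carrier R"
  shows "ring.algebraic S (h ` K) (h x) \<longleftrightarrow> ring.algebraic R K x"
proof -
  interpret R: field R by fact
  interpret S: field S by fact
  interpret h: ring_hom_ring R S h
    by (rule ring_hom_ringI2[OF R.ring_axioms S.ring_axioms h])
  have hx: "h x \<in> carrier S" using x by simp
  have inj: "inj_on h (carrier R)"
    by (rule h.img_is_subfield(1)[OF R.carrier_is_subfield]) simp
  have K': "subfield (h ` K) S"
    by (rule h.img_is_subfield(2)[OF K]) simp
  have Kc: "K \<subseteq> carrier R" by (rule subfieldE(3)[OF K])
  have hz: "h a = \<zero>\<^bsub>S\<^esub> \<longleftrightarrow> a = \<zero>\<^bsub>R\<^esub>" if "a \<in> carrier R" for a
    using inj_onD[OF inj, of a "\<zero>\<^bsub>R\<^esub>"] that by auto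
  show ?thesis
  proof
    assume "ring.algebraic S (h ` K) (h x)"
    then obtain p where p: "p \<in> carrier ((h ` K)[X]\<^bsub>S\<^esub>)" "p \<noteq> []" "S.eval p (h x) = \<zero>\<^bsub>S\<^esub>"
      using S.algebraicE[OF subfieldE(1)[OF K'] hx] unfolding over_def by blast
    then have "set p \<subseteq> h ` K" by (auto simp: univ_poly_def polynomial_def)
    then have "p \<in> map h ` lists K"
      unfolding lists_image[symmetric] by blast
    then obtain r where r: "set r \<subseteq> K" "p = map h r" by auto
    have rc: "set r \<subseteq> carrier R" using r Kc by auto
    have "lead_coeff r \<noteq> \<zero>\<^bsub>R\<^esub>"
      using p r rc hz by (cases r) (auto simp: univ_poly_def polynomial_def)
    then have "r \<in> carrier (K[X]\<^bsub>R\<^esub>)" "r \<noteq> []"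
      using p r by (auto simp: univ_poly_def polynomial_def)
    moreover have "R.eval r x = \<zero>\<^bsub>R\<^esub>"
      using p r h.eval_hom'[OF x rc] hz R.eval_in_carrier[OF rc x] by simp
    ultimately show "R.algebraic K x"
      using R.algebraicI[of r K x] unfolding over_def by blast
  next
    assume "R.algebraic K x"
    then obtain p where p: "p \<in> carrier (K[X]\<^bsub>R\<^esub>)" "p \<noteq> []" "R.eval p x = \<zero>\<^bsub>R\<^esub>"
      using R.algebraicE[OF subfieldE(1)[OF K] x] unfolding over_def by blast
    then have pK: "set p \<subseteq> K" and lc: "lead_coeff p \<noteq> \<zero>\<^bsub>R\<^esub>" by (auto simp: univ_poly_def polynomial_def)
    then have pc: "set p \<subseteq> carrier R" using Kc by auto
    have "lead_coeff (map h p) \<noteq> \<zero>\<^bsub>S\<^esub>"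
      using p lc pc hz by (cases p) auto
    then have "map h p \<in> carrier ((h ` K)[X]\<^bsub>S\<^esub>)" "map h p \<noteq> []"
      using p(2) pK by (auto simp: univ_poly_def polynomial_def)
    moreover have "S.eval (map h p) (h x) = \<zero>\<^bsub>S\<^esub>"
      using p h.eval_hom'[OF x pc] by simp
    ultimately show "ring.algebraic S (h ` K) (h x)"
      using S.algebraicI[of "map h p"] unfolding over_def by blast
  qed
qed

lemma derivationD:
  assumes "derivation R d"
  shows "x \<in> carrier R \<Longrightarrow> d x \<in> carrier R"
    and "x \<in> carrier R \<Longrightarrow> y \<in> carrier R \<Longrightarrow> d (x \<oplus>\<^bsub>R\<^esub> y) = d x \<oplus>\<^bsub>R\<^esub> d y"
    and "x \<in> carrier R \<Longrightarrow> y \<in> carrier R \<Longrightarrow>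
      d (x \<otimes>\<^bsub>R\<^esub> y) = d x \<otimes>\<^bsub>R\<^esub> y \<oplus>\<^bsub>R\<^esub> x \<otimes>\<^bsub>R\<^esub> d y"
  using assms by (auto simp: derivation_def)

context cring
begin

lemma derivation_zero:
  assumes "derivation R d" shows "d \<zero> = \<zero>"
  using derivationD(1,2)[OF assms, of \<zero>] by (metis add.l_cancel_one' r_zero zero_closed)

lemma derivation_one:
  assumes "derivation R d" shows "d \<one> = \<zero>"
  using derivationD(1)[OF assms one_closed] derivationD(3)[OF assms one_closed one_closed]
  by (metis add.l_cancel_one' l_one one_closed r_one)

lemma derivation_uminus:
  assumes d: "derivation R d" and x: "x \<in> carrier R" shows "d (\<ominus> x) = \<ominus> d x"
proof -
  have "d (\<ominus> x) \<oplus> d x = \<zero>"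
    using derivationD(2)[OF d, of "\<ominus> x" x] x derivation_zero[OF d] by (simp add: l_neg)
  then show ?thesis
    using derivationD(1)[OF d] x by (simp add: minus_equality)
qed

lemma derivation_minus:
  assumes d: "derivation R d" and x: "x \<in> carrier R" "y \<in> carrier R" shows "d (x \<ominus> y) = d x \<ominus> d y"
  using derivationD(2)[OF d x(1), of "\<ominus> y"] derivation_uminus[OF d x(2)] x by (simp add: a_minus_def)

lemma derivation_pow_const:
  assumes d: "derivation R d" and x: "x \<in> carrier R" "d x = \<zero>" shows "d (x [^] (n::nat)) = \<zero>"
  by (induction n) (use x in \<open>simp_all add: derivation_one[OF d] derivationD[OF d]\<close>)

text \<open>All powers of the constant \<open>x\<close> are killed by \<open>d\<close>, so the
  Leibniz rule leaves only the terms in which a coefficient is differentiated.\<close>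

lemma derivation_eval_const:
  assumes d: "derivation R d" and x: "x \<in> carrier R" "d x = \<zero>" and p: "set p \<subseteq> carrier R"
  shows "d (eval p x) = eval (map d p) x"
  using p
  by (induction p)
    (use x in \<open>simp_all add: derivation_zero[OF d] derivationD[OF d] eval_in_carrier derivation_pow_const[OF d]\<close>)

end

text \<open>
  Differentiating the equation of the minimal polynomial kills its leading coefficient 1, so
  minimality forces the differentiated polynomial to vanish identically.
\<close>

lemma (in field) derivation_Irr_coeffs:
  assumes F: "subfield F R" and d: "derivation R d" and dF: "d ` F \<subseteq> F"
    and x: "x \<in> carrier R" "d x = \<zero>" and alg: "(algebraic over F) x"
  shows "\<forall>a\<in>set (Irr F x). d a = \<zero>"
proof -
  note I = IrrE[OF F x(1) alg]
  have Iset: "set (Irr F x) \<subseteq> F" and ne: "Irr F x \<noteq> []"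
    using I(1,2) by (auto simp: univ_poly_def polynomial_def ring_irreducible_def)
  have Fc: "F \<subseteq> carrier R" by (rule subfieldE(3)[OF F])
  obtain r where r: "Irr F x = \<one> # r" using ne I(3) by (cases "Irr F x") auto
  have rF: "set r \<subseteq> F" "set (map d r) \<subseteq> F" using Iset r dF by auto
  then have rc: "set r \<subseteq> carrier R" "set (map d r) \<subseteq> carrier R" using Fc by blast+
  have "d (eval (Irr F x) x) = eval (map d (Irr F x)) x"
    using derivation_eval_const[OF d x, of "Irr F x"] Iset Fc by blast
  moreover have "d (eval (Irr F x) x) = \<zero>"
    unfolding I(4) by (rule derivation_zero[OF d])
  moreover have "eval (map d (Irr F x)) x = eval (map d r) x"
    using x rc by (simp add: r derivation_one[OF d] eval_in_carrier)
  ultimately have e: "eval (map d r) x = \<zero>" by simp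
  \<comment> \<open>\<open>normalize\<close> strips leading zeros and makes \<open>q\<close> a
    genuine polynomial over \<open>F\<close>. Its length is at most that of \<open>r\<close>, one
    less than that of \<open>Irr F x\<close>, so a nonempty \<open>q\<close> would be a multiple of
    \<open>Irr F x\<close> of smaller degree.\<close>
  define q where "q = normalize (map d r)"
  have q: "q \<in> carrier (F[X])" "eval q x = \<zero>" "length q \<le> length r"
    using normalize_gives_polynomial[OF rF(2)] eval_normalize[OF rc(2) x(1)] e
      normalize_length_le[of "map d r"] by (auto simp: q_def univ_poly_def)
  have "q = []"
  proof (rule ccontr)
    assume "q \<noteq> []"
    moreover have "degree (Irr F x) \<le> degree q" if "q \<noteq> []"
      using pdivides_imp_degree_le[OF subfieldE(1)[OF F] I(1) q(1) that Irr_minimal[OF F x(1) alg q(1,2)]] .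
    ultimately show False using r q(3) by (cases q) auto
  qed
  then have "map d r = replicate (length r) \<zero>"
    using normalize_def'(1)[of "map d r"] by (simp add: q_def[symmetric])
  then have "\<forall>a\<in>set r. d a = \<zero>"
    by (metis (no_types, lifting) in_set_replicate list.set_map image_eqI)
  then show ?thesis using derivation_one[OF d] by (simp add: r)
qed

section \<open>Bidifferential homomorphisms and fraction fields\<close>

lemma bidifferential_ring_derivation:
  assumes "bidifferential_ring R" and "r \<in> carrier R"
  shows "derivation R (\<lambda>s. \<lbrace>r, s\<rbrace>\<^bsub>R\<^esub>)" and "derivation R (\<lambda>s. \<lbrace>s, r\<rbrace>\<^bsub>R\<^esub>)"
  using bidifferential_ring.bider[OF assms(1)] assms(2) by (auto simp: biderivation_def)

lemma bracket_closed:
  assumes "bidifferential_ring R" and "r \<in> carrier R" and "s \<in> carrier R"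
  shows "\<lbrace>r, s\<rbrace>\<^bsub>R\<^esub> \<in> carrier R"
  using derivationD(1)[OF bidifferential_ring_derivation(1)] assms .

lemma bidifferential_homI:
  assumes "f \<in> ring_hom R S"
    and "\<And>x y. x \<in> carrier R \<Longrightarrow> y \<in> carrier R \<Longrightarrow> f \<lbrace>x, y\<rbrace>\<^bsub>R\<^esub> = \<lbrace>f x, f y\<rbrace>\<^bsub>S\<^esub>"
  shows "bidifferential_hom R S f"
  using assms by (simp add: bidifferential_hom_def)

lemma bidifferential_homD:
  assumes "bidifferential_hom R S f"
  shows "f \<in> ring_hom R S"
    and "x \<in> carrier R \<Longrightarrow> y \<in> carrier R \<Longrightarrow> f \<lbrace>x, y\<rbrace>\<^bsub>R\<^esub> = \<lbrace>f x, f y\<rbrace>\<^bsub>S\<^esub>"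
  using assms by (simp_all add: bidifferential_hom_def)

text \<open>This is the quotient rule for \<open>\<phi> x = \<phi> a / \<phi> e\<close>. As
  \<open>\<phi>\<close> is not yet known to commute with the derivations, the vanishing of
  \<open>\<phi>\<close> on \<open>x e - a\<close> says nothing about the derivative of that element,
  which is why the latter is a separate hypothesis.\<close>

lemma hom_commutes_derivation_quotient:
  assumes T: "cring T" and K: "field K" and \<phi>: "\<phi> \<in> ring_hom T K"
    and d: "derivation T d" and \<delta>: "derivation K \<delta>"
    and c: "x \<in> carrier T" "a \<in> carrier T" "e \<in> carrier T"
    and z: "\<phi> (x \<otimes>\<^bsub>T\<^esub> e \<ominus>\<^bsub>T\<^esub> a) = \<zero>\<^bsub>K\<^esub>" "\<phi> (d (x \<otimes>\<^bsub>T\<^esub> e \<ominus>\<^bsub>T\<^esub> a)) = \<zero>\<^bsub>K\<^esub>"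
    and e: "\<phi> e \<noteq> \<zero>\<^bsub>K\<^esub>"
    and da: "\<phi> (d a) = \<delta> (\<phi> a)" and de: "\<phi> (d e) = \<delta> (\<phi> e)"
  shows "\<phi> (d x) = \<delta> (\<phi> x)"
proof -
  interpret T: cring T by fact
  interpret K: field K by fact
  interpret \<phi>: ring_hom_ring T K \<phi>
    by (rule ring_hom_ringI2[OF T.ring_axioms K.ring_axioms \<phi>])
  note D = derivationD[OF d] and \<Delta> = derivationD[OF \<delta>]
  have cl: "\<phi> x \<in> carrier K" "\<phi> a \<in> carrier K" "\<phi> e \<in> carrier K" "d x \<in> carrier T" "d a \<in> carrier T" "d e \<in> carrier T"
    "\<delta> (\<phi> x) \<in> carrier K" "\<delta> (\<phi> e) \<in> carrier K"  "\<delta> (\<phi> a) \<in> carrier K" "\<phi> (d x) \<in> carrier K"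
    using c D \<Delta> by auto
  have sub: "u = v" if "\<phi> (u' \<ominus>\<^bsub>T\<^esub> v') = \<zero>\<^bsub>K\<^esub>" "\<phi> u' = u" "\<phi> v' = v" "u' \<in> carrier T" "v' \<in> carrier T" for u v u' v'
  proof -
    have "u \<ominus>\<^bsub>K\<^esub> v = \<zero>\<^bsub>K\<^esub>" using that(1,4,5) by (simp add: that(2,3)[symmetric] a_minus_def)
    moreover have "u \<in> carrier K" "v \<in> carrier K" using that by auto
    ultimately show ?thesis by (simp add: K.r_right_minus_eq)
  qed
  have 1: "\<phi> x \<otimes>\<^bsub>K\<^esub> \<phi> e = \<phi> a"
    by (rule sub[OF z(1)]) (use c in simp_all)
  have "\<phi> (d x) \<otimes>\<^bsub>K\<^esub> \<phi> e \<oplus>\<^bsub>K\<^esub> \<phi> x \<otimes>\<^bsub>K\<^esub> \<delta> (\<phi> e) = \<phi> (d a)"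
    by (rule sub[OF z(2)[unfolded T.derivation_minus[OF d T.m_closed[OF c(1,3)] c(2)]]])
      (use c cl D de in simp_all)
  also have "\<dots> = \<delta> (\<phi> x) \<otimes>\<^bsub>K\<^esub> \<phi> e \<oplus>\<^bsub>K\<^esub> \<phi> x \<otimes>\<^bsub>K\<^esub> \<delta> (\<phi> e)"
    unfolding da 1[symmetric] using cl by (simp add: \<Delta>)
  finally have "\<phi> (d x) \<otimes>\<^bsub>K\<^esub> \<phi> e = \<delta> (\<phi> x) \<otimes>\<^bsub>K\<^esub> \<phi> e"
    using cl by simp
  then show ?thesis
    using cl e K.m_rcancel by simp
qed

text \<open>\<open>P\<close> supplies numerators and denominators. Since \<open>J\<close> is a
  bidifferential ideal inside the kernel, the brackets of \<open>x e - a\<close> also die under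
  \<open>\<phi>\<close>, and the quotient rule applies. The lemma serves twice: with
  \<open>J\<close> zero for fraction fields, and with the fibre ideal for the generic fibre.\<close>

lemma bidifferential_hom_from_generators:
  assumes T: "bidifferential_ring T" and K: "bidifferential_field K" and \<phi>: "\<phi> \<in> ring_hom T K"
    and J: "bidifferential_ideal T J" "\<And>j. j \<in> J \<Longrightarrow> \<phi> j = \<zero>\<^bsub>K\<^esub>"
    and P: "P \<subseteq> carrier T"
    and br: "\<And>a b. a \<in> P \<Longrightarrow> b \<in> P \<Longrightarrow> \<phi> \<lbrace>a, b\<rbrace>\<^bsub>T\<^esub> = \<lbrace>\<phi> a, \<phi> b\<rbrace>\<^bsub>K\<^esub>"
    and q: "\<And>x. x \<in> carrier T \<Longrightarrow> \<exists>a\<in>P. \<exists>e\<in>P. \<phi> e \<noteq> \<zero>\<^bsub>K\<^esub> \<and> x \<otimes>\<^bsub>T\<^esub> e \<ominus>\<^bsub>T\<^esub> a \<in> J"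
  shows "bidifferential_hom T K \<phi>"
proof (rule bidifferential_homI[OF \<phi>])
  have T': "cring T" and K': "field K" "bidifferential_ring K"
    using T K by (auto simp: bidifferential_ring_def bidifferential_field_def)
  have \<phi>c: "\<phi> x \<in> carrier K" if "x \<in> carrier T" for x
    using ring_hom_closed[OF \<phi>] that .
  have JB: "\<phi> \<lbrace>r, j\<rbrace>\<^bsub>T\<^esub> = \<zero>\<^bsub>K\<^esub>" "\<phi> \<lbrace>j, r\<rbrace>\<^bsub>T\<^esub> = \<zero>\<^bsub>K\<^esub>" if "r \<in> carrier T" "j \<in> J" for r j
    using J that by (auto simp: bidifferential_ideal_def)
  \<comment> \<open>The second argument is freed first, while the first one stays in
    \<open>P\<close>; the result then feeds the same argument for the first slot.\<close>
  have 1: "\<phi> \<lbrace>a, y\<rbrace>\<^bsub>T\<^esub> = \<lbrace>\<phi> a, \<phi> y\<rbrace>\<^bsub>K\<^esub>" if a: "a \<in> P" and y: "y \<in> carrier T" for a y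
  proof -
    have ac: "a \<in> carrier T" using a P by blast
    obtain b e where be: "b \<in> P" "e \<in> P" "\<phi> e \<noteq> \<zero>\<^bsub>K\<^esub>" "y \<otimes>\<^bsub>T\<^esub> e \<ominus>\<^bsub>T\<^esub> b \<in> J"
      using q[OF y] by blast
    have bec: "b \<in> carrier T" "e \<in> carrier T" using be P by auto
    show ?thesis
      by (rule hom_commutes_derivation_quotient[OF T' K'(1) \<phi>
            bidifferential_ring_derivation(1)[OF T ac] bidifferential_ring_derivation(1)[OF K'(2) \<phi>c[OF ac]]
            y bec J(2)[OF be(4)] JB(1)[OF ac be(4)] be(3) br[OF a be(1)] br[OF a be(2)]])
  qed
  fix x y assume x: "x \<in> carrier T" and y: "y \<in> carrier T"
  obtain b e where be: "b \<in> P" "e \<in> P" "\<phi> e \<noteq> \<zero>\<^bsub>K\<^esub>" "x \<otimes>\<^bsub>T\<^esub> e \<ominus>\<^bsub>T\<^esub> b \<in> J"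
    using q[OF x] by blast
  have bec: "b \<in> carrier T" "e \<in> carrier T" using be P by auto
  show "\<phi> \<lbrace>x, y\<rbrace>\<^bsub>T\<^esub> = \<lbrace>\<phi> x, \<phi> y\<rbrace>\<^bsub>K\<^esub>"
    by (rule hom_commutes_derivation_quotient[OF T' K'(1) \<phi>
          bidifferential_ring_derivation(2)[OF T y] bidifferential_ring_derivation(2)[OF K'(2) \<phi>c[OF y]]
          x bec J(2)[OF be(4)] JB(2)[OF y be(4)] be(3) 1[OF be(1) y] 1[OF be(2) y]])
qed

text \<open>Surjectivity matters as much as injectivity: a constant of \<open>S\<close> is tested
  against all elements of \<open>S\<close>, not only against the image of \<open>R\<close>.\<close>

lemma constants_iso_iff:
  assumes R: "cring R" and S: "cring S" and h: "bidifferential_hom R S h"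
    and b: "bij_betw h (carrier R) (carrier S)"
    and cl: "bidifferential_ring R" and c: "c \<in> carrier R"
  shows "h c \<in> constants S \<longleftrightarrow> c \<in> constants R"
proof -
  interpret R: cring R by fact
  interpret S: cring S by fact
  note H = bidifferential_homD[OF h]
  have z: "h x = \<zero>\<^bsub>S\<^esub> \<longleftrightarrow> x = \<zero>\<^bsub>R\<^esub>" if "x \<in> carrier R" for x
  proof -
    have "h \<zero>\<^bsub>R\<^esub> = \<zero>\<^bsub>S\<^esub>" by (rule ring_hom_zero[OF H(1) R.ring_axioms S.ring_axioms])
    then show ?thesis
      using bij_betw_imp_inj_on[OF b] that by (metis R.zero_closed inj_onD)
  qed
  have "h c \<in> constants S \<longleftrightarrow> (\<forall>r\<in>carrier R. \<lbrace>h c, h r\<rbrace>\<^bsub>S\<^esub> = \<zero>\<^bsub>S\<^esub> \<and> \<lbrace>h r, h c\<rbrace>\<^bsub>S\<^esub> = \<zero>\<^bsub>S\<^esub>)"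
    using ring_hom_closed[OF H(1) c] by (simp add: constants_def bij_betw_imp_surj_on[OF b, symmetric])
  also have "\<dots> \<longleftrightarrow> c \<in> constants R"
    using c bracket_closed[OF cl] by (auto simp: constants_def H(2)[symmetric] z)
  finally show ?thesis .
qed

text \<open>Attaching a bracket to a ring produces a record of another type with the same
  operations; the field axioms have to be carried across.\<close>

lemma field_cong:
  assumes "field R" and "carrier S = carrier R" "\<zero>\<^bsub>S\<^esub> = \<zero>\<^bsub>R\<^esub>" "\<one>\<^bsub>S\<^esub> = \<one>\<^bsub>R\<^esub>"
    and "\<And>x y. x \<oplus>\<^bsub>S\<^esub> y = x \<oplus>\<^bsub>R\<^esub> y" "\<And>x y. x \<otimes>\<^bsub>S\<^esub> y = x \<otimes>\<^bsub>R\<^esub> y"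
  shows "field S"
proof -
  interpret field R by fact
  have "id \<in> ring_iso R S" using assms by (intro ring_iso_memI) auto
  \<comment> \<open>\<open>ring_iso_imp_img_field\<close> speaks of the target with its zero
    overwritten by the image of zero; along \<open>id\<close> that update changes nothing.\<close>
  then have "field (S\<lparr>zero := \<zero>\<^bsub>S\<^esub>\<rparr>)" using ring_iso_imp_img_field assms(3) by force
  then show ?thesis by simp
qed

lemma cring_cong:
  assumes "cring R" and "carrier S = carrier R" "\<zero>\<^bsub>S\<^esub> = \<zero>\<^bsub>R\<^esub>" "\<one>\<^bsub>S\<^esub> = \<one>\<^bsub>R\<^esub>"
    and "\<And>x y. x \<oplus>\<^bsub>S\<^esub> y = x \<oplus>\<^bsub>R\<^esub> y" "\<And>x y. x \<otimes>\<^bsub>S\<^esub> y = x \<otimes>\<^bsub>R\<^esub> y"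
  shows "cring S"
proof -
  interpret cring R by fact
  have "id \<in> ring_iso R S" using assms by (intro ring_iso_memI) auto
  then have "cring (S\<lparr>zero := \<zero>\<^bsub>S\<^esub>\<rparr>)" using ring_iso_imp_img_cring assms(3) by force
  then show ?thesis by simp
qed

lemma derivation_cong:
  assumes "carrier S = carrier R"
    and "\<And>x y. x \<oplus>\<^bsub>S\<^esub> y = x \<oplus>\<^bsub>R\<^esub> y" "\<And>x y. x \<otimes>\<^bsub>S\<^esub> y = x \<otimes>\<^bsub>R\<^esub> y"
  shows "derivation S = derivation R"
  using assms by (simp add: derivation_def fun_eq_iff)

section \<open>Universal property of the bidifferential fraction field\<close>

lemma bidifferential_field_frac_bidiff:
  assumes R: "domain R" "bidifferential_ring R"
  shows "bidifferential_field (frac_bidiff R)"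
proof -
  have F: "field (frac_bidiff R)"
    by (rule field_cong[OF domain.field_frac_ring[OF R(1)]]) simp_all
  then have "bidifferential_ring (frac_bidiff R)"
    using frac_bider_extends(1)[OF R]
      derivation_cong[of "frac_bidiff R" "frac_ring R"]
    by (simp add: bidifferential_ring_def bidifferential_ring_axioms_def fieldE(1) biderivation_def)
  with F show ?thesis by (simp add: bidifferential_field_def)
qed

lemma bidifferential_hom_to_frac:
  assumes R: "domain R" "bidifferential_ring R"
  shows "bidifferential_hom R (frac_bidiff R) (to_frac R)"
proof (rule bidifferential_homI)
  show "to_frac R \<in> ring_hom R (frac_bidiff R)"
    using domain.to_frac_hom[OF R(1)] by (simp add: ring_hom_def)
qed (simp add: frac_bider_extends(2)[OF R])

lemma frac_ring_hom_extend:
  assumes R: "domain R" and S: "field S" and h: "h \<in> ring_hom R S" and inj: "inj_on h (carrier R)"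
  obtains H where "H \<in> ring_hom (frac_ring R) S" "\<And>a. a \<in> carrier R \<Longrightarrow> H (to_frac R a) = h a"
proof -
  interpret R: domain R by fact
  interpret S: field S by fact
  interpret F: field "frac_ring R" by (rule R.field_frac_ring)
  interpret h: ring_hom_ring R S h
    by (rule ring_hom_ringI2[OF R.ring_axioms S.ring_axioms h])
  let ?F = "frac_ring R" and ?\<iota> = "to_frac R"
  note \<iota> = ring_hom_add[OF R.to_frac_hom] ring_hom_mult[OF R.to_frac_hom]
  have hz: "h a \<noteq> \<zero>\<^bsub>S\<^esub>" if "a \<in> carrier R" "a \<noteq> \<zero>\<^bsub>R\<^esub>" for a
    using inj_onD[OF inj, of a "\<zero>\<^bsub>R\<^esub>"] that by auto
  \<comment> \<open>The value at \<open>a/b\<close> must be \<open>h a / h b\<close>. Describing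
    fractions by \<open>x b = a\<close> avoids representatives of classes, and \<open>unique\<close>
    shows by cross-multiplication that the value does not depend on the pair \<open>a\<close>,
    \<open>b\<close>; injectivity of \<open>h\<close> keeps denominators nonzero. Through
    \<open>HI\<close> a single pair then suffices to compute \<open>H x\<close>.\<close>
  define H where "H x = (THE z. \<exists>a\<in>carrier R. \<exists>b\<in>carrier R. b \<noteq> \<zero>\<^bsub>R\<^esub> \<and>
    x \<otimes>\<^bsub>?F\<^esub> ?\<iota> b = ?\<iota> a \<and> z \<in> carrier S \<and> z \<otimes>\<^bsub>S\<^esub> h b = h a)" for x
  have unique: "z = w"
    if x: "x \<in> carrier ?F" and c: "a \<in> carrier R" "b \<in> carrier R" "b \<noteq> \<zero>\<^bsub>R\<^esub>" "a' \<in> carrier R" "b' \<in> carrier R" "b' \<noteq> \<zero>\<^bsub>R\<^esub>"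
      and e: "x \<otimes>\<^bsub>?F\<^esub> ?\<iota> b = ?\<iota> a" "x \<otimes>\<^bsub>?F\<^esub> ?\<iota> b' = ?\<iota> a'"
      and zw: "z \<in> carrier S" "w \<in> carrier S" "z \<otimes>\<^bsub>S\<^esub> h b = h a" "w \<otimes>\<^bsub>S\<^esub> h b' = h a'"
    for x a b a' b' z w
  proof -
    have b: "?\<iota> b \<in> carrier ?F" "?\<iota> b' \<in> carrier ?F" using c by auto
    have "?\<iota> a \<otimes>\<^bsub>?F\<^esub> ?\<iota> b' = ?\<iota> a' \<otimes>\<^bsub>?F\<^esub> ?\<iota> b"
      unfolding e[symmetric] using x b by algebra
    then have "a \<otimes>\<^bsub>R\<^esub> b' = a' \<otimes>\<^bsub>R\<^esub> b"
      using c by (simp add: \<iota>[symmetric] R.to_frac_eq_iff)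
    then have "h a \<otimes>\<^bsub>S\<^esub> h b' = h a' \<otimes>\<^bsub>S\<^esub> h b"
      using c by (simp flip: h.hom_mult)
    then have "z \<otimes>\<^bsub>S\<^esub> h b \<otimes>\<^bsub>S\<^esub> h b' = w \<otimes>\<^bsub>S\<^esub> h b' \<otimes>\<^bsub>S\<^esub> h b" by (simp add: zw)
    then have "z \<otimes>\<^bsub>S\<^esub> (h b \<otimes>\<^bsub>S\<^esub> h b') = w \<otimes>\<^bsub>S\<^esub> (h b \<otimes>\<^bsub>S\<^esub> h b')"
      using zw(1,2) c by (simp add: S.m_ac)
    then show ?thesis
      using zw(1,2) c hz S.m_rcancel[of "h b \<otimes>\<^bsub>S\<^esub> h b'"] by (simp add: S.integral_iff)
  qed
  have HI: "H x = z"
    if "x \<in> carrier ?F" "a \<in> carrier R" "b \<in> carrier R" "b \<noteq> \<zero>\<^bsub>R\<^esub>" "x \<otimes>\<^bsub>?F\<^esub> ?\<iota> b = ?\<iota> a"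
      "z \<in> carrier S" "z \<otimes>\<^bsub>S\<^esub> h b = h a" for x a b z
    unfolding H_def by (rule the_equality) (use that unique in blast)+
  have HE: "H x \<in> carrier S \<and> H x \<otimes>\<^bsub>S\<^esub> h b = h a"
    if c: "x \<in> carrier ?F" "a \<in> carrier R" "b \<in> carrier R" "b \<noteq> \<zero>\<^bsub>R\<^esub>" "x \<otimes>\<^bsub>?F\<^esub> ?\<iota> b = ?\<iota> a" for x a b
  proof -
    let ?z = "h a \<otimes>\<^bsub>S\<^esub> inv\<^bsub>S\<^esub> (h b)"
    have u: "h b \<in> Units S" using c hz by (simp add: S.field_Units)
    then have z: "?z \<in> carrier S" "?z \<otimes>\<^bsub>S\<^esub> h b = h a" using c by (simp_all add: S.m_assoc)
    then show ?thesis using HI[OF c] by simp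
  qed
  have H\<iota>: "H (?\<iota> a) = h a" if "a \<in> carrier R" for a
    by (rule HI[of _ a "\<one>\<^bsub>R\<^esub>"]) (use that ring_hom_one[OF R.to_frac_hom] in simp_all)
  have "H \<in> ring_hom ?F S"
  proof (rule ring_hom_memI)
    fix x y assume x: "x \<in> carrier ?F" and y: "y \<in> carrier ?F"
    show "H x \<in> carrier S"
      using x by (rule R.frac_ring_cases) (use HE x in blast)
    obtain a b where ab: "a \<in> carrier R" "b \<in> carrier R" "b \<noteq> \<zero>\<^bsub>R\<^esub>" "x \<otimes>\<^bsub>?F\<^esub> ?\<iota> b = ?\<iota> a"
      using x by (rule R.frac_ring_cases)
    obtain a' b' where ab': "a' \<in> carrier R" "b' \<in> carrier R" "b' \<noteq> \<zero>\<^bsub>R\<^esub>" "y \<otimes>\<^bsub>?F\<^esub> ?\<iota> b' = ?\<iota> a'"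
      using y by (rule R.frac_ring_cases)
    have bb: "b \<otimes>\<^bsub>R\<^esub> b' \<in> carrier R" "b \<otimes>\<^bsub>R\<^esub> b' \<noteq> \<zero>\<^bsub>R\<^esub>"
      using ab ab' by (simp_all add: R.integral_iff)
    have hx: "H x \<in> carrier S" "h a = H x \<otimes>\<^bsub>S\<^esub> h b" and hy: "H y \<in> carrier S" "h a' = H y \<otimes>\<^bsub>S\<^esub> h b'"
      using HE[OF x ab] HE[OF y ab'] by simp_all
    have \<iota>b: "?\<iota> b \<in> carrier ?F" "?\<iota> b' \<in> carrier ?F" "h b \<in> carrier S" "h b' \<in> carrier S"
      using ab ab' by auto
    show "H (x \<otimes>\<^bsub>?F\<^esub> y) = H x \<otimes>\<^bsub>S\<^esub> H y"
    proof (rule HI[OF _ _ bb])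
      show "x \<otimes>\<^bsub>?F\<^esub> y \<otimes>\<^bsub>?F\<^esub> ?\<iota> (b \<otimes>\<^bsub>R\<^esub> b') = ?\<iota> (a \<otimes>\<^bsub>R\<^esub> a')"
        using ab(1-3) ab'(1-3) apply (simp add: \<iota> ab(4)[symmetric] ab'(4)[symmetric])
        using x y \<iota>b by algebra
      show "H x \<otimes>\<^bsub>S\<^esub> H y \<otimes>\<^bsub>S\<^esub> h (b \<otimes>\<^bsub>R\<^esub> b') = h (a \<otimes>\<^bsub>R\<^esub> a')"
        using ab(1-3) ab'(1-3) apply (simp add: hx(2) hy(2))
        using hx(1) hy(1) \<iota>b by algebra
    qed (use x y hx hy ab ab' in auto)
    show "H (x \<oplus>\<^bsub>?F\<^esub> y) = H x \<oplus>\<^bsub>S\<^esub> H y"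
    proof (rule HI[OF _ _ bb])
      show "(x \<oplus>\<^bsub>?F\<^esub> y) \<otimes>\<^bsub>?F\<^esub> ?\<iota> (b \<otimes>\<^bsub>R\<^esub> b') = ?\<iota> (a \<otimes>\<^bsub>R\<^esub> b' \<oplus>\<^bsub>R\<^esub> a' \<otimes>\<^bsub>R\<^esub> b)"
        using ab(1-3) ab'(1-3) apply (simp add: \<iota> ab(4)[symmetric] ab'(4)[symmetric])
        using x y \<iota>b by algebra
      show "(H x \<oplus>\<^bsub>S\<^esub> H y) \<otimes>\<^bsub>S\<^esub> h (b \<otimes>\<^bsub>R\<^esub> b') = h (a \<otimes>\<^bsub>R\<^esub> b' \<oplus>\<^bsub>R\<^esub> a' \<otimes>\<^bsub>R\<^esub> b)"
        using ab(1-3) ab'(1-3) apply (simp add: hx(2) hy(2))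
        using hx(1) hy(1) \<iota>b by algebra
    qed (use x y hx hy ab ab' in auto)
  next
    show "H \<one>\<^bsub>?F\<^esub> = \<one>\<^bsub>S\<^esub>"
      using H\<iota>[OF R.one_closed] ring_hom_one[OF R.to_frac_hom] by simp
  qed
  with H\<iota> that show thesis by blast
qed

text \<open>The purely algebraic extension already respects the brackets, because every element is a
  quotient of elements of \<open>R\<close> and brackets of quotients follow from those on
  \<open>R\<close>.\<close>

lemma frac_bidiff_hom_extend:
  assumes R: "domain R" "bidifferential_ring R" and S: "bidifferential_field S"
    and h: "bidifferential_hom R S h" and inj: "inj_on h (carrier R)"
  obtains H where "bidifferential_hom (frac_bidiff R) S H" "\<And>a. a \<in> carrier R \<Longrightarrow> H (to_frac R a) = h a"
proof -
  interpret R: domain R by fact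
  let ?F = "frac_bidiff R" and ?\<iota> = "to_frac R"
  have F: "bidifferential_field ?F" by (rule bidifferential_field_frac_bidiff[OF R])
  interpret F: bidifferential_field ?F by (rule F)
  interpret S: bidifferential_field S by fact
  note hD = bidifferential_homD[OF h] and \<iota>D = bidifferential_homD[OF bidifferential_hom_to_frac[OF R]]
  obtain H where H: "H \<in> ring_hom (frac_ring R) S" and H\<iota>: "\<And>a. a \<in> carrier R \<Longrightarrow> H (?\<iota> a) = h a"
    using frac_ring_hom_extend[OF R(1) S.field_axioms hD(1) inj] by blast
  have H': "H \<in> ring_hom ?F S" using H by (simp add: ring_hom_def)
  interpret H: ring_hom_ring ?F S H
    by (rule ring_hom_ringI2[OF F.ring_axioms S.ring_axioms H'])
  have hz: "h \<zero>\<^bsub>R\<^esub> = \<zero>\<^bsub>S\<^esub>" by (rule ring_hom_zero[OF hD(1) R.ring_axioms S.ring_axioms])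
  have "bidifferential_hom ?F S H"
  proof (rule bidifferential_hom_from_generators[OF F.bidifferential_ring_axioms S H',
        where J = "{\<zero>\<^bsub>?F\<^esub>}" and P = "?\<iota> ` carrier R"])
    show "bidifferential_ideal ?F {\<zero>\<^bsub>?F\<^esub>}"
      unfolding bidifferential_ideal_def
      using F.zeroideal F.derivation_zero[OF bidifferential_ring_derivation(1)[OF F.bidifferential_ring_axioms]]
        F.derivation_zero[OF bidifferential_ring_derivation(2)[OF F.bidifferential_ring_axioms]] by simp
    show "?\<iota> ` carrier R \<subseteq> carrier ?F" by auto
    show "H \<lbrace>a, b\<rbrace>\<^bsub>?F\<^esub> = \<lbrace>H a, H b\<rbrace>\<^bsub>S\<^esub>" if ab: "a \<in> ?\<iota> ` carrier R" "b \<in> ?\<iota> ` carrier R" for a b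
      using ab bracket_closed[OF R(2)] by (auto simp: \<iota>D(2)[symmetric] hD(2) H\<iota> simp del: frac_bidiff_simps)
    fix x assume x: "x \<in> carrier ?F"
    then have "x \<in> carrier (frac_ring R)" by simp
    then obtain a b where ab: "a \<in> carrier R" "b \<in> carrier R" "b \<noteq> \<zero>\<^bsub>R\<^esub>" "x \<otimes>\<^bsub>frac_ring R\<^esub> ?\<iota> b = ?\<iota> a"
      by (rule R.frac_ring_cases)
    have "H (?\<iota> b) \<noteq> \<zero>\<^bsub>S\<^esub>"
      using H\<iota> ab inj_onD[OF inj, of b "\<zero>\<^bsub>R\<^esub>"] hz by auto
    moreover have "x \<otimes>\<^bsub>?F\<^esub> ?\<iota> b \<ominus>\<^bsub>?F\<^esub> ?\<iota> a = \<zero>\<^bsub>?F\<^esub>"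
      using ab F.r_neg[of "?\<iota> a"] by (simp add: a_minus_def)
    ultimately show "\<exists>a\<in>?\<iota> ` carrier R. \<exists>e\<in>?\<iota> ` carrier R. H e \<noteq> \<zero>\<^bsub>S\<^esub> \<and> x \<otimes>\<^bsub>?F\<^esub> e \<ominus>\<^bsub>?F\<^esub> a \<in> {\<zero>\<^bsub>?F\<^esub>}"
      using ab by blast
  qed (use H.hom_zero in simp)
  with H\<iota> that show thesis by blast
qed

section \<open>Quotients by bidifferential ideals\<close>

lemma bidiff_quot_simps [simp]:
  "carrier (bidiff_quot R I) = carrier (R Quot I)"
  "x \<otimes>\<^bsub>bidiff_quot R I\<^esub> y = x \<otimes>\<^bsub>R Quot I\<^esub> y"
  "x \<oplus>\<^bsub>bidiff_quot R I\<^esub> y = x \<oplus>\<^bsub>R Quot I\<^esub> y"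
  "\<one>\<^bsub>bidiff_quot R I\<^esub> = \<one>\<^bsub>R Quot I\<^esub>"
  "\<zero>\<^bsub>bidiff_quot R I\<^esub> = \<zero>\<^bsub>R Quot I\<^esub>"
  by (simp_all add: bidiff_quot_def ring.defs bidiff_ring.defs)

lemma bidifferential_ring_bidiff_quot:
  assumes R: "bidifferential_ring R" and I: "bidifferential_ideal R I"
  shows "bidifferential_ring (bidiff_quot R I)"
proof -
  interpret R: bidifferential_ring R by fact
  interpret I: ideal I R using I by (simp add: bidifferential_ideal_def)
  let ?Q = "bidiff_quot R I"
  have Q: "cring ?Q"
    by (rule cring_cong[OF I.quotient_is_cring[OF R.cring_axioms]]) simp_all
  have cases: "\<exists>a\<in>carrier R. x = I +>\<^bsub>R\<^esub> a" if "x \<in> carrier ?Q" for x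
    using that by (auto simp: FactRing_def A_RCOSETS_def')
  have cos: "I +>\<^bsub>R\<^esub> a \<in> carrier ?Q" if "a \<in> carrier R" for a
    using that by (auto simp: FactRing_def A_RCOSETS_def')
  have ar: "(I +>\<^bsub>R\<^esub> a) \<oplus>\<^bsub>?Q\<^esub> (I +>\<^bsub>R\<^esub> b) = I +>\<^bsub>R\<^esub> (a \<oplus>\<^bsub>R\<^esub> b)"
      "(I +>\<^bsub>R\<^esub> a) \<otimes>\<^bsub>?Q\<^esub> (I +>\<^bsub>R\<^esub> b) = I +>\<^bsub>R\<^esub> (a \<otimes>\<^bsub>R\<^esub> b)" if "a \<in> carrier R" "b \<in> carrier R" for a b
    using that I.rcoset_mult_add by (simp_all add: FactRing_def I.a_rcos_sum)
  note D = bidifferential_ring_derivation[OF R, THEN derivationD(2)]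
    bidifferential_ring_derivation[OF R, THEN derivationD(3)]
  note br = bidiff_quot_bracket[OF R I]
  note cl = bracket_closed[OF R]
  have "derivation ?Q (\<lambda>s. \<lbrace>r, s\<rbrace>\<^bsub>?Q\<^esub>) \<and> derivation ?Q (\<lambda>s. \<lbrace>s, r\<rbrace>\<^bsub>?Q\<^esub>)" if r: "r \<in> carrier ?Q" for r
  proof -
    obtain c where c: "c \<in> carrier R" "r = I +>\<^bsub>R\<^esub> c" using cases[OF r] by blast
    \<comment> \<open>Quantifiers over cosets become quantifiers over representatives, on which the
      derivation laws are those of \<open>R\<close>.\<close>
    have ball: "(\<forall>x\<in>carrier ?Q. P x) \<longleftrightarrow> (\<forall>a\<in>carrier R. P (I +>\<^bsub>R\<^esub> a))" for P
      using cases cos by metis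
    show ?thesis
      unfolding derivation_def c(2) Pi_def mem_Collect_eq Ball_def[symmetric] ball
      using c(1) by (simp add: ar br cos cl D del: bidiff_quot_simps)
  qed
  then show ?thesis
    using Q by (auto simp: bidifferential_ring_def bidifferential_ring_axioms_def biderivation_def)
qed

lemma domain_of_inj_hom:
  assumes R: "cring R" and S: "domain S" and h: "h \<in> ring_hom R S" and inj: "inj_on h (carrier R)"
  shows "domain R"
proof -
  interpret R: cring R by fact
  interpret S: domain S by fact
  interpret h: ring_hom_ring R S h
    by (rule ring_hom_ringI2[OF R.ring_axioms S.ring_axioms h])
  have z: "h a = \<zero>\<^bsub>S\<^esub> \<longleftrightarrow> a = \<zero>\<^bsub>R\<^esub>" if "a \<in> carrier R" for a
    using inj_onD[OF inj, of a "\<zero>\<^bsub>R\<^esub>"] that by auto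
  show ?thesis
  proof
    show "\<one>\<^bsub>R\<^esub> \<noteq> \<zero>\<^bsub>R\<^esub>" using z[of "\<one>\<^bsub>R\<^esub>"] by auto
    show "a = \<zero>\<^bsub>R\<^esub> \<or> b = \<zero>\<^bsub>R\<^esub>"
      if "a \<otimes>\<^bsub>R\<^esub> b = \<zero>\<^bsub>R\<^esub>" "a \<in> carrier R" "b \<in> carrier R" for a b
    proof -
      have "h a \<otimes>\<^bsub>S\<^esub> h b = \<zero>\<^bsub>S\<^esub>" using that h.hom_mult[of a b] by simp
      then show ?thesis using that z S.integral_iff by auto
    qed
  qed
qed

text \<open>First isomorphism theorem with brackets. The ideal is a variable equated with the
  kernel, so that the result speaks directly about an ideal defined in another way, such as a fibre
  ideal.\<close>

lemma bidiff_quot_kernel_hom: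
  assumes T: "bidifferential_ring T" and S: "ring S" and \<psi>: "bidifferential_hom T S \<psi>"
    and J: "J = a_kernel T S \<psi>" "bidifferential_ideal T J"
  obtains \<Psi> where "bidifferential_hom (bidiff_quot T J) S \<Psi>" "inj_on \<Psi> (carrier (bidiff_quot T J))"
    "\<And>x. x \<in> carrier T \<Longrightarrow> \<Psi> (J +>\<^bsub>T\<^esub> x) = \<psi> x"
proof -
  interpret T: bidifferential_ring T by fact
  interpret \<psi>: ring_hom_ring T S \<psi>
    by (rule ring_hom_ringI2[OF T.ring_axioms S bidifferential_homD(1)[OF \<psi>]])
  \<comment> \<open>On a coset of its kernel \<open>\<psi>\<close> is constant, so the image of the
    coset is a singleton.\<close>
  define \<Psi> where "\<Psi> A = the_elem (\<psi> ` A)" for A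
  let ?Q = "bidiff_quot T J"
  have \<Psi>: "\<Psi> (J +>\<^bsub>T\<^esub> x) = \<psi> x" if "x \<in> carrier T" for x
    using \<psi>.the_elem_simp[OF that] by (simp add: J(1) \<Psi>_def)
  have cases: "\<exists>a\<in>carrier T. x = J +>\<^bsub>T\<^esub> a" if "x \<in> carrier ?Q" for x
    using that by (auto simp: FactRing_def A_RCOSETS_def')
  have "bidifferential_hom ?Q S \<Psi>"
  proof (rule bidifferential_homI)
    show "\<Psi> \<in> ring_hom ?Q S"
      unfolding \<Psi>_def J(1)
      by (intro ring_hom_memI) (simp_all add: ring_hom_memE[OF \<psi>.the_elem_hom])
    fix x y assume "x \<in> carrier ?Q" "y \<in> carrier ?Q"
    then obtain a b where "a \<in> carrier T" "x = J +>\<^bsub>T\<^esub> a" "b \<in> carrier T" "y = J +>\<^bsub>T\<^esub> b"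
      using cases by metis
    then show "\<Psi> \<lbrace>x, y\<rbrace>\<^bsub>?Q\<^esub> = \<lbrace>\<Psi> x, \<Psi> y\<rbrace>\<^bsub>S\<^esub>"
      by (simp add: bidiff_quot_bracket[OF T J(2)] \<Psi> bracket_closed[OF T] bidifferential_homD(2)[OF \<psi>])
  qed
  moreover have "inj_on \<Psi> (carrier ?Q)"
    using \<psi>.the_elem_inj by (auto simp: inj_on_def J(1) \<Psi>_def)
  ultimately show thesis using that \<Psi> by blast
qed

section \<open>Homomorphisms from tensor products\<close>

lemma is_tensor_productE:
  assumes "is_tensor_product k A i L j T p q"
  obtains h where "group_hom (free_Abelian_group (carrier A \<times> carrier L)) (add_monoid T) h"
    and "\<And>x z. x \<in> carrier A \<Longrightarrow> z \<in> carrier L \<Longrightarrow> h (frag_of (x, z)) = p x \<otimes>\<^bsub>T\<^esub> q z"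
    and "h ` carrier (free_Abelian_group (carrier A \<times> carrier L)) = carrier T"
    and "kernel (free_Abelian_group (carrier A \<times> carrier L)) (add_monoid T) h = tensor_relations k A i L j"
proof -
  interpret T: cring T using assms by (simp add: is_tensor_product_def)
  show thesis
    using assms unfolding is_tensor_product_def
    by (elim conjE bexE, intro that)
      (simp_all add: group_hom_def group_hom_axioms_def T.add.is_group
        del: carrier_free_Abelian_group_iff)
qed

text \<open>Surjectivity of the map from the free abelian group makes \<open>T\<close> additively
  generated by pure tensors. Differences cover sums and negatives at once and match
  \<open>free_Abelian_group_induct\<close>.\<close>

lemma tensor_product_induct [consumes 2, case_names zero pure minus]:
  assumes T: "is_tensor_product k A i L j T p q" and t: "t \<in> carrier T"
    and zero: "P \<zero>\<^bsub>T\<^esub>"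
    and pure: "\<And>a l. a \<in> carrier A \<Longrightarrow> l \<in> carrier L \<Longrightarrow> P (p a \<otimes>\<^bsub>T\<^esub> q l)"
    and minus: "\<And>x y. x \<in> carrier T \<Longrightarrow> y \<in> carrier T \<Longrightarrow> P x \<Longrightarrow> P y \<Longrightarrow> P (x \<ominus>\<^bsub>T\<^esub> y)"
  shows "P t"
proof -
  let ?S = "carrier A \<times> carrier L"
  let ?F = "free_Abelian_group ?S"
  interpret T: cring T using T by (simp add: is_tensor_product_def)
  obtain h where h: "group_hom ?F (add_monoid T) h"
    and hp: "\<And>x z. x \<in> carrier A \<Longrightarrow> z \<in> carrier L \<Longrightarrow> h (frag_of (x, z)) = p x \<otimes>\<^bsub>T\<^esub> q z"
    and onto: "h ` carrier ?F = carrier T"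
    using is_tensor_productE[OF T] by metis
  interpret h: group_hom ?F "add_monoid T" h
    by (rule h)
  have hm: "h (u - v) = h u \<ominus>\<^bsub>T\<^esub> h v" if "u \<in> carrier ?F" "v \<in> carrier ?F" for u v
    using h.hom_mult[of u "- v"] h.hom_inv[OF that(2)] that
    by (simp add: a_minus_def a_inv_def)
  have "t \<in> h ` carrier ?F" unfolding onto by (rule t)
  then obtain u where "u \<in> carrier ?F" and t': "t = h u" by (rule imageE)
  then have "Poly_Mapping.keys u \<subseteq> ?S" by simp
  then have "P (h u)"
  proof (rule free_Abelian_group_induct)
    show "P (h 0)" using zero h.hom_one by simp
    show "P (h (frag_of a))" if "a \<in> ?S" for a
      using that pure hp by auto
    fix x y
    assume "Poly_Mapping.keys x \<subseteq> ?S" "Poly_Mapping.keys y \<subseteq> ?S" and P: "P (h x)" "P (h y)"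
    then have xy: "x \<in> carrier ?F" "y \<in> carrier ?F" by simp_all
    show "P (h (x - y))"
      unfolding hm[OF xy] using minus[OF _ _ P] h.hom_closed[OF xy(1)] h.hom_closed[OF xy(2)] by simp
  qed
  then show ?thesis by (simp add: t')
qed

text \<open>This is the existence half of the universal property. The definition of
  \<open>is_tensor_product\<close> presents only the additive group of \<open>T\<close>, so the map
  is built additively and its multiplicativity is proved afterwards.\<close>

lemma tensor_product_hom:
  assumes T: "is_tensor_product k A i L j T p q" and A: "cring A" and L: "cring L" and S: "cring S"
    and ij: "\<And>c. c \<in> carrier k \<Longrightarrow> i c \<in> carrier A" "\<And>c. c \<in> carrier k \<Longrightarrow> j c \<in> carrier L"
    and \<phi>: "\<phi> \<in> ring_hom A S" and \<chi>: "\<chi> \<in> ring_hom L S"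
    and eq: "\<And>c. c \<in> carrier k \<Longrightarrow> \<phi> (i c) = \<chi> (j c)"
  obtains \<psi> where "\<psi> \<in> ring_hom T S" "\<And>a. a \<in> carrier A \<Longrightarrow> \<psi> (p a) = \<phi> a"
    "\<And>l. l \<in> carrier L \<Longrightarrow> \<psi> (q l) = \<chi> l"
proof -
  let ?S = "carrier A \<times> carrier L"
  let ?F = "free_Abelian_group ?S"
  interpret A: cring A by fact
  interpret L: cring L by fact
  interpret S: cring S by fact
  interpret T: cring T using T by (simp add: is_tensor_product_def)
  have p: "p \<in> ring_hom A T" and q: "q \<in> ring_hom L T"
    using T by (simp_all add: is_tensor_product_def)
  interpret p: ring_hom_ring A T p by (rule ring_hom_ringI2[OF A.ring_axioms T.ring_axioms p])
  interpret q: ring_hom_ring L T q by (rule ring_hom_ringI2[OF L.ring_axioms T.ring_axioms q])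
  interpret \<phi>: ring_hom_ring A S \<phi> by (rule ring_hom_ringI2[OF A.ring_axioms S.ring_axioms \<phi>])
  interpret \<chi>: ring_hom_ring L S \<chi> by (rule ring_hom_ringI2[OF L.ring_axioms S.ring_axioms \<chi>])
  obtain h where h: "group_hom ?F (add_monoid T) h"
    and hp: "\<And>x z. x \<in> carrier A \<Longrightarrow> z \<in> carrier L \<Longrightarrow> h (frag_of (x, z)) = p x \<otimes>\<^bsub>T\<^esub> q z"
    and onto: "h ` carrier ?F = carrier T"
    and ker: "kernel ?F (add_monoid T) h = tensor_relations k A i L j"
    using is_tensor_productE[OF T] by metis
  have "(\<lambda>(a, l). \<phi> a \<otimes>\<^bsub>S\<^esub> \<chi> l) ` ?S \<subseteq> carrier (add_monoid S)" by auto
  then obtain g where g: "g \<in> hom ?F (add_monoid S)"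
    and gp': "\<And>x. x \<in> ?S \<Longrightarrow> g (frag_of x) = (\<lambda>(a, l). \<phi> a \<otimes>\<^bsub>S\<^esub> \<chi> l) x"
    by (rule comm_group.free_Abelian_group_universal[OF S.a_comm_group]) blast
  have gp: "g (frag_of (x, z)) = \<phi> x \<otimes>\<^bsub>S\<^esub> \<chi> z" if "x \<in> carrier A" "z \<in> carrier L" for x z
    using gp'[of "(x, z)"] that by simp
  interpret h: group_hom ?F "add_monoid T" h
    by (rule h)
  interpret g: group_hom ?F "add_monoid S" g
    using g S.add.is_group by (simp add: group_hom_def group_hom_axioms_def)
  have hm: "h (u - v) = h u \<ominus>\<^bsub>T\<^esub> h v" if "u \<in> carrier ?F" "v \<in> carrier ?F" for u v
    using h.hom_mult[of u "- v"] h.hom_inv[OF that(2)] that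
    by (simp add: a_minus_def a_inv_def)
  have gm: "g (u - v) = g u \<ominus>\<^bsub>S\<^esub> g v" if "u \<in> carrier ?F" "v \<in> carrier ?F" for u v
    using g.hom_mult[of u "- v"] g.hom_inv[OF that(2)] that
    by (simp add: a_minus_def a_inv_def)
  have F_minus: "u - v \<in> carrier ?F" if "u \<in> carrier ?F" "v \<in> carrier ?F" for u v
    using that keys_diff[of u v] by auto
  have hc: "h u \<in> carrier T" and gc: "g u \<in> carrier S" if "u \<in> carrier ?F" for u
    using h.hom_closed[OF that] g.hom_closed[OF that] by simp_all
  have dd: "u \<oplus>\<^bsub>S\<^esub> v \<ominus>\<^bsub>S\<^esub> u = v" if "u \<in> carrier S" "v \<in> carrier S" for u v
    using that by algebra
  \<comment> \<open>The kernel of \<open>h\<close> is generated by the tensor relations, so killing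
    these generators makes \<open>g\<close> factor through \<open>h\<close>. The balancing relation
    is where \<open>eq\<close> enters.\<close>
  have "tensor_relations k A i L j \<subseteq> kernel ?F (add_monoid S) g"
    unfolding tensor_relations_def
  proof (rule h.generate_subgroup_incl[OF _ g.subgroup_kernel], (rule Un_least)+; clarify)
    fix x y z assume c: "x \<in> carrier A" "y \<in> carrier A" "z \<in> carrier L"
    let ?u = "frag_of (x \<oplus>\<^bsub>A\<^esub> y, z) - frag_of (x, z) - frag_of (y, z)"
    have "?u \<in> carrier ?F"
      by (intro F_minus) (use c in simp_all)
    moreover have "g ?u = \<zero>\<^bsub>S\<^esub>"
      using c by (simp add: gm F_minus gp del: carrier_free_Abelian_group_iff)
        (simp add: S.l_distr dd)
    ultimately show "?u \<in> kernel ?F (add_monoid S) g" by (simp add: kernel_def)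
  next
    fix x z w assume c: "x \<in> carrier A" "z \<in> carrier L" "w \<in> carrier L"
    let ?u = "frag_of (x, z \<oplus>\<^bsub>L\<^esub> w) - frag_of (x, z) - frag_of (x, w)"
    have "?u \<in> carrier ?F"
      by (intro F_minus) (use c in simp_all)
    moreover have "g ?u = \<zero>\<^bsub>S\<^esub>"
      using c by (simp add: gm F_minus gp del: carrier_free_Abelian_group_iff)
        (simp add: S.r_distr dd)
    ultimately show "?u \<in> kernel ?F (add_monoid S) g" by (simp add: kernel_def)
  next
    fix c x z assume c: "c \<in> carrier k" "x \<in> carrier A" "z \<in> carrier L"
    let ?u = "frag_of (i c \<otimes>\<^bsub>A\<^esub> x, z) - frag_of (x, j c \<otimes>\<^bsub>L\<^esub> z)"
    have "?u \<in> carrier ?F"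
      by (intro F_minus) (use c ij in simp_all)
    moreover have "g ?u = \<zero>\<^bsub>S\<^esub>"
      using c ij[OF c(1)] eq[OF c(1)] \<chi>.hom_closed[OF ij(2)[OF c(1)]]
      by (simp add: gm F_minus gp del: carrier_free_Abelian_group_iff)
        (simp add: S.m_ac S.r_neg a_minus_def)
    ultimately show "?u \<in> kernel ?F (add_monoid S) g" by (simp add: kernel_def)
  qed
  then have kk: "g u = \<zero>\<^bsub>S\<^esub>" if "u \<in> carrier ?F" "h u = \<zero>\<^bsub>T\<^esub>" for u
    using that ker by (auto simp: kernel_def)
  \<comment> \<open>The choice of a preimage under \<open>h\<close> is harmless: two preimages
    differ by an element of the kernel of \<open>h\<close>, which \<open>g\<close> kills.\<close>
  define \<psi> where "\<psi> t = g (SOME u. u \<in> carrier ?F \<and> h u = t)" for t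
  have \<psi>h: "\<psi> (h u) = g u" if u: "u \<in> carrier ?F" for u
  proof -
    define v where "v = (SOME v. v \<in> carrier ?F \<and> h v = h u)"
    have v: "v \<in> carrier ?F" "h v = h u"
      using someI[of "\<lambda>v. v \<in> carrier ?F \<and> h v = h u" u] u by (simp_all add: v_def)
    have "g (v - u) = \<zero>\<^bsub>S\<^esub>"
      using kk[OF F_minus[OF v(1) u]] hm[OF v(1) u] hc[OF u] v(2) by (simp add: T.r_neg a_minus_def)
    then have "g v = g u"
      using gm[OF v(1) u] gc[OF u] gc[OF v(1)] by simp
    then show ?thesis by (simp add: \<psi>_def v_def)
  qed
  have ex: "\<exists>u\<in>carrier ?F. h u = t" if t: "t \<in> carrier T" for t
  proof -
    have "t \<in> h ` carrier ?F" unfolding onto by (rule t)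
    then obtain u where "u \<in> carrier ?F" "t = h u" by (rule imageE)
    then show ?thesis by (intro bexI[of _ u]) simp_all
  qed
  have \<psi>c: "\<psi> t \<in> carrier S" if "t \<in> carrier T" for t
    using ex[OF that] gc \<psi>h by auto
  have \<psi>add: "\<psi> (s \<oplus>\<^bsub>T\<^esub> t) = \<psi> s \<oplus>\<^bsub>S\<^esub> \<psi> t" if st: "s \<in> carrier T" "t \<in> carrier T" for s t
  proof -
    obtain u v where uv: "u \<in> carrier ?F" "h u = s" "v \<in> carrier ?F" "h v = t"
      using ex st by metis
    have "u + v \<in> carrier ?F" "h (u + v) = s \<oplus>\<^bsub>T\<^esub> t" "g (u + v) = g u \<oplus>\<^bsub>S\<^esub> g v"
      using h.hom_mult[OF uv(1,3)] g.hom_mult[OF uv(1,3)] h.m_closed[OF uv(1,3)] uv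
      by (simp_all del: carrier_free_Abelian_group_iff)
    then show ?thesis using \<psi>h uv by metis
  qed
  have \<psi>minus: "\<psi> (s \<ominus>\<^bsub>T\<^esub> t) = \<psi> s \<ominus>\<^bsub>S\<^esub> \<psi> t" if st: "s \<in> carrier T" "t \<in> carrier T" for s t
  proof -
    obtain u v where uv: "u \<in> carrier ?F" "h u = s" "v \<in> carrier ?F" "h v = t"
      using ex st by metis
    then show ?thesis using \<psi>h F_minus[OF uv(1,3)] hm[OF uv(1,3)] gm[OF uv(1,3)] by metis
  qed
  have \<psi>z: "\<psi> \<zero>\<^bsub>T\<^esub> = \<zero>\<^bsub>S\<^esub>"
    using \<psi>minus[of "\<zero>\<^bsub>T\<^esub>" "\<zero>\<^bsub>T\<^esub>"] \<psi>c[of "\<zero>\<^bsub>T\<^esub>"] by (simp add: S.r_neg a_minus_def)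
  have \<psi>p: "\<psi> (p a \<otimes>\<^bsub>T\<^esub> q l) = \<phi> a \<otimes>\<^bsub>S\<^esub> \<chi> l" if "a \<in> carrier A" "l \<in> carrier L" for a l
    using \<psi>h[of "frag_of (a, l)"] that hp gp by simp
  have \<psi>pa: "\<psi> (p a) = \<phi> a" if "a \<in> carrier A" for a
    using \<psi>p[of a "\<one>\<^bsub>L\<^esub>"] that by simp
  have \<psi>ql: "\<psi> (q l) = \<chi> l" if "l \<in> carrier L" for l
    using \<psi>p[of "\<one>\<^bsub>A\<^esub>" l] that by simp
  \<comment> \<open>Multiplicativity is bilinear, so it is proved by induction on one factor at a
    time: here the left factor is a pure tensor, in \<open>m2\<close> it is arbitrary.\<close>
  have m1: "\<psi> ((p a \<otimes>\<^bsub>T\<^esub> q l) \<otimes>\<^bsub>T\<^esub> t) = \<psi> (p a \<otimes>\<^bsub>T\<^esub> q l) \<otimes>\<^bsub>S\<^esub> \<psi> t"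
    if al: "a \<in> carrier A" "l \<in> carrier L" and t: "t \<in> carrier T" for a l t
    using T t
  proof (induction rule: tensor_product_induct)
    case zero
    then show ?case using al \<psi>c by (simp add: \<psi>z)
  next
    case (pure b m)
    have e: "(p a \<otimes>\<^bsub>T\<^esub> q l) \<otimes>\<^bsub>T\<^esub> (p b \<otimes>\<^bsub>T\<^esub> q m) = p (a \<otimes>\<^bsub>A\<^esub> b) \<otimes>\<^bsub>T\<^esub> q (l \<otimes>\<^bsub>L\<^esub> m)"
      using al pure by (simp add: T.m_ac)
    have "\<psi> ((p a \<otimes>\<^bsub>T\<^esub> q l) \<otimes>\<^bsub>T\<^esub> (p b \<otimes>\<^bsub>T\<^esub> q m)) = \<phi> (a \<otimes>\<^bsub>A\<^esub> b) \<otimes>\<^bsub>S\<^esub> \<chi> (l \<otimes>\<^bsub>L\<^esub> m)"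
      unfolding e by (rule \<psi>p) (use al pure in simp_all)
    then show ?case using al pure by (simp add: \<psi>p S.m_ac)
  next
    case (minus x y)
    have c: "p a \<otimes>\<^bsub>T\<^esub> q l \<in> carrier T" using al by simp
    have "(p a \<otimes>\<^bsub>T\<^esub> q l) \<otimes>\<^bsub>T\<^esub> (x \<ominus>\<^bsub>T\<^esub> y) = (p a \<otimes>\<^bsub>T\<^esub> q l) \<otimes>\<^bsub>T\<^esub> x \<ominus>\<^bsub>T\<^esub> (p a \<otimes>\<^bsub>T\<^esub> q l) \<otimes>\<^bsub>T\<^esub> y"
      using c minus(1,2) by (simp add: a_minus_def T.r_distr T.r_minus)
    then show ?case
      using minus c \<psi>c by (simp add: \<psi>minus) (simp add: a_minus_def S.r_distr S.r_minus)
  qed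
  have m2: "\<psi> (s \<otimes>\<^bsub>T\<^esub> t) = \<psi> s \<otimes>\<^bsub>S\<^esub> \<psi> t" if s: "s \<in> carrier T" and t: "t \<in> carrier T" for s t
    using T s
  proof (induction rule: tensor_product_induct)
    case zero
    then show ?case using t \<psi>c by (simp add: \<psi>z)
  next
    case (pure a l)
    then show ?case using m1 t by simp
  next
    case (minus x y)
    have "(x \<ominus>\<^bsub>T\<^esub> y) \<otimes>\<^bsub>T\<^esub> t = x \<otimes>\<^bsub>T\<^esub> t \<ominus>\<^bsub>T\<^esub> y \<otimes>\<^bsub>T\<^esub> t"
      using t minus(1,2) by (simp add: a_minus_def T.l_distr T.l_minus)
    then show ?case
      using minus t \<psi>c by (simp add: \<psi>minus) (simp add: a_minus_def S.l_distr S.l_minus)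
  qed
  have "\<psi> \<in> ring_hom T S"
    using \<psi>c m2 \<psi>add \<psi>pa[OF A.one_closed] by (intro ring_hom_memI) simp_all
  with \<psi>pa \<psi>ql that show thesis by blast
qed

text \<open>It is the balancing relation at \<open>x = 1\<close> and \<open>z = 1\<close>. It makes
  the two routes from the base field into the tensor product agree.\<close>

lemma tensor_product_balanced:
  assumes T: "is_tensor_product k A i L j T p q" and A: "cring A" and L: "cring L"
    and c: "c \<in> carrier k" "i c \<in> carrier A" "j c \<in> carrier L"
  shows "p (i c) = q (j c)"
proof -
  let ?F = "free_Abelian_group (carrier A \<times> carrier L)"
  interpret A: cring A by fact
  interpret L: cring L by fact
  interpret T: cring T using T by (simp add: is_tensor_product_def)
  have p: "p \<in> ring_hom A T" and q: "q \<in> ring_hom L T"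
    using T by (simp_all add: is_tensor_product_def)
  obtain h where h: "group_hom ?F (add_monoid T) h"
    and hp: "\<And>x z. x \<in> carrier A \<Longrightarrow> z \<in> carrier L \<Longrightarrow> h (frag_of (x, z)) = p x \<otimes>\<^bsub>T\<^esub> q z"
    and ker: "kernel ?F (add_monoid T) h = tensor_relations k A i L j"
    using is_tensor_productE[OF T] by metis
  interpret h: group_hom ?F "add_monoid T" h
    by (rule h)
  let ?u = "frag_of (i c \<otimes>\<^bsub>A\<^esub> \<one>\<^bsub>A\<^esub>, \<one>\<^bsub>L\<^esub>)" and ?v = "frag_of (\<one>\<^bsub>A\<^esub>, j c \<otimes>\<^bsub>L\<^esub> \<one>\<^bsub>L\<^esub>)"
  have uv: "?u \<in> carrier ?F" "?v \<in> carrier ?F" using c by simp_all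
  have "?u - ?v \<in> tensor_relations k A i L j"
    unfolding tensor_relations_def using c by (intro generate.incl UnI2) blast
  then have "h (?u - ?v) = \<zero>\<^bsub>T\<^esub>" by (simp add: ker[symmetric] kernel_def)
  moreover have "h (?u - ?v) = h ?u \<ominus>\<^bsub>T\<^esub> h ?v"
    using h.hom_mult[of ?u "- ?v"] h.hom_inv[OF uv(2)] uv by (simp add: a_minus_def a_inv_def)
  moreover have "h ?u = p (i c)" "h ?v = q (j c)"
    using c ring_hom_closed[OF p] ring_hom_closed[OF q] ring_hom_one[OF p] ring_hom_one[OF q]
    by (simp_all add: hp)
  ultimately show ?thesis
    using ring_hom_closed[OF p c(2)] ring_hom_closed[OF q c(3)] by simp
qed

section \<open>The generic fibre\<close>

lemma a_kernel_iff: "x \<in> a_kernel R S h \<longleftrightarrow> x \<in> carrier R \<and> h x = \<zero>\<^bsub>S\<^esub>"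
  unfolding a_kernel_def' by (rule mem_Collect_eq)

lemma subset_radical:
  assumes "ring R" and I: "ideal I R" shows "I \<subseteq> radical R I"
proof
  interpret ring R by fact
  interpret I: ideal I R by fact
  fix x assume "x \<in> I"
  then have "x [^]\<^bsub>R\<^esub> (1::nat) \<in> I" "x \<in> carrier R" by (simp_all add: I.Icarr)
  then show "x \<in> radical R I" unfolding radical_def by blast
qed

text \<open>A domain has no nilpotents. Dominance and genericity are stated through radical ideals,
  so this is what lets them be applied to kernels; it also identifies the radical in the fibre
  ideal.\<close>

lemma radical_ideal_kernel:
  assumes A: "cring A" and B: "domain B" and h: "h \<in> ring_hom A B"
  shows "radical_ideal A (a_kernel A B h)"
proof -
  interpret A: cring A by fact
  interpret B: domain B by fact
  interpret h: ring_hom_ring A B h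
    by (rule ring_hom_ringI2[OF A.ring_axioms B.ring_axioms h])
  \<comment> \<open>\<open>radical\<close> admits the exponent 0; that case is excluded because
    \<open>1\<close> and \<open>0\<close> differ in a domain.\<close>
  have pow: "x = \<zero>\<^bsub>B\<^esub>" if "x [^]\<^bsub>B\<^esub> (n::nat) = \<zero>\<^bsub>B\<^esub>" "x \<in> carrier B" for x n
    using that by (induction n) (auto simp: B.integral_iff)
  have hp: "h (x [^]\<^bsub>A\<^esub> (n::nat)) = h x [^]\<^bsub>B\<^esub> n" if "x \<in> carrier A" for x n
    using that by (induction n) simp_all
  have "radical A (a_kernel A B h) = a_kernel A B h"
  proof
    show "radical A (a_kernel A B h) \<subseteq> a_kernel A B h"
    proof
      fix x assume "x \<in> radical A (a_kernel A B h)"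
      then have x: "x \<in> carrier A" and "\<exists>n::nat. x [^]\<^bsub>A\<^esub> n \<in> a_kernel A B h"
        by (simp_all add: radical_def)
      then obtain n :: nat where "x [^]\<^bsub>A\<^esub> n \<in> a_kernel A B h" by (elim exE)
      then have "h x [^]\<^bsub>B\<^esub> n = \<zero>\<^bsub>B\<^esub>"
        unfolding a_kernel_iff hp[OF x, symmetric] by (rule conjunct2)
      then show "x \<in> a_kernel A B h"
        unfolding a_kernel_iff using pow h.hom_closed[OF x] x by (intro conjI)
    qed
    show "a_kernel A B h \<subseteq> radical A (a_kernel A B h)"
      by (rule subset_radical[OF A.ring_axioms h.kernel_is_ideal])
  qed
  then show ?thesis
    using h.kernel_is_ideal by (simp add: radical_ideal_def)
qed

text \<open>
  The coefficients of the minimal polynomial of a constant of \<open>K\<close> over the image of \<open>L\<close> are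
  constants of \<open>L\<close>.
\<close>

lemma constants_algebraic_over_subfield:
  assumes L: "bidifferential_field L" and K: "bidifferential_field K" and \<Phi>: "bidifferential_hom L K \<Phi>"
    and k: "subfield k L" and rational: "\<And>c. c \<in> constants L \<Longrightarrow> ring.algebraic L k c"
    and c: "c \<in> constants K" and alg: "ring.algebraic K (\<Phi> ` carrier L) c"
  shows "ring.algebraic K (\<Phi> ` k) c"
proof -
  interpret L: bidifferential_field L by fact
  interpret K: bidifferential_field K by fact
  note H = bidifferential_homD[OF \<Phi>]
  interpret \<Phi>: ring_hom_ring L K \<Phi>
    by (rule ring_hom_ringI2[OF L.ring_axioms K.ring_axioms H(1)])
  have inj: "inj_on \<Phi> (carrier L)" and F: "subfield (\<Phi> ` carrier L) K"
    using \<Phi>.img_is_subfield[OF L.carrier_is_subfield] by simp_all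
  have k': "subfield (\<Phi> ` k) K"
    by (rule \<Phi>.img_is_subfield(2)[OF k]) simp
  have cK: "c \<in> carrier K" and c0: "\<And>x. x \<in> carrier K \<Longrightarrow> \<lbrace>c, x\<rbrace>\<^bsub>K\<^esub> = \<zero>\<^bsub>K\<^esub> \<and> \<lbrace>x, c\<rbrace>\<^bsub>K\<^esub> = \<zero>\<^bsub>K\<^esub>"
    using c by (simp_all add: constants_def)
  note dK = bidifferential_ring_derivation[OF K.bidifferential_ring_axioms]
  note cl = bracket_closed[OF L.bidifferential_ring_axioms]
  have alg': "(K.algebraic over (\<Phi> ` carrier L)) c"
    using alg by (simp add: over_def)
  define m where "m = K.Irr (\<Phi> ` carrier L) c"
  note I = K.IrrE[OF F cK alg', folded m_def]
  have z: "\<Phi> x = \<zero>\<^bsub>K\<^esub> \<longleftrightarrow> x = \<zero>\<^bsub>L\<^esub>" if "x \<in> carrier L" for x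
    using inj_onD[OF inj, of x "\<zero>\<^bsub>L\<^esub>"] that by auto
  have mF: "set m \<subseteq> \<Phi> ` carrier L" and mlc: "lead_coeff m \<noteq> \<zero>\<^bsub>K\<^esub>" and mne: "m \<noteq> []"
    using I(1-3) by (auto simp: univ_poly_def polynomial_def ring_irreducible_def)
  have coeff: "a \<in> {y \<in> carrier K. (K.algebraic over (\<Phi> ` k)) y}" if a: "a \<in> set m" for a
  proof -
    obtain b where b: "b \<in> carrier L" "a = \<Phi> b" using mF a by blast
    have "\<lbrace>\<Phi> x, a\<rbrace>\<^bsub>K\<^esub> = \<zero>\<^bsub>K\<^esub> \<and> \<lbrace>a, \<Phi> x\<rbrace>\<^bsub>K\<^esub> = \<zero>\<^bsub>K\<^esub>" if x: "x \<in> carrier L" for x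
    proof -
      have x': "\<Phi> x \<in> carrier K" using x by simp
      \<comment> \<open>Bracketing with \<open>\<Phi> x\<close> preserves the image of
        \<open>L\<close> because \<open>\<Phi>\<close> is bidifferential; this stability is what
        permits differentiating the minimal polynomial inside that subfield.\<close>
      have "(\<lambda>s. \<lbrace>\<Phi> x, s\<rbrace>\<^bsub>K\<^esub>) ` \<Phi> ` carrier L \<subseteq> \<Phi> ` carrier L"
        "(\<lambda>s. \<lbrace>s, \<Phi> x\<rbrace>\<^bsub>K\<^esub>) ` \<Phi> ` carrier L \<subseteq> \<Phi> ` carrier L"
        using x cl by (auto simp: H(2)[symmetric])
      then show ?thesis
        using K.derivation_Irr_coeffs[OF F dK(1)[OF x'] _ cK _ alg']
          K.derivation_Irr_coeffs[OF F dK(2)[OF x'] _ cK _ alg'] c0[OF x'] a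
        by (simp add: m_def)
    qed
    then have "b \<in> constants L"
      using b cl by (simp add: constants_def H(2)[symmetric] z)
    then have "K.algebraic (\<Phi> ` k) a"
      using rational algebraic_image_iff[OF L.field_axioms K.field_axioms H(1) k b(1)] b(2) by simp
    then show ?thesis using b by (simp add: over_def)
  qed
  have "m \<in> carrier ({y \<in> carrier K. (K.algebraic over (\<Phi> ` k)) y}[X]\<^bsub>K\<^esub>)"
    using coeff mlc mne by (auto simp: univ_poly_def polynomial_def)
  then have "(K.algebraic over {y \<in> carrier K. (K.algebraic over (\<Phi> ` k)) y}) c"
    using mne I(4) by (rule K.algebraicI)
  then have "(K.algebraic over (\<Phi> ` k)) c"
    by (rule K.algebraic_over_algebraics[OF k' cK])
  then show ?thesis by (simp add: over_def)
qed

text \<open>Modulo \<open>I\<close> the scalar \<open>\<sigma> a\<close> and the function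
  \<open>f a\<close> agree. Scalars of \<open>L\<close> are quotients of such values, so after
  multiplication by a common denominator the scalars occurring in \<open>t\<close> can be moved into
  \<open>B\<close>.\<close>

lemma tensor_clear_denominators:
  assumes T: "is_tensor_product k B i L j T p s" and A: "domain A" and B: "cring B" and L: "cring L"
    and f: "f \<in> ring_hom A B" and \<sigma>: "\<sigma> \<in> ring_hom A L"
    and frac: "\<And>l. l \<in> carrier L \<Longrightarrow> \<exists>a\<in>carrier A. \<exists>d\<in>carrier A. d \<noteq> \<zero>\<^bsub>A\<^esub> \<and> l \<otimes>\<^bsub>L\<^esub> \<sigma> d = \<sigma> a"
    and I: "ideal I T" "\<And>a. a \<in> carrier A \<Longrightarrow> s (\<sigma> a) \<ominus>\<^bsub>T\<^esub> p (f a) \<in> I"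
    and t: "t \<in> carrier T"
  shows "\<exists>d\<in>carrier A. \<exists>b\<in>carrier B. d \<noteq> \<zero>\<^bsub>A\<^esub> \<and> s (\<sigma> d) \<otimes>\<^bsub>T\<^esub> t \<ominus>\<^bsub>T\<^esub> p b \<in> I"
  using T t
proof (induction rule: tensor_product_induct)
  interpret A: domain A by fact
  interpret B: cring B by fact
  interpret L: cring L by fact
  interpret T: cring T using T by (simp add: is_tensor_product_def)
  have ps: "p \<in> ring_hom B T" "s \<in> ring_hom L T" using T by (simp_all add: is_tensor_product_def)
  interpret p: ring_hom_ring B T p by (rule ring_hom_ringI2[OF B.ring_axioms T.ring_axioms ps(1)])
  interpret s: ring_hom_ring L T s by (rule ring_hom_ringI2[OF L.ring_axioms T.ring_axioms ps(2)])
  interpret f: ring_hom_ring A B f by (rule ring_hom_ringI2[OF A.ring_axioms B.ring_axioms f])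
  interpret \<sigma>: ring_hom_ring A L \<sigma> by (rule ring_hom_ringI2[OF A.ring_axioms L.ring_axioms \<sigma>])
  interpret I: ideal I T by fact
  have minus: "x \<ominus>\<^bsub>T\<^esub> y \<in> I" if "x \<in> I" "y \<in> I" for x y
    using that by (simp add: a_minus_def)
  {
    case zero
    have "s (\<sigma> \<one>\<^bsub>A\<^esub>) \<otimes>\<^bsub>T\<^esub> \<zero>\<^bsub>T\<^esub> \<ominus>\<^bsub>T\<^esub> p \<zero>\<^bsub>B\<^esub> \<in> I" by (simp add: a_minus_def)
    then show ?case
      by (intro bexI[of _ "\<one>\<^bsub>A\<^esub>"] bexI[of _ "\<zero>\<^bsub>B\<^esub>"] conjI) simp_all
  next
    case (pure b l)
    \<comment> \<open>The denominator \<open>d\<close> of the scalar \<open>l\<close> is cleared,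
      and its numerator \<open>a\<close> crosses into \<open>B\<close> as
      \<open>f a\<close>.\<close>
    obtain a d where ad: "a \<in> carrier A" "d \<in> carrier A" "d \<noteq> \<zero>\<^bsub>A\<^esub>" "l \<otimes>\<^bsub>L\<^esub> \<sigma> d = \<sigma> a"
      using frac[OF pure(2)] by blast
    have "s l \<otimes>\<^bsub>T\<^esub> s (\<sigma> d) = s (\<sigma> a)"
      using pure ad by (simp flip: s.hom_mult)
    then have "s (\<sigma> d) \<otimes>\<^bsub>T\<^esub> (p b \<otimes>\<^bsub>T\<^esub> s l) \<ominus>\<^bsub>T\<^esub> p (b \<otimes>\<^bsub>B\<^esub> f a) = p b \<otimes>\<^bsub>T\<^esub> s (\<sigma> a) \<ominus>\<^bsub>T\<^esub> p b \<otimes>\<^bsub>T\<^esub> p (f a)"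
      using pure ad by (simp add: T.m_ac)
    also have "\<dots> = p b \<otimes>\<^bsub>T\<^esub> (s (\<sigma> a) \<ominus>\<^bsub>T\<^esub> p (f a))"
      using pure ad by (simp add: a_minus_def T.r_distr T.r_minus)
    also have "\<dots> \<in> I" using pure ad I by (intro I.I_l_closed) simp_all
    finally show ?case
      using ad pure by (intro bexI[of _ d] bexI[of _ "b \<otimes>\<^bsub>B\<^esub> f a"] conjI) simp_all
  next
    case (minus x y)
    obtain d b where db: "d \<in> carrier A" "b \<in> carrier B" "d \<noteq> \<zero>\<^bsub>A\<^esub>" "s (\<sigma> d) \<otimes>\<^bsub>T\<^esub> x \<ominus>\<^bsub>T\<^esub> p b \<in> I"
      using minus(3) by blast
    obtain d' b' where db': "d' \<in> carrier A" "b' \<in> carrier B" "d' \<noteq> \<zero>\<^bsub>A\<^esub>" "s (\<sigma> d') \<otimes>\<^bsub>T\<^esub> y \<ominus>\<^bsub>T\<^esub> p b' \<in> I"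
      using minus(4) by blast
    let ?\<delta> = "\<lambda>d. s (\<sigma> d) \<ominus>\<^bsub>T\<^esub> p (f d)"
    have c: "s (\<sigma> d) \<in> carrier T" "s (\<sigma> d') \<in> carrier T" "p (f d) \<in> carrier T" "p (f d') \<in> carrier T"
      "p b \<in> carrier T" "p b' \<in> carrier T" using db db' by simp_all
    have "s (\<sigma> (d \<otimes>\<^bsub>A\<^esub> d')) \<otimes>\<^bsub>T\<^esub> (x \<ominus>\<^bsub>T\<^esub> y) \<ominus>\<^bsub>T\<^esub> p (f d' \<otimes>\<^bsub>B\<^esub> b \<ominus>\<^bsub>B\<^esub> f d \<otimes>\<^bsub>B\<^esub> b') =
      s (\<sigma> d) \<otimes>\<^bsub>T\<^esub> s (\<sigma> d') \<otimes>\<^bsub>T\<^esub> (x \<ominus>\<^bsub>T\<^esub> y) \<ominus>\<^bsub>T\<^esub> (p (f d') \<otimes>\<^bsub>T\<^esub> p b \<ominus>\<^bsub>T\<^esub> p (f d) \<otimes>\<^bsub>T\<^esub> p b')"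
      using db(1,2) db'(1,2) by (simp add: a_minus_def[of B] a_minus_def[of T "p (f d') \<otimes>\<^bsub>T\<^esub> p b"])
    \<comment> \<open>With the common denominator \<open>d d'\<close>, the difference is rearranged
      into four terms of \<open>I\<close>: two from the induction hypotheses, and two replacing
      \<open>\<sigma>\<close> by \<open>f\<close> on \<open>d\<close> and \<open>d'\<close>.\<close>
    also have "\<dots> =
      (s (\<sigma> d') \<otimes>\<^bsub>T\<^esub> (s (\<sigma> d) \<otimes>\<^bsub>T\<^esub> x \<ominus>\<^bsub>T\<^esub> p b) \<oplus>\<^bsub>T\<^esub> p b \<otimes>\<^bsub>T\<^esub> ?\<delta> d') \<ominus>\<^bsub>T\<^esub>
      (s (\<sigma> d) \<otimes>\<^bsub>T\<^esub> (s (\<sigma> d') \<otimes>\<^bsub>T\<^esub> y \<ominus>\<^bsub>T\<^esub> p b') \<oplus>\<^bsub>T\<^esub> p b' \<otimes>\<^bsub>T\<^esub> ?\<delta> d)"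
      using c minus(1,2) by algebra
    also have "\<dots> \<in> I"
      by (intro \<open>\<And>x y. x \<in> I \<Longrightarrow> y \<in> I \<Longrightarrow> x \<ominus>\<^bsub>T\<^esub> y \<in> I\<close> I.a_closed I.I_l_closed I(2) db(1,4) db'(1,4) c)
    finally have "s (\<sigma> (d \<otimes>\<^bsub>A\<^esub> d')) \<otimes>\<^bsub>T\<^esub> (x \<ominus>\<^bsub>T\<^esub> y) \<ominus>\<^bsub>T\<^esub> p (f d' \<otimes>\<^bsub>B\<^esub> b \<ominus>\<^bsub>B\<^esub> f d \<otimes>\<^bsub>B\<^esub> b') \<in> I" .
    moreover have "d \<otimes>\<^bsub>A\<^esub> d' \<in> carrier A" "d \<otimes>\<^bsub>A\<^esub> d' \<noteq> \<zero>\<^bsub>A\<^esub>" "f d' \<otimes>\<^bsub>B\<^esub> b \<ominus>\<^bsub>B\<^esub> f d \<otimes>\<^bsub>B\<^esub> b' \<in> carrier B"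
      using db db' by (simp_all add: A.integral_iff)
    ultimately show ?case
      by (intro bexI[of _ "d \<otimes>\<^bsub>A\<^esub> d'"] bexI[of _ "f d' \<otimes>\<^bsub>B\<^esub> b \<ominus>\<^bsub>B\<^esub> f d \<otimes>\<^bsub>B\<^esub> b'"] conjI)
  }
qed

section \<open>Injectivity from dominance and genericity\<close>

lemma inj_on_of_trivial_kernel:
  assumes A: "ring A" and B: "ring B" and h: "h \<in> ring_hom A B" and "a_kernel A B h = {\<zero>\<^bsub>A\<^esub>}"
  shows "inj_on h (carrier A)"
proof -
  interpret h: ring_hom_ring A B h by (rule ring_hom_ringI2[OF A B h])
  show ?thesis by (rule h.trivial_ker_imp_inj) fact
qed

text \<open>The kernel of \<open>f\<close> is a radical ideal whose zero set contains the image of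
  the morphism, so dominance forces it to vanish.\<close>

lemma dominant_imp_inj:
  assumes A: "cring (coord_ring W)" and B: "domain (coord_ring V)"
    and f: "f \<in> ring_hom (coord_ring W) (coord_ring V)" and dom: "dominant V W f"
  shows "inj_on f (carrier (coord_ring W))"
proof (rule inj_on_of_trivial_kernel[OF cring.axioms(1)[OF A] cring.axioms(1)[OF domain.axioms(1)[OF B]] f])
  show "a_kernel (coord_ring W) (coord_ring V) f = {\<zero>\<^bsub>coord_ring W\<^esub>}"
    using dom radical_ideal_kernel[OF A B f] unfolding dominant_def by (auto simp: a_kernel_iff)
qed

text \<open>A nonzero kernel of evaluation would cut out a proper closed subvariety over
  \<open>k\<close> containing the point.\<close>

lemma generic_point_imp_inj:
  assumes A: "cring (coord_ring W)" and L: "domain L"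
    and \<sigma>: "(\<lambda>a. \<alpha> (q a)) \<in> ring_hom (coord_ring W) L" and gen: "generic_point L W q \<alpha>"
  shows "inj_on (\<lambda>a. \<alpha> (q a)) (carrier (coord_ring W))"
proof (rule inj_on_of_trivial_kernel[OF cring.axioms(1)[OF A] cring.axioms(1)[OF domain.axioms(1)[OF L]] \<sigma>])
  show "a_kernel (coord_ring W) L (\<lambda>a. \<alpha> (q a)) = {\<zero>\<^bsub>coord_ring W\<^esub>}"
    using gen radical_ideal_kernel[OF A L \<sigma>] unfolding generic_point_def by (auto simp: a_kernel_iff)
qed

text \<open>If \<open>\<psi> t = 0\<close> and \<open>s l t - p b\<close> lies in \<open>I\<close>,
  then \<open>\<psi>\<close> kills \<open>p b\<close>, hence \<open>p b = 0\<close> and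
  \<open>s l t\<close> lies in \<open>I\<close>. The scalar \<open>l\<close> is a unit of
  \<open>L\<close>, so \<open>t\<close> lies in \<open>I\<close> as well.\<close>

lemma kernel_eq_of_denominators:
  assumes T: "cring T" and L: "field L" and K: "ring K" and \<psi>: "\<psi> \<in> ring_hom T K" and s: "s \<in> ring_hom L T"
    and pc: "\<And>b. b \<in> B \<Longrightarrow> p b \<in> carrier T"
    and inj: "\<And>b. b \<in> B \<Longrightarrow> \<psi> (p b) = \<zero>\<^bsub>K\<^esub> \<Longrightarrow> p b = \<zero>\<^bsub>T\<^esub>"
    and I: "ideal I T" "I \<subseteq> a_kernel T K \<psi>"
    and den: "\<And>t. t \<in> carrier T \<Longrightarrow> \<exists>l\<in>carrier L. \<exists>b\<in>B. l \<noteq> \<zero>\<^bsub>L\<^esub> \<and> s l \<otimes>\<^bsub>T\<^esub> t \<ominus>\<^bsub>T\<^esub> p b \<in> I"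
  shows "I = a_kernel T K \<psi>"
proof
  interpret T: cring T by (rule T)
  interpret L: field L by (rule L)
  interpret K: ring K by (rule K)
  interpret I: ideal I T by (rule I(1))
  interpret \<psi>: ring_hom_ring T K \<psi> by (rule ring_hom_ringI2[OF T.ring_axioms K \<psi>])
  interpret s: ring_hom_ring L T s by (rule ring_hom_ringI2[OF L.ring_axioms T.ring_axioms s])
  show "a_kernel T K \<psi> \<subseteq> I"
  proof
    fix t assume "t \<in> a_kernel T K \<psi>"
    then have t: "t \<in> carrier T" "\<psi> t = \<zero>\<^bsub>K\<^esub>"
      unfolding a_kernel_iff by (rule conjunct1, rule conjunct2)
    obtain l b where l: "l \<in> carrier L" "l \<noteq> \<zero>\<^bsub>L\<^esub>" and b: "b \<in> B" and e: "s l \<otimes>\<^bsub>T\<^esub> t \<ominus>\<^bsub>T\<^esub> p b \<in> I"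
      using den[OF t(1)] by (elim bexE conjE)
    have "\<psi> (s l \<otimes>\<^bsub>T\<^esub> t \<ominus>\<^bsub>T\<^esub> p b) = \<zero>\<^bsub>K\<^esub>" using subsetD[OF I(2) e] unfolding a_kernel_iff by (rule conjunct2)
    then have "\<psi> (p b) = \<zero>\<^bsub>K\<^esub>" using l t pc[OF b] by (simp add: a_minus_def)
    then have "p b = \<zero>\<^bsub>T\<^esub>" by (rule inj[OF b])
    then have st: "s l \<otimes>\<^bsub>T\<^esub> t \<in> I" using e l t by (simp add: a_minus_def)
    have "l \<in> Units L" using l by (simp add: L.field_Units)
    then have il: "inv\<^bsub>L\<^esub> l \<in> carrier L" "inv\<^bsub>L\<^esub> l \<otimes>\<^bsub>L\<^esub> l = \<one>\<^bsub>L\<^esub>" by simp_all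
    have "s (inv\<^bsub>L\<^esub> l) \<otimes>\<^bsub>T\<^esub> (s l \<otimes>\<^bsub>T\<^esub> t) = s (inv\<^bsub>L\<^esub> l \<otimes>\<^bsub>L\<^esub> l) \<otimes>\<^bsub>T\<^esub> t"
      using l il(1) t by (simp add: T.m_assoc)
    also have "\<dots> = t" using t by (simp add: il(2))
    finally show "t \<in> I" using I.I_l_closed[OF st, of "s (inv\<^bsub>L\<^esub> l)"] il(1) by simp
  qed
qed (rule I)

text \<open>
  In the next two lemmas, \<open>A \<rightarrow> B\<close> corresponds to \<open>\<phi>: X \<rightarrow> Y\<close>, the point
  \<open>\<alpha>\<close> to \<open>\<sigma>: A \<rightarrow> L\<close>, and \<open>L[X\<^sub>\<alpha>]\<close> is \<open>T\<close> modulo \<open>I\<close>; it is the localization of \<open>B\<close> at the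
  nonzero elements of \<open>A\<close> because \<open>L\<close> consists of quotients of elements of \<open>\<sigma>(A)\<close>.
\<close>

lemma generic_fibre_kernel:
  assumes T: "is_tensor_product k B i L j T p s" and A: "domain A" and B: "domain B" and L: "field L"
    and K: "field K"
    and f: "f \<in> ring_hom A B" and \<sigma>: "\<sigma> \<in> ring_hom A L" "inj_on \<sigma> (carrier A)"
    and frac: "\<And>l. l \<in> carrier L \<Longrightarrow> \<exists>a\<in>carrier A. \<exists>d\<in>carrier A. d \<noteq> \<zero>\<^bsub>A\<^esub> \<and> l \<otimes>\<^bsub>L\<^esub> \<sigma> d = \<sigma> a"
    and I: "ideal I T" "I \<subseteq> a_kernel T K \<psi>" "\<And>a. a \<in> carrier A \<Longrightarrow> s (\<sigma> a) \<ominus>\<^bsub>T\<^esub> p (f a) \<in> I"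
    and \<psi>: "\<psi> \<in> ring_hom T K" "inj_on (\<lambda>b. \<psi> (p b)) (carrier B)"
  shows "I = a_kernel T K \<psi>"
proof -
  interpret A: domain A by fact
  interpret B: domain B by fact
  interpret L: field L by fact
  interpret K: field K by fact
  have T': "cring T" "p \<in> ring_hom B T" "s \<in> ring_hom L T"
    using T by (simp_all add: is_tensor_product_def)
  interpret T: cring T by (rule T')
  have z: "p \<zero>\<^bsub>B\<^esub> = \<zero>\<^bsub>T\<^esub>" "\<psi> \<zero>\<^bsub>T\<^esub> = \<zero>\<^bsub>K\<^esub>" "\<sigma> \<zero>\<^bsub>A\<^esub> = \<zero>\<^bsub>L\<^esub>"
    using ring_hom_zero[OF T'(2) B.ring_axioms T.ring_axioms]
      ring_hom_zero[OF \<psi>(1) T.ring_axioms K.ring_axioms]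
      ring_hom_zero[OF \<sigma>(1) A.ring_axioms L.ring_axioms] by simp_all
  show ?thesis
  proof (rule kernel_eq_of_denominators[OF T.cring_axioms L K.ring_axioms \<psi>(1) T'(3) _ _ I(1,2)])
    show "p b \<in> carrier T" if "b \<in> carrier B" for b
      by (rule ring_hom_closed[OF T'(2) that])
    show "p b = \<zero>\<^bsub>T\<^esub>" if "b \<in> carrier B" "\<psi> (p b) = \<zero>\<^bsub>K\<^esub>" for b
      using inj_onD[OF \<psi>(2) _ that(1) B.zero_closed] that(2) z by simp
    fix t assume t: "t \<in> carrier T"
    have "\<exists>d\<in>carrier A. \<exists>b\<in>carrier B. d \<noteq> \<zero>\<^bsub>A\<^esub> \<and> s (\<sigma> d) \<otimes>\<^bsub>T\<^esub> t \<ominus>\<^bsub>T\<^esub> p b \<in> I"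
      by (rule tensor_clear_denominators[OF T A B.cring_axioms L.cring_axioms f \<sigma>(1) frac I(1,3) t])
    then obtain d b where db: "d \<in> carrier A" "b \<in> carrier B" "d \<noteq> \<zero>\<^bsub>A\<^esub>" "s (\<sigma> d) \<otimes>\<^bsub>T\<^esub> t \<ominus>\<^bsub>T\<^esub> p b \<in> I"
      by (elim bexE conjE)
    have "\<sigma> d \<noteq> \<zero>\<^bsub>L\<^esub>"
      using inj_onD[OF \<sigma>(2) _ db(1) A.zero_closed] db(3) z(3) by auto
    then show "\<exists>l\<in>carrier L. \<exists>b\<in>carrier B. l \<noteq> \<zero>\<^bsub>L\<^esub> \<and> s l \<otimes>\<^bsub>T\<^esub> t \<ominus>\<^bsub>T\<^esub> p b \<in> I"
      using db ring_hom_closed[OF \<sigma>(1) db(1)] by (intro bexI[of _ "\<sigma> d"] bexI[of _ b] conjI)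
  qed
qed

lemma generic_fibre_bidifferential_hom:
  assumes T: "is_tensor_product k B i L j T p s" and A: "domain A" and B: "domain B" and L: "field L"
    and f: "f \<in> ring_hom A B" "inj_on f (carrier A)" and \<sigma>: "\<sigma> \<in> ring_hom A L"
    and frac: "\<And>l. l \<in> carrier L \<Longrightarrow> \<exists>a\<in>carrier A. \<exists>d\<in>carrier A. d \<noteq> \<zero>\<^bsub>A\<^esub> \<and> l \<otimes>\<^bsub>L\<^esub> \<sigma> d = \<sigma> a"
    and I: "bidifferential_ideal T I" "I \<subseteq> a_kernel T K \<psi>" "\<And>a. a \<in> carrier A \<Longrightarrow> s (\<sigma> a) \<ominus>\<^bsub>T\<^esub> p (f a) \<in> I"
    and \<psi>: "\<psi> \<in> ring_hom T K" "inj_on (\<lambda>b. \<psi> (p b)) (carrier B)"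
    and bd: "bidifferential_ring T" "bidifferential_field K" "bidifferential_hom B T p"
      "bidifferential_hom B K (\<lambda>b. \<psi> (p b))" "bidifferential_ring B"
  shows "bidifferential_hom T K \<psi>"
proof -
  interpret A: domain A by fact
  interpret B: domain B by fact
  interpret L: field L by fact
  interpret K: bidifferential_field K by fact
  have T': "cring T" "p \<in> ring_hom B T" "s \<in> ring_hom L T"
    using T by (simp_all add: is_tensor_product_def)
  interpret T: cring T by (rule T')
  interpret I: ideal I T using I(1) by (simp add: bidifferential_ideal_def)
  have z: "p \<zero>\<^bsub>B\<^esub> = \<zero>\<^bsub>T\<^esub>" "\<psi> \<zero>\<^bsub>T\<^esub> = \<zero>\<^bsub>K\<^esub>" "f \<zero>\<^bsub>A\<^esub> = \<zero>\<^bsub>B\<^esub>"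
    using ring_hom_zero[OF T'(2) B.ring_axioms T.ring_axioms]
      ring_hom_zero[OF \<psi>(1) T.ring_axioms K.ring_axioms]
      ring_hom_zero[OF f(1) A.ring_axioms B.ring_axioms] by simp_all
  note pc = ring_hom_closed[OF T'(2)] and sc = ring_hom_closed[OF T'(3)]
    and fc = ring_hom_closed[OF f(1)] and \<sigma>c = ring_hom_closed[OF \<sigma>(1)]
  show ?thesis
  proof (rule bidifferential_hom_from_generators[OF bd(1,2) \<psi>(1) I(1), where P = "p ` carrier B"])
    show "\<psi> x = \<zero>\<^bsub>K\<^esub>" if "x \<in> I" for x
      using I(2) that by (simp add: a_kernel_iff subset_iff)
    show "p ` carrier B \<subseteq> carrier T" using pc by (simp add: image_subset_iff)
    show "\<psi> \<lbrace>x, y\<rbrace>\<^bsub>T\<^esub> = \<lbrace>\<psi> x, \<psi> y\<rbrace>\<^bsub>K\<^esub>" if xy: "x \<in> p ` carrier B" "y \<in> p ` carrier B" for x y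
    proof -
      obtain a b where "a \<in> carrier B" "x = p a" "b \<in> carrier B" "y = p b"
        using xy by (elim imageE)
      then show ?thesis
        using bidifferential_homD(2)[OF bd(4)] bidifferential_homD(2)[OF bd(3)] by metis
    qed
    fix t assume t: "t \<in> carrier T"
    have "\<exists>d\<in>carrier A. \<exists>b\<in>carrier B. d \<noteq> \<zero>\<^bsub>A\<^esub> \<and> s (\<sigma> d) \<otimes>\<^bsub>T\<^esub> t \<ominus>\<^bsub>T\<^esub> p b \<in> I"
      by (rule tensor_clear_denominators[OF T A B.cring_axioms L.cring_axioms f(1) \<sigma> frac I.ideal_axioms I(3) t])
    then obtain d b where db: "d \<in> carrier A" "b \<in> carrier B" "d \<noteq> \<zero>\<^bsub>A\<^esub>" "s (\<sigma> d) \<otimes>\<^bsub>T\<^esub> t \<ominus>\<^bsub>T\<^esub> p b \<in> I"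
      by (elim bexE conjE)
    have c: "s (\<sigma> d) \<in> carrier T" "p (f d) \<in> carrier T" "p b \<in> carrier T"
      using db pc sc fc \<sigma>c by simp_all
    have "f d \<noteq> \<zero>\<^bsub>B\<^esub>"
      using inj_onD[OF f(2) _ db(1) A.zero_closed] db(3) z(3) by auto
    then have nz: "\<psi> (p (f d)) \<noteq> \<zero>\<^bsub>K\<^esub>"
      using inj_onD[OF \<psi>(2) _ fc[OF db(1)] B.zero_closed] z by auto
    have "t \<otimes>\<^bsub>T\<^esub> p (f d) \<ominus>\<^bsub>T\<^esub> p b = (s (\<sigma> d) \<otimes>\<^bsub>T\<^esub> t \<ominus>\<^bsub>T\<^esub> p b) \<oplus>\<^bsub>T\<^esub> \<ominus>\<^bsub>T\<^esub> (t \<otimes>\<^bsub>T\<^esub> (s (\<sigma> d) \<ominus>\<^bsub>T\<^esub> p (f d)))"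
      using c t by algebra
    also have "\<dots> \<in> I"
      by (intro I.a_closed I.a_inv_closed I.I_l_closed I(3) db t)
    finally show "\<exists>a\<in>p ` carrier B. \<exists>e\<in>p ` carrier B. \<psi> e \<noteq> \<zero>\<^bsub>K\<^esub> \<and> t \<otimes>\<^bsub>T\<^esub> e \<ominus>\<^bsub>T\<^esub> a \<in> I"
      using nz by (intro bexI[of _ "p b"] bexI[of _ "p (f d)"] conjI imageI fc db)
  qed
qed

text \<open>The intended pair is the constant function \<open>\<sigma> a\<close> and the function
  \<open>q a\<close>: both have the value \<open>\<sigma> a\<close> at the point, so their
  difference vanishes there.\<close>

lemma ring_hom_kernel_differences:
  assumes T: "cring T" and U: "cring U" and L: "ring L" and \<alpha>: "\<alpha> \<in> ring_hom U L" and f: "f \<in> ring_hom U T"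
    and xy: "x \<in> carrier U" "y \<in> carrier U" "\<alpha> x = \<alpha> y"
  shows "f x \<ominus>\<^bsub>T\<^esub> f y \<in> f ` a_kernel U L \<alpha>"
proof -
  interpret T: cring T by (rule T)
  interpret U: cring U by (rule U)
  interpret L: ring L by (rule L)
  interpret \<alpha>: ring_hom_ring U L \<alpha> by (rule ring_hom_ringI2[OF U.ring_axioms L \<alpha>])
  interpret f: ring_hom_ring U T f by (rule ring_hom_ringI2[OF U.ring_axioms T.ring_axioms f])
  have "f x \<ominus>\<^bsub>T\<^esub> f y = f (x \<ominus>\<^bsub>U\<^esub> y)" using xy by (simp add: a_minus_def)
  moreover have "\<alpha> (x \<ominus>\<^bsub>U\<^esub> y) = \<zero>\<^bsub>L\<^esub>" using xy \<alpha>.hom_closed[OF xy(2)] by (simp add: a_minus_def L.r_neg)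
  moreover have "x \<ominus>\<^bsub>U\<^esub> y \<in> carrier U" using xy by simp
  ultimately show ?thesis unfolding a_kernel_iff image_iff Bex_def by (intro exI[of _ "x \<ominus>\<^bsub>U\<^esub> y"] conjI)
qed

text \<open>This is the uniqueness half of the universal property: pure tensors generate
  \<open>T\<close> additively.\<close>

lemma tensor_product_hom_eqI:
  assumes T: "is_tensor_product k A i L j T p q" and S: "ring S"
    and h: "h \<in> ring_hom T S" and h': "h' \<in> ring_hom T S"
    and p: "\<And>a. a \<in> carrier A \<Longrightarrow> h (p a) = h' (p a)" and q: "\<And>l. l \<in> carrier L \<Longrightarrow> h (q l) = h' (q l)"
    and t: "t \<in> carrier T"
  shows "h t = h' t"
proof -
  have T': "cring T" "p \<in> ring_hom A T" "q \<in> ring_hom L T"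
    using T by (simp_all add: is_tensor_product_def)
  interpret T: cring T by (rule T')
  interpret S: ring S by (rule S)
  interpret h: ring_hom_ring T S h by (rule ring_hom_ringI2[OF T.ring_axioms S h])
  interpret h': ring_hom_ring T S h' by (rule ring_hom_ringI2[OF T.ring_axioms S h'])
  show ?thesis
    using T t
  proof (induction rule: tensor_product_induct)
    case (pure a l)
    then show ?case using p q ring_hom_closed[OF T'(2)] ring_hom_closed[OF T'(3)] by simp
  qed (simp_all add: a_minus_def)
qed

lemma frac_ring_denominators:
  assumes A: "domain A" and \<tau>: "\<tau> \<in> ring_hom (frac_ring A) L" "\<tau> ` carrier (frac_ring A) = carrier L"
    and \<tau>\<sigma>: "\<And>a. a \<in> carrier A \<Longrightarrow> \<tau> (to_frac A a) = \<sigma> a" and l: "l \<in> carrier L"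
  shows "\<exists>a\<in>carrier A. \<exists>d\<in>carrier A. d \<noteq> \<zero>\<^bsub>A\<^esub> \<and> l \<otimes>\<^bsub>L\<^esub> \<sigma> d = \<sigma> a"
proof -
  obtain x where x: "x \<in> carrier (frac_ring A)" "l = \<tau> x"
    using l unfolding \<tau>(2)[symmetric] by (elim imageE)
  obtain a b where ab: "a \<in> carrier A" "b \<in> carrier A" "b \<noteq> \<zero>\<^bsub>A\<^esub>"
    "x \<otimes>\<^bsub>frac_ring A\<^esub> to_frac A b = to_frac A a"
    using domain.frac_ring_cases[OF A x(1)] .
  have "\<tau> x \<otimes>\<^bsub>L\<^esub> \<tau> (to_frac A b) = \<tau> (to_frac A a)"
    using ring_hom_mult[OF \<tau>(1) x(1) domain.to_frac_closed[OF A ab(2)]] by (simp add: ab(4))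
  then show ?thesis using ab x \<tau>\<sigma> by (intro bexI[of _ a] bexI[of _ b]) simp_all
qed

text \<open>\<open>\<Theta>\<close> is a surjective homomorphism of fields, hence an isomorphism.
  B-rationality can therefore be tested in \<open>K\<close>, so that both varieties of the theorem
  are compared inside the one field \<open>k(X)\<close>.\<close>

lemma B_rational_iff:
  assumes V: "bidifferential_ring (coord_ring V)" "domain (coord_ring V)"
    and L: "field L" and K: "bidifferential_field K" and s: "scalar V \<in> ring_hom L (coord_ring V)"
    and \<Theta>: "bidifferential_hom (function_field V) K \<Theta>" "\<Theta> ` carrier (function_field V) = carrier K"
  shows "B_rational L V \<longleftrightarrow> (\<forall>c\<in>constants K. ring.algebraic K ((\<Theta> \<circ> function_field_scalar V) ` carrier L) c)"
proof -
  interpret F: bidifferential_field "function_field V"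
    by (rule bidifferential_field_frac_bidiff[OF V(2,1)])
  interpret K: bidifferential_field K by (rule K)
  interpret L: field L by (rule L)
  note H = bidifferential_homD[OF \<Theta>(1)]
  interpret \<Theta>: ring_hom_ring "function_field V" K \<Theta>
    by (rule ring_hom_ringI2[OF F.ring_axioms K.ring_axioms H(1)])
  have bij: "bij_betw \<Theta> (carrier (function_field V)) (carrier K)"
    unfolding bij_betw_def using \<Theta>.img_is_subfield(1)[OF F.carrier_is_subfield] \<Theta>(2) by simp
  have "function_field_scalar V \<in> ring_hom L (function_field V)"
    using ring_hom_trans[OF s bidifferential_homD(1)[OF bidifferential_hom_to_frac[OF V(2,1)]]] .
  then interpret \<iota>: ring_hom_ring L "function_field V" "function_field_scalar V"
    by (rule ring_hom_ringI2[OF L.ring_axioms F.ring_axioms])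
  have k: "subfield (function_field_scalar V ` carrier L) (function_field V)"
    by (rule \<iota>.img_is_subfield(2)[OF L.carrier_is_subfield F.one_not_zero])
  have alg: "ring.algebraic K ((\<Theta> \<circ> function_field_scalar V) ` carrier L) (\<Theta> c) \<longleftrightarrow>
      ring.algebraic (function_field V) (function_field_scalar V ` carrier L) c"
    if "c \<in> carrier (function_field V)" for c
    using algebraic_image_iff[OF F.field_axioms K.field_axioms H(1) k that] unfolding image_comp .
  have con: "\<Theta> c \<in> constants K \<longleftrightarrow> c \<in> constants (function_field V)" if "c \<in> carrier (function_field V)" for c
    by (rule constants_iso_iff[OF F.cring_axioms K.cring_axioms \<Theta>(1) bij F.bidifferential_ring_axioms that])
  have "B_rational L V \<longleftrightarrow> (\<forall>c\<in>carrier (function_field V). c \<in> constants (function_field V) \<longrightarrow>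
      ring.algebraic (function_field V) (function_field_scalar V ` carrier L) c)"
    unfolding B_rational_def using V(2) by (auto simp: constants_def)
  also have "\<dots> \<longleftrightarrow> (\<forall>c\<in>\<Theta> ` carrier (function_field V). c \<in> constants K \<longrightarrow>
      ring.algebraic K ((\<Theta> \<circ> function_field_scalar V) ` carrier L) c)"
    using alg con by simp
  also have "\<dots> \<longleftrightarrow> (\<forall>c\<in>constants K. ring.algebraic K ((\<Theta> \<circ> function_field_scalar V) ` carrier L) c)"
    unfolding \<Theta>(2) by (auto simp: constants_def)
  finally show ?thesis .
qed

theorem proposition4p8:
  fixes k :: "'k bidiff_ring"
    and V :: "('k, 'a) B_var" and W :: "('k, 'b) B_var"
    and f :: "'b \<Rightarrow> 'a"
    and VL :: "(('b \<times> 'b) set, 't) B_var" and WL :: "(('b \<times> 'b) set, 'u) B_var"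
    and p :: "'a \<Rightarrow> 't" and q :: "'b \<Rightarrow> 'u"
    and fL :: "'u \<Rightarrow> 't" and \<alpha> :: "'u \<Rightarrow> ('b \<times> 'b) set"
  assumes "bidifferential_field k" and "char_zero k"
    and "irreducible_B_variety k V" and "irreducible_B_variety k W"
    and "B_morphism k V W f" and "dominant V W f"
    and "B_rational k W"
    and "generic_B_fibre k V W f (function_field W) (function_field_scalar W) VL p WL q fL \<alpha>"
    and "residue_field_pt k W (function_field W) (function_field_scalar W) q \<alpha>
      = carrier (function_field W)"
  shows "B_rational k V \<longleftrightarrow> B_rational (function_field W) (fibre (function_field W) VL WL fL \<alpha>)"
proof -
  let ?A = "coord_ring W" and ?B = "coord_ring V" and ?L = "function_field W" and ?K = "function_field V"
    and ?T = "coord_ring VL" and ?U = "coord_ring WL" and ?e = "function_field_scalar W"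
    and ?s = "scalar VL" and ?\<iota>A = "to_frac (coord_ring W)" and ?\<iota>B = "to_frac (coord_ring V)"
  have A: "domain ?A" "bidifferential_ring ?A" "scalar W \<in> ring_hom k ?A"
    and B: "domain ?B" "bidifferential_ring ?B" "scalar V \<in> ring_hom k ?B"
    using assms(3,4) by (simp_all add: irreducible_B_variety_def B_variety_def bidifferential_hom_def)
  have f: "bidifferential_hom ?A ?B f" and f_scalar: "\<And>c. c \<in> carrier k \<Longrightarrow> f (scalar W c) = scalar V c"
    using assms(5) by (simp_all add: B_morphism_def)
  note gen = assms(8)[unfolded generic_B_fibre_def compatible_base_extension_def B_morphism_def B_point_def point_def]
  have TV: "is_tensor_product k ?B (scalar V) ?L ?e ?T p ?s"
    and TW: "is_tensor_product k ?A (scalar W) ?L ?e ?U q (scalar WL)"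
    and bT: "bidifferential_ring ?T" and pbd: "bidifferential_hom ?B ?T p"
    and fL: "bidifferential_hom ?U ?T fL"
    and fLs: "\<And>c. c \<in> carrier ?L \<Longrightarrow> fL (scalar WL c) = ?s c"
    and fLq: "\<And>g. g \<in> carrier ?A \<Longrightarrow> fL (q g) = p (f g)"
    and \<alpha>: "\<alpha> \<in> ring_hom ?U ?L" and \<alpha>s: "\<And>c. c \<in> carrier ?L \<Longrightarrow> \<alpha> (scalar WL c) = c"
    and generic: "generic_point ?L W q \<alpha>"
    and Jsub: "B_subvariety VL (fibre_ideal ?L VL WL fL \<alpha>)"
    using gen by (simp_all only: simp_thms)
  interpret k: bidifferential_field k by (rule assms(1))
  interpret A: domain ?A by (rule A(1))
  interpret B: domain ?B by (rule B(1))
  interpret L: bidifferential_field ?L by (rule bidifferential_field_frac_bidiff[OF A(1,2)])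
  interpret K: bidifferential_field ?K by (rule bidifferential_field_frac_bidiff[OF B(1,2)])
  have T': "cring ?T" "p \<in> ring_hom ?B ?T" "?s \<in> ring_hom ?L ?T"
    using TV by (simp_all only: is_tensor_product_def)
  have U': "cring ?U" "q \<in> ring_hom ?A ?U" "scalar WL \<in> ring_hom ?L ?U"
    using TW by (simp_all only: is_tensor_product_def)
  interpret T: cring ?T by (rule T'(1))
  interpret U: cring ?U by (rule U'(1))
  note f' = bidifferential_homD(1)[OF f] and fL' = bidifferential_homD(1)[OF fL]
  have \<iota>A: "bidifferential_hom ?A ?L ?\<iota>A" and \<iota>B: "bidifferential_hom ?B ?K ?\<iota>B"
    by (rule bidifferential_hom_to_frac[OF A(1,2)], rule bidifferential_hom_to_frac[OF B(1,2)])
  note \<iota>A' = bidifferential_homD(1)[OF \<iota>A] and \<iota>B' = bidifferential_homD(1)[OF \<iota>B]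
  note scc = ring_hom_closed[OF A(3)] and sccV = ring_hom_closed[OF B(3)]
  have f_inj: "inj_on f (carrier ?A)"
    by (rule dominant_imp_inj[OF A.cring_axioms B(1) f' assms(6)])
  have \<iota>B_inj: "inj_on ?\<iota>B (carrier ?B)"
    by (rule inj_onI) (simp add: B.to_frac_eq_iff)
  have ec: "?e c \<in> carrier ?L" if "c \<in> carrier k" for c
    using ring_hom_closed[OF \<iota>A' scc[OF that]] by simp

  \<comment> \<open>The value at the point of a function on \<open>Y\<close>. Genericity makes this
    an embedding of \<open>A\<close> into \<open>L\<close>, possibly different from
    \<open>?\<iota>A\<close>.\<close>
  define \<sigma> where "\<sigma> a = \<alpha> (q a)" for a
  have \<sigma>: "\<sigma> \<in> ring_hom ?A ?L"
    using ring_hom_trans[OF U'(2) \<alpha>] by (simp only: comp_def \<sigma>_def[abs_def])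
  have \<sigma>_inj: "inj_on \<sigma> (carrier ?A)"
    unfolding \<sigma>_def[abs_def]
    by (rule generic_point_imp_inj[OF A.cring_axioms L.domain_axioms \<sigma>[unfolded \<sigma>_def[abs_def]] generic])
  have \<sigma>_scalar: "\<sigma> (scalar W c) = ?e c" if "c \<in> carrier k" for c
    using tensor_product_balanced[OF TW A.cring_axioms L.cring_axioms that scc[OF that] ec[OF that]] \<alpha>s[OF ec[OF that]]
    by (simp add: \<sigma>_def)
  \<comment> \<open>\<open>\<tau>\<close> measures how far \<open>\<sigma>\<close> is from the
    canonical embedding of \<open>A\<close>: it is the identity on \<open>L\<close> when the two
    coincide.\<close>
  obtain \<tau> where \<tau>: "\<tau> \<in> ring_hom (frac_ring ?A) ?L" and \<tau>\<iota>: "\<And>a. a \<in> carrier ?A \<Longrightarrow> \<tau> (?\<iota>A a) = \<sigma> a"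
    using frac_ring_hom_extend[OF A(1) L.field_axioms \<sigma> \<sigma>_inj] by metis
  have \<tau>': "\<tau> \<in> ring_hom ?L ?L" using \<tau> by (simp add: ring_hom_def)
  interpret \<tau>: ring_hom_ring ?L ?L \<tau> by (rule ring_hom_ringI2[OF L.ring_axioms L.ring_axioms \<tau>'])
  have \<tau>_inj: "inj_on \<tau> (carrier ?L)" and \<tau>_field: "subfield (\<tau> ` carrier ?L) ?L"
    using \<tau>.img_is_subfield[OF L.carrier_is_subfield L.one_not_zero] by blast+
  have \<sigma>_img: "\<sigma> a \<in> \<tau> ` carrier ?L" if "a \<in> carrier ?A" for a
    using \<tau>\<iota>[OF that] ring_hom_closed[OF \<iota>A' that] by (metis imageI)
  \<comment> \<open>The image of \<open>\<tau>\<close> is a subfield containing the generators of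
    \<open>k(\<alpha>)\<close>, which is all of \<open>L\<close>.\<close>
  have \<tau>_onto: "\<tau> ` carrier ?L = carrier ?L"
  proof
    show "\<tau> ` carrier ?L \<subseteq> carrier ?L" by (rule subfieldE(3)[OF \<tau>_field])
    have "?e ` carrier k \<union> (\<lambda>g. \<alpha> (q g)) ` carrier ?A \<subseteq> \<tau> ` carrier ?L"
    proof (intro Un_least image_subsetI)
      fix c assume c: "c \<in> carrier k"
      show "?e c \<in> \<tau> ` carrier ?L" using \<sigma>_img[OF scc[OF c]] by (simp only: \<sigma>_scalar[OF c])
    next
      fix g assume "g \<in> carrier ?A"
      then show "\<alpha> (q g) \<in> \<tau> ` carrier ?L" using \<sigma>_img by (simp only: \<sigma>_def)
    qed
    moreover from this have "?e ` carrier k \<union> (\<lambda>g. \<alpha> (q g)) ` carrier ?A \<subseteq> carrier ?L"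
      by (rule subset_trans[OF _ subfieldE(3)[OF \<tau>_field]])
    ultimately have "residue_field_pt k W ?L ?e q \<alpha> \<subseteq> \<tau> ` carrier ?L"
      unfolding residue_field_pt_def using L.generate_field_min_subfield1[OF _ \<tau>_field] by blast
    then show "carrier ?L \<subseteq> \<tau> ` carrier ?L" unfolding assms(9) .
  qed
  have frac: "\<exists>a\<in>carrier ?A. \<exists>d\<in>carrier ?A. d \<noteq> \<zero>\<^bsub>?A\<^esub> \<and> l \<otimes>\<^bsub>?L\<^esub> \<sigma> d = \<sigma> a" if "l \<in> carrier ?L" for l
    by (rule frac_ring_denominators[OF A(1) \<tau> _ \<tau>\<iota> that]) (use \<tau>_onto in simp_all)

  have \<iota>f: "bidifferential_hom ?A ?K (\<lambda>a. ?\<iota>B (f a))"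
  proof (rule bidifferential_homI)
    show "(\<lambda>a. ?\<iota>B (f a)) \<in> ring_hom ?A ?K" using ring_hom_trans[OF f' \<iota>B'] by (simp only: comp_def)
    show "?\<iota>B (f \<lbrace>x, y\<rbrace>\<^bsub>?A\<^esub>) = \<lbrace>?\<iota>B (f x), ?\<iota>B (f y)\<rbrace>\<^bsub>?K\<^esub>" if "x \<in> carrier ?A" "y \<in> carrier ?A" for x y
      using bidifferential_homD(2)[OF f that] bidifferential_homD(2)[OF \<iota>B, of "f x" "f y"]
        ring_hom_closed[OF f'] that by simp
  qed
  have \<iota>f_inj: "inj_on (\<lambda>a. ?\<iota>B (f a)) (carrier ?A)"
    using f_inj ring_hom_closed[OF f'] by (simp add: inj_on_def B.to_frac_eq_iff)
  obtain \<Phi> where \<Phi>: "bidifferential_hom ?L ?K \<Phi>" and \<Phi>\<iota>: "\<And>a. a \<in> carrier ?A \<Longrightarrow> \<Phi> (?\<iota>A a) = ?\<iota>B (f a)"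
    using frac_bidiff_hom_extend[OF A(1,2) K.bidifferential_field_axioms \<iota>f \<iota>f_inj] by metis
  note \<Phi>' = bidifferential_homD(1)[OF \<Phi>]

  \<comment> \<open>On the fibre the scalar \<open>\<sigma> a\<close> has to equal the function
    \<open>f a\<close>. Since \<open>\<Phi>\<close> sends \<open>?\<iota>A a\<close> to
    \<open>f a\<close> and \<open>\<tau>\<close> sends \<open>?\<iota>A a\<close> to
    \<open>\<sigma> a\<close>, undoing \<open>\<tau>\<close> before applying \<open>\<Phi>\<close>
    is the right embedding of the scalars.\<close>
  define \<chi> where "\<chi> = \<Phi> \<circ> inv_into (carrier ?L) \<tau>"
  have "\<tau> \<in> ring_iso ?L ?L"
    using \<tau>' \<tau>_inj \<tau>_onto by (simp add: ring_iso_def bij_betw_def)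
  then have \<tau>_inv: "inv_into (carrier ?L) \<tau> \<in> ring_iso ?L ?L"
    by (rule ring_iso_set_sym[OF L.ring_axioms])
  then have \<chi>: "\<chi> \<in> ring_hom ?L ?K"
    unfolding \<chi>_def ring_iso_def mem_Collect_eq by (intro ring_hom_trans[OF _ \<Phi>']) (rule conjunct1)
  have \<chi>_img: "\<chi> ` carrier ?L = \<Phi> ` carrier ?L"
    unfolding \<chi>_def image_comp[symmetric] bij_betw_imp_surj_on[OF ring_iso_memE(5)[OF \<tau>_inv]] ..
  have \<chi>\<sigma>: "\<chi> (\<sigma> a) = ?\<iota>B (f a)" if a: "a \<in> carrier ?A" for a
    using inv_into_f_f[OF \<tau>_inj ring_hom_closed[OF \<iota>A' a]] \<tau>\<iota>[OF a] \<Phi>\<iota>[OF a] by (simp add: \<chi>_def)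
  have "?\<iota>B (scalar V c) = \<chi> (?e c)" if c: "c \<in> carrier k" for c
    using \<chi>\<sigma>[OF scc[OF c]] by (simp only: \<sigma>_scalar[OF c] f_scalar[OF c])
  \<comment> \<open>\<open>\<psi>\<close> sends \<open>b \<otimes> l\<close> to
    \<open>b \<chi>(l)\<close>; its kernel will turn out to be the ideal of the fibre.\<close>
  then obtain \<psi> where \<psi>: "\<psi> \<in> ring_hom ?T ?K" and \<psi>p: "\<And>b. b \<in> carrier ?B \<Longrightarrow> \<psi> (p b) = ?\<iota>B b"
    and \<psi>s: "\<And>l. l \<in> carrier ?L \<Longrightarrow> \<psi> (?s l) = \<chi> l"
    using tensor_product_hom[OF TV B.cring_axioms L.cring_axioms K.cring_axioms sccV ec \<iota>B' \<chi>] by metis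
  have \<psi>p_inj: "inj_on (\<lambda>b. \<psi> (p b)) (carrier ?B)"
    using \<iota>B_inj \<psi>p by (simp add: inj_on_def)
  have \<psi>p_hom: "bidifferential_hom ?B ?K (\<lambda>b. \<psi> (p b))"
  proof (rule bidifferential_homI)
    show "(\<lambda>b. \<psi> (p b)) \<in> ring_hom ?B ?K" using ring_hom_trans[OF T'(2) \<psi>] by (simp only: comp_def)
    show "\<psi> (p \<lbrace>x, y\<rbrace>\<^bsub>?B\<^esub>) = \<lbrace>\<psi> (p x), \<psi> (p y)\<rbrace>\<^bsub>?K\<^esub>" if xy: "x \<in> carrier ?B" "y \<in> carrier ?B" for x y
      unfolding \<psi>p[OF xy(1)] \<psi>p[OF xy(2)] \<psi>p[OF bracket_closed[OF B(2) xy]]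
      by (rule bidifferential_homD(2)[OF \<iota>B xy])
  qed

  \<comment> \<open>\<open>I\<close> is generated by the equations of the fibre and \<open>J\<close>
    is its radical. Denominators are cleared modulo \<open>I\<close>, while the bidifferential
    property is available for \<open>J\<close>; the two turn out to coincide.\<close>
  define I where "I = Idl\<^bsub>?T\<^esub> (fL ` vanishing_ideal_pt ?L WL \<alpha>)"
  define J where "J = fibre_ideal ?L VL WL fL \<alpha>"
  have J_rad: "J = radical ?T I"
    by (simp add: J_def I_def fibre_ideal_def)
  have J_bd: "bidifferential_ideal ?T J"
    using Jsub by (simp add: B_subvariety_def J_def)
  \<comment> \<open>The homomorphisms \<open>\<psi> \<circ> fL\<close> and
    \<open>\<chi> \<circ> \<alpha>\<close> agree on functions from \<open>A\<close> and on scalars,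
    hence on all of \<open>L[Y]\<close>. So \<open>\<psi>\<close> kills the pullback of whatever
    vanishes at the point.\<close>
  have gens: "fL ` vanishing_ideal_pt ?L WL \<alpha> \<subseteq> a_kernel ?T ?K \<psi>"
  proof (rule image_subsetI)
    fix x assume "x \<in> vanishing_ideal_pt ?L WL \<alpha>"
    then have x: "x \<in> carrier ?U" "\<alpha> x = \<zero>\<^bsub>?L\<^esub>"
      unfolding vanishing_ideal_pt_def a_kernel_iff by (rule conjunct1, rule conjunct2)
    have "(\<psi> \<circ> fL) x = (\<chi> \<circ> \<alpha>) x"
    proof (rule tensor_product_hom_eqI[OF TW K.ring_axioms ring_hom_trans[OF fL' \<psi>] ring_hom_trans[OF \<alpha> \<chi>] _ _ x(1)])
      show "(\<psi> \<circ> fL) (q a) = (\<chi> \<circ> \<alpha>) (q a)" if "a \<in> carrier ?A" for a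
        using fLq[OF that] \<psi>p[OF ring_hom_closed[OF f' that]] \<chi>\<sigma>[OF that] by (simp add: \<sigma>_def)
      show "(\<psi> \<circ> fL) (scalar WL l) = (\<chi> \<circ> \<alpha>) (scalar WL l)" if "l \<in> carrier ?L" for l
        using fLs[OF that] \<alpha>s[OF that] \<psi>s[OF that] by simp
    qed
    also have "\<dots> = \<zero>\<^bsub>?K\<^esub>"
      using ring_hom_zero[OF \<chi> L.ring_axioms K.ring_axioms] x(2) by (simp only: comp_def)
    finally have "\<psi> (fL x) = \<zero>\<^bsub>?K\<^esub>" by (simp only: comp_def)
    then show "fL x \<in> a_kernel ?T ?K \<psi>"
      unfolding a_kernel_iff using ring_hom_closed[OF fL' x(1)] by (intro conjI)
  qed
  have ker: "radical_ideal ?T (a_kernel ?T ?K \<psi>)"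
    by (rule radical_ideal_kernel[OF T'(1) K.domain_axioms \<psi>])
  have gens_c: "fL ` vanishing_ideal_pt ?L WL \<alpha> \<subseteq> carrier ?T"
    using gens by (auto simp: a_kernel_iff)
  have I: "ideal I ?T" "I \<subseteq> a_kernel ?T ?K \<psi>"
    unfolding I_def using T.genideal_ideal[OF gens_c] T.genideal_minimal[OF _ gens] ker
    by (simp_all add: radical_ideal_def)
  have Id: "?s (\<sigma> a) \<ominus>\<^bsub>?T\<^esub> p (f a) \<in> I" if a: "a \<in> carrier ?A" for a
  proof -
    have \<sigma>a: "\<sigma> a \<in> carrier ?L" by (rule ring_hom_closed[OF \<sigma> a])
    have "fL (scalar WL (\<sigma> a)) \<ominus>\<^bsub>?T\<^esub> fL (q a) \<in> fL ` a_kernel ?U ?L \<alpha>"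
      by (rule ring_hom_kernel_differences[OF T'(1) U'(1) L.ring_axioms \<alpha> fL'
            ring_hom_closed[OF U'(3) \<sigma>a] ring_hom_closed[OF U'(2) a]])
        (rule trans[OF \<alpha>s[OF \<sigma>a] \<sigma>_def])
    then have "?s (\<sigma> a) \<ominus>\<^bsub>?T\<^esub> p (f a) \<in> fL ` vanishing_ideal_pt ?L WL \<alpha>"
      by (simp only: fLs[OF \<sigma>a] fLq[OF a] vanishing_ideal_pt_def)
    then show ?thesis
      unfolding I_def by (rule subsetD[OF T.genideal_self[OF gens_c]])
  qed
  \<comment> \<open>As the kernel of a map to a field, \<open>I\<close> is already radical, whence
    \<open>J = I\<close> in the next step.\<close>
  have I_ker: "I = a_kernel ?T ?K \<psi>"
    by (rule generic_fibre_kernel[OF TV A(1) B(1) L.field_axioms K.field_axioms f' \<sigma> \<sigma>_inj frac I Id \<psi> \<psi>p_inj])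
  have J_ker: "J = a_kernel ?T ?K \<psi>"
    using ker by (simp add: J_rad I_ker radical_ideal_def)
  \<comment> \<open>That the fibre is a B-subvariety enters here, through \<open>J_bd\<close>: it
    gives control of the brackets that involve scalars of \<open>L\<close>.\<close>
  have \<psi>bd: "bidifferential_hom ?T ?K \<psi>"
    by (rule generic_fibre_bidifferential_hom[OF TV A(1) B(1) L.field_axioms f' f_inj \<sigma> frac J_bd _ _ \<psi> \<psi>p_inj
          bT K.bidifferential_field_axioms pbd \<psi>p_hom B(2)])
      (use J_ker I_ker Id in simp_all)

  let ?C = "bidiff_quot ?T J"
  define Z where "Z = fibre ?L VL WL fL \<alpha>"
  have Z: "coord_ring Z = ?C" "scalar Z = (\<lambda>l. J +>\<^bsub>?T\<^esub> ?s l)"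
    by (simp_all add: Z_def fibre_def subvar_def J_def)
  obtain \<Psi> where \<Psi>: "bidifferential_hom ?C ?K \<Psi>" "inj_on \<Psi> (carrier ?C)"
    and \<Psi>c: "\<And>t. t \<in> carrier ?T \<Longrightarrow> \<Psi> (J +>\<^bsub>?T\<^esub> t) = \<psi> t"
    using bidiff_quot_kernel_hom[OF bT K.ring_axioms \<psi>bd J_ker J_bd] by metis
  have C: "bidifferential_ring ?C" by (rule bidifferential_ring_bidiff_quot[OF bT J_bd])
  then have C_dom: "domain ?C"
    using domain_of_inj_hom[OF _ K.domain_axioms bidifferential_homD(1)[OF \<Psi>(1)] \<Psi>(2)]
    by (simp add: bidifferential_ring_def)
  obtain \<Theta> where \<Theta>: "bidifferential_hom (frac_bidiff ?C) ?K \<Theta>"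
    and \<Theta>\<iota>: "\<And>c. c \<in> carrier ?C \<Longrightarrow> \<Theta> (to_frac ?C c) = \<Psi> c"
    using frac_bidiff_hom_extend[OF C_dom C K.bidifferential_field_axioms \<Psi>] by metis
  have J_ideal: "ideal J ?T" using J_bd by (simp add: bidifferential_ideal_def)
  have cos: "(+>\<^bsub>?T\<^esub>) J \<in> ring_hom ?T ?C"
    using ideal.rcos_ring_hom[OF J_ideal] by (simp add: ring_hom_def)
  have sZ: "scalar Z \<in> ring_hom ?L ?C"
    unfolding Z using ring_hom_trans[OF T'(3) cos] by (simp only: comp_def)
  have \<Theta>p: "\<Theta> (to_frac ?C (J +>\<^bsub>?T\<^esub> p b)) = ?\<iota>B b" if b: "b \<in> carrier ?B" for b
    using \<Theta>\<iota>[OF ring_hom_closed[OF cos ring_hom_closed[OF T'(2) b]]] \<Psi>c[OF ring_hom_closed[OF T'(2) b]] \<psi>p[OF b]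
    by simp
  \<comment> \<open>The image is a subfield of \<open>k(X)\<close> containing every
    \<open>?\<iota>B b\<close>, and each element of \<open>k(X)\<close> is a quotient of two of
    those.\<close>
  have \<Theta>_onto: "\<Theta> ` carrier (frac_bidiff ?C) = carrier ?K"
  proof -
    interpret F: bidifferential_field "frac_bidiff ?C" by (rule bidifferential_field_frac_bidiff[OF C_dom C])
    note \<Theta>' = bidifferential_homD(1)[OF \<Theta>]
    interpret \<Theta>: ring_hom_ring "frac_bidiff ?C" ?K \<Theta> by (rule ring_hom_ringI2[OF F.ring_axioms K.ring_axioms \<Theta>'])
    have sub: "subfield (\<Theta> ` carrier (frac_bidiff ?C)) ?K"
      by (rule \<Theta>.img_is_subfield(2)[OF F.carrier_is_subfield K.one_not_zero])
    have \<iota>_img: "?\<iota>B b \<in> \<Theta> ` carrier (frac_bidiff ?C)" if b: "b \<in> carrier ?B" for b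
      using \<Theta>p[OF b] ring_hom_closed[OF bidifferential_homD(1)[OF bidifferential_hom_to_frac[OF C_dom C]]
          ring_hom_closed[OF cos ring_hom_closed[OF T'(2) b]]] by (metis imageI)
    have "x \<in> \<Theta> ` carrier (frac_bidiff ?C)" if x: "x \<in> carrier ?K" for x
    proof -
      have "x \<in> carrier (frac_ring ?B)" using x by simp
      then obtain a b where ab: "a \<in> carrier ?B" "b \<in> carrier ?B" "b \<noteq> \<zero>\<^bsub>?B\<^esub>" "x \<otimes>\<^bsub>frac_ring ?B\<^esub> ?\<iota>B b = ?\<iota>B a"
        by (rule B.frac_ring_cases)
      have e: "x \<otimes>\<^bsub>?K\<^esub> ?\<iota>B b = ?\<iota>B a" using ab(4) by simp
      have nz: "?\<iota>B b \<in> carrier ?K - {\<zero>\<^bsub>?K\<^esub>}" using B.to_frac_nonzero[OF ab(2,3)] ab(2) by simp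
      then have i: "inv\<^bsub>?K\<^esub> (?\<iota>B b) \<in> \<Theta> ` carrier (frac_bidiff ?C)"
        using K.subfield_m_inv(1)[OF sub, of "?\<iota>B b"] \<iota>_img[OF ab(2)] by blast
      have u: "?\<iota>B b \<in> Units ?K" using nz by (simp only: K.field_Units)
      have "x = x \<otimes>\<^bsub>?K\<^esub> (?\<iota>B b \<otimes>\<^bsub>?K\<^esub> inv\<^bsub>?K\<^esub> (?\<iota>B b))"
        using K.Units_r_inv[OF u] K.r_one[OF x] by simp
      also have "\<dots> = ?\<iota>B a \<otimes>\<^bsub>?K\<^esub> inv\<^bsub>?K\<^esub> (?\<iota>B b)"
        unfolding e[symmetric] using K.m_assoc[OF x _ K.Units_inv_closed[OF u]] nz by simp
      finally show ?thesis
        using subringE(6)[OF subfieldE(1)[OF sub] \<iota>_img[OF ab(1)] i] by simp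
    qed
    then show ?thesis using subfieldE(3)[OF sub] by blast
  qed
  \<comment> \<open>The scalars of the fibre sit in \<open>k(X)\<close> through
    \<open>\<chi>\<close>; precomposing with the inverse of \<open>\<tau>\<close> does not change
    the image, so this subfield is the copy of \<open>k(Y)\<close>.\<close>
  have \<Theta>s: "(\<Theta> \<circ> function_field_scalar Z) ` carrier ?L = \<Phi> ` carrier ?L"
    unfolding \<chi>_img[symmetric]
  proof (rule image_cong[OF refl])
    fix l assume l: "l \<in> carrier ?L"
    show "(\<Theta> \<circ> function_field_scalar Z) l = \<chi> l"
      using \<Theta>\<iota>[OF ring_hom_closed[OF cos ring_hom_closed[OF T'(3) l]]] \<Psi>c[OF ring_hom_closed[OF T'(3) l]] \<psi>s[OF l]
      by (simp add: Z)
  qed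
  have fibre_iff: "B_rational ?L Z \<longleftrightarrow> (\<forall>c\<in>constants ?K. ring.algebraic ?K (\<Phi> ` carrier ?L) c)"
    unfolding \<Theta>s[symmetric]
    by (rule B_rational_iff[OF _ _ L.field_axioms K.bidifferential_field_axioms])
      (simp_all only: Z(1) C C_dom sZ \<Theta> \<Theta>_onto)

  have \<Phi>e: "\<Phi> ` ?e ` carrier k = function_field_scalar V ` carrier k"
    unfolding image_comp
    by (rule image_cong[OF refl]) (use \<Phi>\<iota>[OF scc] f_scalar in simp)
  have ek: "subfield (?e ` carrier k) ?L"
  proof -
    interpret e: ring_hom_ring k ?L ?e
      by (rule ring_hom_ringI2[OF k.ring_axioms L.ring_axioms ring_hom_trans[OF A(3) \<iota>A']])
    show ?thesis by (rule e.img_is_subfield(2)[OF k.carrier_is_subfield L.one_not_zero])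
  qed
  have W_rat: "ring.algebraic ?L (?e ` carrier k) c" if "c \<in> constants ?L" for c
    using assms(7) that by (simp add: B_rational_def)
  have V_iff: "B_rational k V \<longleftrightarrow> (\<forall>c\<in>constants ?K. ring.algebraic ?K (\<Phi> ` ?e ` carrier k) c)"
    unfolding \<Phi>e B_rational_def using B(1) by blast
  have sub: "\<Phi> ` ?e ` carrier k \<subseteq> \<Phi> ` carrier ?L"
    by (rule image_mono[OF subfieldE(3)[OF ek]])
  \<comment> \<open>Both sides now concern the constants of \<open>k(X)\<close>, over the images of
    \<open>k\<close> and of \<open>k(Y)\<close>. One implication is monotonicity in the coefficient
    field, the other is the descent of algebraicity along the minimal polynomial.\<close>
  show ?thesis
    unfolding Z_def[symmetric] fibre_iff V_iff
    using constants_algebraic_over_subfield[OF L.bidifferential_field_axioms K.bidifferential_field_axioms \<Phi> ek W_rat]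
      K.algebraic_mono[OF sub] unfolding over_def by blast
qed

end
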